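(* Let $\Bbbk$ be a commutative ring. Fix a triple $(\mathbb{X},\Gamma/{\sim})$ with path category $C$ and $\Bbbk$-linear path category $\mathcal{C}$, a screen $\mathfrak{P}$ of $(\mathbb{X},\Gamma/{\sim})$, and a path based ideal $\mathcal{I}$ in $\mathcal{C}$, with $\mathcal{A}=\mathcal{C}/\mathcal{I}$. Then: (1) The pixelation $C[\Sigma_{\mathfrak{P}}^{-1}]$ of $C$ is equivalent to $\overline{Q(C,\mathfrak{P})}$. (2) The pixelation $\overline{\mathcal{A}}^{\mathfrak{P}}[\Sigma_{\mathfrak{P}}^{-1}]$ of $\mathcal{A}$ is equivalent to $\overline{\mathcal{Q}(\mathcal{A},\mathfrak{P})}$.
   Context: TRIPLES. A path in a nonempty set $\mathbb{X}$ is any function $\gamma:[0,1]\to\mathbb{X}$; $\mathrm{im}(\gamma)$ is its image. If $\gamma(1)=\gamma'(0)$, then $\gamma\cdot\gamma'$ is the path equal to $\gamma(2t)$ for $0\le t\le\frac12$ and to $\gamma'(2t-1)$ for $\frac12\le t\le1$. A triple $(\mathbb{X},\Gamma/{\sim})$ consists of a nonempty set $\mathbb{X}$, a set $\Gamma$ of paths in $\mathbb{X}$, and an equivalence relation $\sim$ on $\Gamma$ (equivalent paths have the same endpoints) such that: (a) $\gamma,\gamma'\in\Gamma$ with $\gamma(1)=\gamma'(0)$ implies $\gamma\cdot\gamma'\in\Gamma$; (b) if $\gamma\in\Gamma$ and $\phi:[0,1]\to[0,1]$ is weakly order preserving and sends intervals to intervals, then $\gamma\circ\phi\in\Gamma$;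 (c) all constant paths are in $\Gamma$; (d) a path equivalent to a constant path is constant; (e) if in (b) also $\phi(0)=0$, $\phi(1)=1$, then $\gamma\sim\gamma\circ\phi$; (f) if $\gamma,\gamma',\rho,\rho'\in\Gamma$ and $\rho\cdot\gamma\cdot\rho'$, $\rho\cdot\gamma'\cdot\rho'$ are defined and in $\Gamma$, then $\gamma\sim\gamma'$ if and only if $\rho\cdot\gamma\cdot\rho'\sim\rho\cdot\gamma'\cdot\rho'$. The class of $\gamma$ is $[\gamma]$. SCREENS. A screen of $(\mathbb{X},\Gamma/{\sim})$ is a partition $\mathfrak{P}$ of $\mathbb{X}$, whose elements are called pixels, such that: (S1) if $\gamma,\gamma'\in\Gamma$ have the same start and the same end and $\mathrm{im}(\gamma)\subset\mathsf{X}\in\mathfrak{P}$, then $\gamma\sim\gamma'$ if and only if $\mathrm{im}(\gamma')\subset\mathsf{X}$; (S2) any two points $x,y$ of a pixel $\mathsf{X}$ are joined by a finite walk $\gamma_0\cdot\gamma_1^{-1}\cdot\gamma_2\cdots\gamma_{2n-1}^{-1}\cdot\gamma_{2n}$ from $x$ to $y$ (where $\gamma^{-1}$ is $\gamma$ run backwards) with all $\gamma_i\in\Gamma$ and $\mathrm{im}(\gamma_i)\subset\mathsf{X}$; (S3) if $\rho,\gamma\in\Gamma$, $\rho(0)=\gamma(0)$ and $\mathrm{im}(\rho)$ lies in a pixel, then there are $\rho',\gamma'\in\Gamma$ with $\mathrm{im}(\rho')$ in a pixel and $\gamma\cdot\rho'\sim\rho\cdot\gamma'$; dually, if $\rho',\gamma'\in\Gamma$,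 $\rho'(1)=\gamma'(1)$ and $\mathrm{im}(\rho')$ lies in a pixel, then there are $\rho,\gamma\in\Gamma$ with $\mathrm{im}(\rho)$ in a pixel and $\gamma\cdot\rho'\sim\rho\cdot\gamma'$; (S4) for every $\gamma\in\Gamma$ there are a finite partition $\{I_i\}_{i=1}^n$ of $[0,1]$ into subintervals (listed in increasing order) and pixels $(\mathsf{X}_1,\dots,\mathsf{X}_n)$ with $\gamma(I_i)\subset\mathsf{X}_i$, where for $i\ne j$ the equality $\mathsf{X}_i=\mathsf{X}_j$ is allowed only if $|i-j|>1$; (S5) if $\gamma,\gamma'\in\Gamma$ have the same start and the same end and admit the same partition $\{I_i\}$ and the same list of pixels as in (S4), then $\gamma\sim\gamma'$. PATH CATEGORIES. $C$ has objects the points of $\mathbb{X}$, $\mathrm{Hom}_C(x,y)=\{[\gamma]\mid\gamma\in\Gamma,\gamma(0)=x,\gamma(1)=y\}$, composition $[\gamma']\circ[\gamma]=[\gamma\cdot\gamma']$. $\mathcal{C}$ has objects $\mathbb{X}\sqcup\{0\}$ with $0$ a zero object, $\mathrm{Hom}_{\mathcal{C}}(x,y)$ the free $\Bbbk$-module on $\mathrm{Hom}_C(x,y)$ for $x,y\in\mathbb{X}$, and bilinear composition. An ideal of $\mathcal{C}$ is path based if it is generated by finite sums $\sum_i\lambda_i[\gamma_i]$ with $\gamma_i\in\Gamma$, each $\lambda_i\in\Bbbk$ not a zero divisor (the zero ideal is allowed). PIXELATIONS. In $C$, $\Sigma_{\mathfrak{P}}$ is the class of $[\rho]$ with $\mathrm{im}(\rho)$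 in a pixel; the pixelation of $C$ is $C[\Sigma_{\mathfrak{P}}^{-1}]$. For the linear case: paths $\gamma,\gamma'\in\Gamma$ are $\mathfrak{P}$-equivalent if there are $\rho_1,\dots,\rho_4\in\Gamma$ with $\mathrm{im}(\rho_1)\cup\mathrm{im}(\rho_2)$ in one pixel, $\mathrm{im}(\rho_3)\cup\mathrm{im}(\rho_4)$ in one pixel, and $\rho_1\cdot\gamma\cdot\rho_3\sim\rho_2\cdot\gamma'\cdot\rho_4$; morphisms $\sum_{i=1}^m\lambda_i[\gamma_i]$, $\sum_{i=1}^m\lambda'_i[\gamma'_i]$ are $\mathfrak{P}$-equivalent if, up to permutation, $\lambda_i=\lambda'_i$ and $\gamma_i,\gamma'_i$ are $\mathfrak{P}$-equivalent for all $i$; $\overline{\mathcal{I}}^{\mathfrak{P}}$ is the ideal generated by all $f$ that are $\mathfrak{P}$-equivalent to some $g\in\mathcal{I}$; $\overline{\mathcal{A}}^{\mathfrak{P}}=\mathcal{C}/\overline{\mathcal{I}}^{\mathfrak{P}}$. A pixel is pre-dead if it contains $\mathrm{im}(\rho)$ for some $\rho\in\Gamma$ with $[\rho]=0$ in $\mathcal{A}$. In $\overline{\mathcal{A}}^{\mathfrak{P}}$, $\Sigma_{\mathfrak{P}}$ consists of the $[\rho]\ne0$ with $\mathrm{im}(\rho)$ in a pixel and of the zero morphisms $x\to y$ with $x,y$ in a common pre-dead pixel. Both classes admit a two-sided calculus of fractions; the pixelation of $\mathcal{A}$ is $\overline{\mathcal{A}}^{\mathfrak{P}}[\Sigma_{\mathfrak{P}}^{-1}]$.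 A pixel is dead if it contains a point isomorphic to $0$ in $\overline{\mathcal{A}}^{\mathfrak{P}}[\Sigma_{\mathfrak{P}}^{-1}]$. CATEGORIES FROM QUIVERS. Choose a point $s_{\mathsf{X}}\in\mathsf{X}$ in each pixel. A pseudo arrow in $C[\Sigma_{\mathfrak{P}}^{-1}]$ is a morphism $[\rho]^{-1}[\gamma]$ with $[\rho]\in\Sigma_{\mathfrak{P}}$ such that $\gamma$ has a partition as in (S4) with exactly two elements; a pseudo arrow in $\overline{\mathcal{A}}^{\mathfrak{P}}[\Sigma_{\mathfrak{P}}^{-1}]$ is a nonzero morphism $\sigma^{-1}\lambda[\gamma]$ with $\sigma\in\Sigma_{\mathfrak{P}}$, $\lambda\in\Bbbk$ and $\gamma$ as before. $Q(C,\mathfrak{P})$ is the quiver with vertex set $\mathfrak{P}$ and arrows $\mathsf{X}\to\mathsf{Y}$ the pseudo arrows $s_{\mathsf{X}}\to s_{\mathsf{Y}}$ in $C[\Sigma_{\mathfrak{P}}^{-1}]$ (at most one). Let $\Psi$ be the functor from the free category on $Q(C,\mathfrak{P})$ to $C[\Sigma_{\mathfrak{P}}^{-1}]$, $\mathsf{X}\mapsto s_{\mathsf{X}}$, sending each arrow to its pseudo arrow; $\overline{Q(C,\mathfrak{P})}$ is the quotient of the free category identifying parallel $f,g$ with $\Psi(f)=\Psi(g)$. $Q(\mathcal{A},\mathfrak{P})$ is the quiver with vertices the non-dead pixels and arrows $\mathsf{X}\to\mathsf{Y}$ the pseudo arrows $s_{\mathsf{X}}\to s_{\mathsf{Y}}$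 in $\overline{\mathcal{A}}^{\mathfrak{P}}[\Sigma_{\mathfrak{P}}^{-1}]$ modulo nonzero scalars (at most one). $\mathcal{Q}(\mathcal{A},\mathfrak{P})$ is the free $\Bbbk$-linear category on it together with a zero object; $\Phi:\mathcal{Q}(\mathcal{A},\mathfrak{P})\to\overline{\mathcal{A}}^{\mathfrak{P}}[\Sigma_{\mathfrak{P}}^{-1}]$ is the $\Bbbk$-linear functor $\mathsf{X}\mapsto s_{\mathsf{X}}$ sending each arrow to the corresponding pseudo arrow of the form $[\rho]^{-1}[\gamma]$; and $\overline{\mathcal{Q}(\mathcal{A},\mathfrak{P})}=\mathcal{Q}(\mathcal{A},\mathfrak{P})/\mathcal{J}$ with $\mathcal{J}=\{f\mid\Phi(f)=0\}$.
   Formalization: Arrows X→Y are pseudo arrows w→s_Y precomposed with inverses of Σ-maps w→s_X (w in the pixel X), since those starting at s_X alone may not suffice; "at most one" is not imposed, and in the linear case all nonzero [ρ]^{-1}[γ] replace classes modulo nonzero scalars. *)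

theory Defs
  imports
    "HOL-Analysis.Topology_Euclidean_Space"
    "HOL-Library.FuncSet"
    "HOL-Library.Disjoint_Sets"
    "HOL-Library.Poly_Mapping"
    "HOL-Algebra.Module"
    "Graph_Theory.Digraph"
    "Graph_Theory.Arc_Walk"
begin

section \<open>Categories\<close>

text \<open>
  The operations are indexed by objects and hom-sets need not be disjoint, so that for
  instance zero morphisms between different pairs of objects may be the same HOL value.
  The composite \<open>Comp C x y z g f\<close> is ``\<open>g\<close> after \<open>f\<close>'', for \<open>f : x \<rightarrow> y\<close> and \<open>g : y \<rightarrow> z\<close>.
\<close>

record ('o, 'm) cat =
  Obj :: "'o set"
  Hom :: "'o \<Rightarrow> 'o \<Rightarrow> 'm set"
  Comp :: "'o \<Rightarrow> 'o \<Rightarrow> 'o \<Rightarrow> 'm \<Rightarrow> 'm \<Rightarrow> 'm"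
  Ident :: "'o \<Rightarrow> 'm"

record ('o, 'm, 'k) lincat = "('o, 'm) cat" +
  HZero :: "'o \<Rightarrow> 'o \<Rightarrow> 'm"
  HAdd :: "'o \<Rightarrow> 'o \<Rightarrow> 'm \<Rightarrow> 'm \<Rightarrow> 'm"
  HScale :: "'o \<Rightarrow> 'o \<Rightarrow> 'k \<Rightarrow> 'm \<Rightarrow> 'm"

locale category =
  fixes C :: "('o, 'm, 'z) cat_scheme"
  assumes Ident_in: "x \<in> Obj C \<Longrightarrow> Ident C x \<in> Hom C x x"
    and Comp_in: "\<lbrakk>x \<in> Obj C; y \<in> Obj C; z \<in> Obj C; f \<in> Hom C x y; g \<in> Hom C y z\<rbrakk>
      \<Longrightarrow> Comp C x y z g f \<in> Hom C x z"
    and Comp_Ident_right: "\<lbrakk>x \<in> Obj C; y \<in> Obj C; f \<in> Hom C x y\<rbrakk> \<Longrightarrow> Comp C x x y f (Ident C x) = f"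
    and Comp_Ident_left: "\<lbrakk>x \<in> Obj C; y \<in> Obj C; f \<in> Hom C x y\<rbrakk> \<Longrightarrow> Comp C x y y (Ident C y) f = f"
    and Comp_assoc: "\<lbrakk>w \<in> Obj C; x \<in> Obj C; y \<in> Obj C; z \<in> Obj C;
        f \<in> Hom C w x; g \<in> Hom C x y; h \<in> Hom C y z\<rbrakk>
      \<Longrightarrow> Comp C w y z h (Comp C w x y g f) = Comp C w x z (Comp C x y z h g) f"

text \<open>
  Commutative unital rings are rendered by the sort \<open>{comm_ring, comm_monoid_mult}\<close>; unlike
  \<open>comm_ring_1\<close>, it does not exclude the zero ring.
\<close>

definition scalar_ring :: "'k::{comm_ring,comm_monoid_mult} ring" where
  "scalar_ring = \<lparr>carrier = UNIV, monoid.mult = (*), one = 1, ring.zero = 0, add = (+)\<rparr>"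

definition hom_module :: "('o, 'm, 'k, 'z) lincat_scheme \<Rightarrow> 'o \<Rightarrow> 'o \<Rightarrow> ('k, 'm) module" where
  "hom_module A x y = \<lparr>carrier = Hom A x y, monoid.mult = undefined, one = undefined,
     ring.zero = HZero A x y, add = HAdd A x y, smult = HScale A x y\<rparr>"

locale lin_category = category A
  for A :: "('o, 'm, 'k::{comm_ring,comm_monoid_mult}, 'z) lincat_scheme" +
  assumes module_Hom: "\<lbrakk>x \<in> Obj A; y \<in> Obj A\<rbrakk> \<Longrightarrow> Module.module scalar_ring (hom_module A x y)"
    and Comp_add_right: "\<lbrakk>x \<in> Obj A; y \<in> Obj A; z \<in> Obj A; f \<in> Hom A x y; f' \<in> Hom A x y; g \<in> Hom A y z\<rbrakk>
      \<Longrightarrow> Comp A x y z g (HAdd A x y f f') = HAdd A x z (Comp A x y z g f) (Comp A x y z g f')"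
    and Comp_add_left: "\<lbrakk>x \<in> Obj A; y \<in> Obj A; z \<in> Obj A; f \<in> Hom A x y; g \<in> Hom A y z; g' \<in> Hom A y z\<rbrakk>
      \<Longrightarrow> Comp A x y z (HAdd A y z g g') f = HAdd A x z (Comp A x y z g f) (Comp A x y z g' f)"
    and Comp_scale_right: "\<lbrakk>x \<in> Obj A; y \<in> Obj A; z \<in> Obj A; f \<in> Hom A x y; g \<in> Hom A y z\<rbrakk>
      \<Longrightarrow> Comp A x y z g (HScale A x y c f) = HScale A x z c (Comp A x y z g f)"
    and Comp_scale_left: "\<lbrakk>x \<in> Obj A; y \<in> Obj A; z \<in> Obj A; f \<in> Hom A x y; g \<in> Hom A y z\<rbrakk>
      \<Longrightarrow> Comp A x y z (HScale A y z c g) f = HScale A x z c (Comp A x y z g f)"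

definition iso_mor :: "('o, 'm, 'z) cat_scheme \<Rightarrow> 'o \<Rightarrow> 'o \<Rightarrow> 'm \<Rightarrow> bool" where
  "iso_mor C x y f \<longleftrightarrow> f \<in> Hom C x y \<and>
     (\<exists>g\<in>Hom C y x. Comp C x y x g f = Ident C x \<and> Comp C y x y f g = Ident C y)"

definition isomorphic_objs :: "('o, 'm, 'z) cat_scheme \<Rightarrow> 'o \<Rightarrow> 'o \<Rightarrow> bool" where
  "isomorphic_objs C x y \<longleftrightarrow> (\<exists>f. iso_mor C x y f)"

locale is_functor = C: category C + D: category D
  for C :: "('o, 'm, 'z) cat_scheme" and D :: "('p, 'n, 'y) cat_scheme" +
  fixes FO :: "'o \<Rightarrow> 'p" and FM :: "'o \<Rightarrow> 'o \<Rightarrow> 'm \<Rightarrow> 'n"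
  assumes FO_in: "x \<in> Obj C \<Longrightarrow> FO x \<in> Obj D"
    and FM_in: "\<lbrakk>x \<in> Obj C; y \<in> Obj C; f \<in> Hom C x y\<rbrakk> \<Longrightarrow> FM x y f \<in> Hom D (FO x) (FO y)"
    and FM_Ident: "x \<in> Obj C \<Longrightarrow> FM x x (Ident C x) = Ident D (FO x)"
    and FM_Comp: "\<lbrakk>x \<in> Obj C; y \<in> Obj C; z \<in> Obj C; f \<in> Hom C x y; g \<in> Hom C y z\<rbrakk>
      \<Longrightarrow> FM x z (Comp C x y z g f) = Comp D (FO x) (FO y) (FO z) (FM y z g) (FM x y f)"

locale is_lin_functor = is_functor C D FO FM + C: lin_category C + D: lin_category D
  for C :: "('o, 'm, 'k::{comm_ring,comm_monoid_mult}, 'z) lincat_scheme"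
    and D :: "('p, 'n, 'k, 'y) lincat_scheme" and FO FM +
  assumes FM_add: "\<lbrakk>x \<in> Obj C; y \<in> Obj C; f \<in> Hom C x y; g \<in> Hom C x y\<rbrakk>
      \<Longrightarrow> FM x y (HAdd C x y f g) = HAdd D (FO x) (FO y) (FM x y f) (FM x y g)"
    and FM_scale: "\<lbrakk>x \<in> Obj C; y \<in> Obj C; f \<in> Hom C x y\<rbrakk>
      \<Longrightarrow> FM x y (HScale C x y c f) = HScale D (FO x) (FO y) c (FM x y f)"

definition nat_iso ::
  "('o, 'm, 'z) cat_scheme \<Rightarrow> ('p, 'n, 'y) cat_scheme \<Rightarrow> ('o \<Rightarrow> 'p) \<Rightarrow> ('o \<Rightarrow> 'o \<Rightarrow> 'm \<Rightarrow> 'n)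
    \<Rightarrow> ('o \<Rightarrow> 'p) \<Rightarrow> ('o \<Rightarrow> 'o \<Rightarrow> 'm \<Rightarrow> 'n) \<Rightarrow> ('o \<Rightarrow> 'n) \<Rightarrow> bool" where
  "nat_iso C D FO FM GO GM \<eta> \<longleftrightarrow>
     (\<forall>x\<in>Obj C. iso_mor D (FO x) (GO x) (\<eta> x)) \<and>
     (\<forall>x\<in>Obj C. \<forall>y\<in>Obj C. \<forall>f\<in>Hom C x y.
        Comp D (FO x) (FO y) (GO y) (\<eta> y) (FM x y f) = Comp D (FO x) (GO x) (GO y) (GM x y f) (\<eta> x))"

definition quasi_inverse ::
  "('o, 'm, 'z) cat_scheme \<Rightarrow> ('p, 'n, 'y) cat_scheme \<Rightarrow> ('o \<Rightarrow> 'p) \<Rightarrow> ('o \<Rightarrow> 'o \<Rightarrow> 'm \<Rightarrow> 'n)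
    \<Rightarrow> ('p \<Rightarrow> 'o) \<Rightarrow> ('p \<Rightarrow> 'p \<Rightarrow> 'n \<Rightarrow> 'm) \<Rightarrow> bool" where
  "quasi_inverse C D FO FM GO GM \<longleftrightarrow>
     (\<exists>\<eta>. nat_iso C C (\<lambda>x. x) (\<lambda>x y f. f) (\<lambda>x. GO (FO x)) (\<lambda>x y f. GM (FO x) (FO y) (FM x y f)) \<eta>) \<and>
     (\<exists>\<epsilon>. nat_iso D D (\<lambda>u. FO (GO u)) (\<lambda>u v g. FM (GO u) (GO v) (GM u v g)) (\<lambda>u. u) (\<lambda>u v g. g) \<epsilon>)"

definition equivalent_cats :: "('o, 'm, 'z) cat_scheme \<Rightarrow> ('p, 'n, 'y) cat_scheme \<Rightarrow> bool" where
  "equivalent_cats C D \<longleftrightarrow>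
     (\<exists>FO FM GO GM. is_functor C D FO FM \<and> is_functor D C GO GM \<and> quasi_inverse C D FO FM GO GM)"

definition equivalent_lincats ::
  "('o, 'm, 'k::{comm_ring,comm_monoid_mult}, 'z) lincat_scheme \<Rightarrow> ('p, 'n, 'k, 'y) lincat_scheme \<Rightarrow> bool" where
  "equivalent_lincats C D \<longleftrightarrow>
     (\<exists>FO FM GO GM. is_lin_functor C D FO FM \<and> is_lin_functor D C GO GM \<and> quasi_inverse C D FO FM GO GM)"

subsection \<open>Quotients\<close>

definition rep :: "'a set \<Rightarrow> 'a" where
  "rep K = (SOME a. a \<in> K)"

definition cat_congruence :: "('o, 'm, 'z) cat_scheme \<Rightarrow> ('o \<Rightarrow> 'o \<Rightarrow> 'm rel) \<Rightarrow> bool" where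
  "cat_congruence C E \<longleftrightarrow>
     (\<forall>x\<in>Obj C. \<forall>y\<in>Obj C. equiv (Hom C x y) (E x y)) \<and>
     (\<forall>x\<in>Obj C. \<forall>y\<in>Obj C. \<forall>z\<in>Obj C. \<forall>f f' g g'. (f, f') \<in> E x y \<longrightarrow> (g, g') \<in> E y z \<longrightarrow>
        (Comp C x y z g f, Comp C x y z g' f') \<in> E x z)"

definition generated_congruence ::
  "('o, 'm, 'z) cat_scheme \<Rightarrow> ('o \<Rightarrow> 'o \<Rightarrow> 'm \<Rightarrow> 'm \<Rightarrow> bool) \<Rightarrow> 'o \<Rightarrow> 'o \<Rightarrow> 'm rel" where
  "generated_congruence C S x y = {(f, g). f \<in> Hom C x y \<and> g \<in> Hom C x y \<and>
     (\<forall>E. cat_congruence C E \<and> (\<forall>u\<in>Obj C. \<forall>v\<in>Obj C. \<forall>p q. S u v p q \<longrightarrow> (p, q) \<in> E u v)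
        \<longrightarrow> (f, g) \<in> E x y)}"

definition quotient_cat :: "('o, 'm, 'z) cat_scheme \<Rightarrow> ('o \<Rightarrow> 'o \<Rightarrow> 'm rel) \<Rightarrow> ('o, 'm set) cat" where
  "quotient_cat C E = \<lparr>Obj = Obj C,
     Hom = \<lambda>x y. Hom C x y // E x y,
     Comp = \<lambda>x y z G F. E x z `` {Comp C x y z (rep G) (rep F)},
     Ident = \<lambda>x. E x x `` {Ident C x}\<rparr>"

definition lin_ideal :: "('o, 'm, 'k, 'z) lincat_scheme \<Rightarrow> ('o \<Rightarrow> 'o \<Rightarrow> 'm set) \<Rightarrow> bool" where
  "lin_ideal A I \<longleftrightarrow>
     (\<forall>x\<in>Obj A. \<forall>y\<in>Obj A. I x y \<subseteq> Hom A x y \<and> HZero A x y \<in> I x y \<and>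
        (\<forall>f\<in>I x y. \<forall>g\<in>I x y. HAdd A x y f g \<in> I x y) \<and> (\<forall>c. \<forall>f\<in>I x y. HScale A x y c f \<in> I x y)) \<and>
     (\<forall>x\<in>Obj A. \<forall>y\<in>Obj A. \<forall>z\<in>Obj A.
        (\<forall>f\<in>I x y. \<forall>g\<in>Hom A y z. Comp A x y z g f \<in> I x z) \<and>
        (\<forall>f\<in>Hom A x y. \<forall>g\<in>I y z. Comp A x y z g f \<in> I x z))"

definition generated_ideal ::
  "('o, 'm, 'k, 'z) lincat_scheme \<Rightarrow> ('o \<Rightarrow> 'o \<Rightarrow> 'm set) \<Rightarrow> 'o \<Rightarrow> 'o \<Rightarrow> 'm set" where
  "generated_ideal A S x y = {f \<in> Hom A x y.
     \<forall>J. lin_ideal A J \<and> (\<forall>u\<in>Obj A. \<forall>v\<in>Obj A. S u v \<subseteq> J u v) \<longrightarrow> f \<in> J x y}"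

definition ideal_rel :: "('o, 'm, 'k, 'z) lincat_scheme \<Rightarrow> ('o \<Rightarrow> 'o \<Rightarrow> 'm set) \<Rightarrow> 'o \<Rightarrow> 'o \<Rightarrow> 'm rel" where
  "ideal_rel A I x y = {(f, g). f \<in> Hom A x y \<and> g \<in> Hom A x y \<and> (\<exists>i\<in>I x y. g = HAdd A x y f i)}"

definition quotient_lincat ::
  "('o, 'm, 'k, 'z) lincat_scheme \<Rightarrow> ('o \<Rightarrow> 'o \<Rightarrow> 'm set) \<Rightarrow> ('o, 'm set, 'k) lincat" where
  "quotient_lincat A I = (let E = ideal_rel A I; Q = quotient_cat A E in
     \<lparr>Obj = Obj Q, Hom = Hom Q, Comp = Comp Q, Ident = Ident Q,
      HZero = \<lambda>x y. E x y `` {HZero A x y},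
      HAdd = \<lambda>x y F G. E x y `` {HAdd A x y (rep F) (rep G)},
      HScale = \<lambda>x y c F. E x y `` {HScale A x y c (rep F)}\<rparr>)"

subsection \<open>Free categories and linearization\<close>

definition quiver :: "'v set \<Rightarrow> ('v \<Rightarrow> 'v \<Rightarrow> 'a set) \<Rightarrow> ('v, 'v \<times> 'a \<times> 'v) pre_digraph" where
  "quiver V Arr = \<lparr>verts = V, arcs = {(u, a, v). u \<in> V \<and> v \<in> V \<and> a \<in> Arr u v},
     tail = fst, head = snd \<circ> snd\<rparr>"

definition free_cat :: "('v, 'e) pre_digraph \<Rightarrow> ('v, 'e list) cat" where
  "free_cat G = \<lparr>Obj = verts G, Hom = \<lambda>u v. {p. pre_digraph.awalk G u p v},
     Comp = \<lambda>u v w q p. p @ q, Ident = \<lambda>u. []\<rparr>"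

text \<open>
  \<open>free_functor D oo v\<close> extends \<open>u \<mapsto> oo u\<close>, \<open>(u, a, w) \<mapsto> a : oo u \<rightarrow> oo w\<close> to the walks
  with end \<open>v\<close> in a quiver whose arrows are morphisms of \<open>D\<close>.
\<close>

fun free_functor :: "('o, 'm, 'z) cat_scheme \<Rightarrow> ('v \<Rightarrow> 'o) \<Rightarrow> 'v \<Rightarrow> ('v \<times> 'm \<times> 'v) list \<Rightarrow> 'm" where
  "free_functor D oo v [] = Ident D (oo v)"
| "free_functor D oo v ((u, a, w) # p) = Comp D (oo u) (oo w) (oo v) (free_functor D oo v p) a"

text \<open>The \<open>\<Bbbk>\<close>-linear category whose hom-modules are free on the hom-sets of \<open>C\<close>.\<close>

definition linearization ::
  "('o, 'm, 'z) cat_scheme \<Rightarrow> ('o, 'm \<Rightarrow>\<^sub>0 'k::{comm_ring,comm_monoid_mult}, 'k) lincat" where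
  "linearization C = \<lparr>Obj = Obj C,
     Hom = \<lambda>x y. {f. Poly_Mapping.keys f \<subseteq> Hom C x y},
     Comp = \<lambda>x y z g f. \<Sum>a\<in>Poly_Mapping.keys f. \<Sum>b\<in>Poly_Mapping.keys g.
       Poly_Mapping.single (Comp C x y z b a) (Poly_Mapping.lookup g b * Poly_Mapping.lookup f a),
     Ident = \<lambda>x. Poly_Mapping.single (Ident C x) 1,
     HZero = \<lambda>x y. 0,
     HAdd = \<lambda>x y. (+),
     HScale = \<lambda>x y c. Poly_Mapping.map ((*) c)\<rparr>"

text \<open>The new zero object is \<open>None\<close>.\<close>

definition adjoin_zero :: "('o, 'm::zero, 'k) lincat \<Rightarrow> ('o option, 'm, 'k) lincat" where
  "adjoin_zero A = \<lparr>Obj = insert None (Some ` Obj A),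
     Hom = \<lambda>u v. case (u, v) of (Some x, Some y) \<Rightarrow> Hom A x y | _ \<Rightarrow> {0},
     Comp = \<lambda>u v w g f. case (u, v, w) of (Some x, Some y, Some z) \<Rightarrow> Comp A x y z g f | _ \<Rightarrow> 0,
     Ident = \<lambda>u. case u of Some x \<Rightarrow> Ident A x | None \<Rightarrow> 0,
     HZero = \<lambda>u v. case (u, v) of (Some x, Some y) \<Rightarrow> HZero A x y | _ \<Rightarrow> 0,
     HAdd = \<lambda>u v f g. case (u, v) of (Some x, Some y) \<Rightarrow> HAdd A x y f g | _ \<Rightarrow> 0,
     HScale = \<lambda>u v c f. case (u, v) of (Some x, Some y) \<Rightarrow> HScale A x y c f | _ \<Rightarrow> 0\<rparr>"

subsection \<open>Localization\<close>

text \<open>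
  The Gabriel--Zisman localization at a family \<open>\<Sigma> x y \<subseteq> Hom C x y\<close>: words in the morphisms
  (\<open>Inl\<close>) and formal inverses (\<open>Inr s : y \<rightarrow> x\<close> for \<open>s \<in> \<Sigma> x y\<close>), modulo the evident relations.
  When \<open>\<Sigma>\<close> admits a calculus of fractions this is the category of fractions.
\<close>

type_synonym ('o, 'm) zigzag = "('o \<times> ('m + 'm) \<times> 'o) list"

definition zigzag_quiver ::
  "('o, 'm, 'z) cat_scheme \<Rightarrow> ('o \<Rightarrow> 'o \<Rightarrow> 'm set) \<Rightarrow> ('o, 'o \<times> ('m + 'm) \<times> 'o) pre_digraph" where
  "zigzag_quiver C \<Sigma> = quiver (Obj C) (\<lambda>x y. Inl ` Hom C x y \<union> Inr ` \<Sigma> y x)"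

inductive loc_rel ::
  "('o, 'm, 'z) cat_scheme \<Rightarrow> ('o \<Rightarrow> 'o \<Rightarrow> 'm set) \<Rightarrow> 'o \<Rightarrow> 'o
    \<Rightarrow> ('o, 'm) zigzag \<Rightarrow> ('o, 'm) zigzag \<Rightarrow> bool"
  for C \<Sigma> where
  comp: "\<lbrakk>x \<in> Obj C; y \<in> Obj C; z \<in> Obj C; f \<in> Hom C x y; g \<in> Hom C y z\<rbrakk> \<Longrightarrow>
    loc_rel C \<Sigma> x z [(x, Inl f, y), (y, Inl g, z)] [(x, Inl (Comp C x y z g f), z)]"
| ident: "x \<in> Obj C \<Longrightarrow> loc_rel C \<Sigma> x x [(x, Inl (Ident C x), x)] []"
| inv_left: "\<lbrakk>x \<in> Obj C; y \<in> Obj C; s \<in> \<Sigma> x y\<rbrakk> \<Longrightarrow> loc_rel C \<Sigma> x x [(x, Inl s, y), (y, Inr s, x)] []"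
| inv_right: "\<lbrakk>x \<in> Obj C; y \<in> Obj C; s \<in> \<Sigma> x y\<rbrakk> \<Longrightarrow> loc_rel C \<Sigma> y y [(y, Inr s, x), (x, Inl s, y)] []"

definition loc_congruence ::
  "('o, 'm, 'z) cat_scheme \<Rightarrow> ('o \<Rightarrow> 'o \<Rightarrow> 'm set) \<Rightarrow> 'o \<Rightarrow> 'o \<Rightarrow> ('o, 'm) zigzag rel" where
  "loc_congruence C \<Sigma> = generated_congruence (free_cat (zigzag_quiver C \<Sigma>)) (loc_rel C \<Sigma>)"

definition localization ::
  "('o, 'm, 'z) cat_scheme \<Rightarrow> ('o \<Rightarrow> 'o \<Rightarrow> 'm set) \<Rightarrow> ('o, ('o, 'm) zigzag set) cat" where
  "localization C \<Sigma> = quotient_cat (free_cat (zigzag_quiver C \<Sigma>)) (loc_congruence C \<Sigma>)"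

text \<open>The images in the localization of \<open>f : x \<rightarrow> y\<close>, and of the inverse of \<open>s : x \<rightarrow> y\<close>.\<close>

definition loc_mor ::
  "('o, 'm, 'z) cat_scheme \<Rightarrow> ('o \<Rightarrow> 'o \<Rightarrow> 'm set)
    \<Rightarrow> 'o \<Rightarrow> 'o \<Rightarrow> 'm \<Rightarrow> ('o, 'm) zigzag set" where
  "loc_mor C \<Sigma> x y f = loc_congruence C \<Sigma> x y `` {[(x, Inl f, y)]}"

definition loc_inv ::
  "('o, 'm, 'z) cat_scheme \<Rightarrow> ('o \<Rightarrow> 'o \<Rightarrow> 'm set)
    \<Rightarrow> 'o \<Rightarrow> 'o \<Rightarrow> 'm \<Rightarrow> ('o, 'm) zigzag set" where
  "loc_inv C \<Sigma> x y s = loc_congruence C \<Sigma> y x `` {[(y, Inr s, x)]}"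

text \<open>
  The localization of a \<open>\<Bbbk>\<close>-linear category: linear combinations of words, modulo the relations
  above and linearity of the localization functor. It has the universal property among \<open>\<Bbbk>\<close>-linear
  functors inverting \<open>\<Sigma>\<close>; when \<open>\<Sigma>\<close> admits a calculus of fractions, it is the category of
  fractions with its unique linear structure that makes the localization functor linear.
\<close>

inductive_set lin_loc_rel ::
  "('o, 'm, 'k::{comm_ring,comm_monoid_mult}) lincat \<Rightarrow> ('o \<Rightarrow> 'o \<Rightarrow> 'm set) \<Rightarrow> 'o \<Rightarrow> 'o
    \<Rightarrow> (('o, 'm) zigzag \<Rightarrow>\<^sub>0 'k) set"
  for A \<Sigma> x y where
  loc: "loc_rel A \<Sigma> x y p q \<Longrightarrow>
    Poly_Mapping.single p 1 - Poly_Mapping.single q 1 \<in> lin_loc_rel A \<Sigma> x y"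
| add: "\<lbrakk>f \<in> Hom A x y; g \<in> Hom A x y\<rbrakk> \<Longrightarrow>
    Poly_Mapping.single [(x, Inl (HAdd A x y f g), y)] 1
      - Poly_Mapping.single [(x, Inl f, y)] 1 - Poly_Mapping.single [(x, Inl g, y)] 1
      \<in> lin_loc_rel A \<Sigma> x y"
| scale: "f \<in> Hom A x y \<Longrightarrow>
    Poly_Mapping.single [(x, Inl (HScale A x y c f), y)] 1 - Poly_Mapping.single [(x, Inl f, y)] c
      \<in> lin_loc_rel A \<Sigma> x y"

definition lin_loc_ideal ::
  "('o, 'm, 'k::{comm_ring,comm_monoid_mult}) lincat \<Rightarrow> ('o \<Rightarrow> 'o \<Rightarrow> 'm set)
    \<Rightarrow> 'o \<Rightarrow> 'o \<Rightarrow> (('o, 'm) zigzag \<Rightarrow>\<^sub>0 'k) set" where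
  "lin_loc_ideal A \<Sigma> =
     generated_ideal (linearization (free_cat (zigzag_quiver A \<Sigma>))) (lin_loc_rel A \<Sigma>)"

definition lin_localization ::
  "('o, 'm, 'k::{comm_ring,comm_monoid_mult}) lincat \<Rightarrow> ('o \<Rightarrow> 'o \<Rightarrow> 'm set)
    \<Rightarrow> ('o, (('o, 'm) zigzag \<Rightarrow>\<^sub>0 'k) set, 'k) lincat" where
  "lin_localization A \<Sigma> =
     quotient_lincat (linearization (free_cat (zigzag_quiver A \<Sigma>))) (lin_loc_ideal A \<Sigma>)"

definition lin_loc_class ::
  "('o, 'm, 'k::{comm_ring,comm_monoid_mult}) lincat \<Rightarrow> ('o \<Rightarrow> 'o \<Rightarrow> 'm set)
    \<Rightarrow> 'o \<Rightarrow> 'o \<Rightarrow> ('o, 'm) zigzag \<Rightarrow> (('o, 'm) zigzag \<Rightarrow>\<^sub>0 'k) set" where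
  "lin_loc_class A \<Sigma> x y p =
     ideal_rel (linearization (free_cat (zigzag_quiver A \<Sigma>))) (lin_loc_ideal A \<Sigma>) x y
       `` {Poly_Mapping.single p 1}"

definition lin_loc_mor ::
  "('o, 'm, 'k::{comm_ring,comm_monoid_mult}) lincat \<Rightarrow> ('o \<Rightarrow> 'o \<Rightarrow> 'm set)
    \<Rightarrow> 'o \<Rightarrow> 'o \<Rightarrow> 'm \<Rightarrow> (('o, 'm) zigzag \<Rightarrow>\<^sub>0 'k) set" where
  "lin_loc_mor A \<Sigma> x y f = lin_loc_class A \<Sigma> x y [(x, Inl f, y)]"

definition lin_loc_inv ::
  "('o, 'm, 'k::{comm_ring,comm_monoid_mult}) lincat \<Rightarrow> ('o \<Rightarrow> 'o \<Rightarrow> 'm set)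
    \<Rightarrow> 'o \<Rightarrow> 'o \<Rightarrow> 'm \<Rightarrow> (('o, 'm) zigzag \<Rightarrow>\<^sub>0 'k) set" where
  "lin_loc_inv A \<Sigma> x y s = lin_loc_class A \<Sigma> y x [(y, Inr s, x)]"

section \<open>Triples and screens\<close>

text \<open>Paths are the extensional functions \<open>{0..1} \<rightarrow>\<^sub>E X\<close>, so that equal paths are equal in HOL.\<close>

type_synonym 'x pth = "real \<Rightarrow> 'x"

definition im :: "'x pth \<Rightarrow> 'x set" where
  "im \<gamma> = \<gamma> ` {0..1}"

definition const_path :: "'x \<Rightarrow> 'x pth" where
  "const_path x = (\<lambda>t\<in>{0..1}. x)"

definition concat_path :: "'x pth \<Rightarrow> 'x pth \<Rightarrow> 'x pth" (infixl \<open>\<cdot>\<^sub>p\<close> 75) where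
  "\<gamma> \<cdot>\<^sub>p \<gamma>' = (\<lambda>t\<in>{0..1}. if t \<le> 1/2 then \<gamma> (2 * t) else \<gamma>' (2 * t - 1))"

definition reparametrization :: "(real \<Rightarrow> real) \<Rightarrow> bool" where
  "reparametrization \<phi> \<longleftrightarrow> \<phi> \<in> {0..1} \<rightarrow> {0..1} \<and> mono_on {0..1} \<phi> \<and>
     (\<forall>J\<subseteq>{0..1}. is_interval J \<longrightarrow> is_interval (\<phi> ` J))"

definition parallel :: "'x pth \<Rightarrow> 'x pth \<Rightarrow> bool" where
  "parallel \<gamma> \<gamma>' \<longleftrightarrow> \<gamma> 0 = \<gamma>' 0 \<and> \<gamma> 1 = \<gamma>' 1"

locale path_triple =
  fixes X :: "'x set" and \<Gamma> :: "'x pth set" and R :: "'x pth rel"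
  assumes nonempty: "X \<noteq> {}"
    and paths: "\<Gamma> \<subseteq> {0..1} \<rightarrow>\<^sub>E X"
    and equiv_R: "equiv \<Gamma> R"
    and R_parallel: "(\<gamma>, \<gamma>') \<in> R \<Longrightarrow> parallel \<gamma> \<gamma>'"
    and concat_in: "\<lbrakk>\<gamma> \<in> \<Gamma>; \<gamma>' \<in> \<Gamma>; \<gamma> 1 = \<gamma>' 0\<rbrakk> \<Longrightarrow> \<gamma> \<cdot>\<^sub>p \<gamma>' \<in> \<Gamma>"
    and reparam_in: "\<lbrakk>\<gamma> \<in> \<Gamma>; reparametrization \<phi>\<rbrakk> \<Longrightarrow> compose {0..1} \<gamma> \<phi> \<in> \<Gamma>"
    and const_in: "x \<in> X \<Longrightarrow> const_path x \<in> \<Gamma>"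
    and R_const: "(\<gamma>, const_path x) \<in> R \<Longrightarrow> \<exists>y. \<gamma> = const_path y"
    and R_reparam: "\<lbrakk>\<gamma> \<in> \<Gamma>; reparametrization \<phi>; \<phi> 0 = 0; \<phi> 1 = 1\<rbrakk>
      \<Longrightarrow> (\<gamma>, compose {0..1} \<gamma> \<phi>) \<in> R"
    and R_cancel: "\<lbrakk>\<gamma> \<in> \<Gamma>; \<gamma>' \<in> \<Gamma>; \<rho> \<in> \<Gamma>; \<rho>' \<in> \<Gamma>;
        \<rho> 1 = \<gamma> 0; \<gamma> 1 = \<rho>' 0; \<rho> 1 = \<gamma>' 0; \<gamma>' 1 = \<rho>' 0\<rbrakk>
      \<Longrightarrow> (\<gamma>, \<gamma>') \<in> R \<longleftrightarrow> (\<rho> \<cdot>\<^sub>p \<gamma> \<cdot>\<^sub>p \<rho>', \<rho> \<cdot>\<^sub>p \<gamma>' \<cdot>\<^sub>p \<rho>') \<in> R"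

definition in_pixel :: "'x set set \<Rightarrow> 'x pth \<Rightarrow> bool" where
  "in_pixel P \<rho> \<longleftrightarrow> (\<exists>A\<in>P. im \<rho> \<subseteq> A)"

definition pixel_walk :: "'x pth set \<Rightarrow> 'x set \<Rightarrow> 'x \<Rightarrow> 'x \<Rightarrow> bool" where
  "pixel_walk \<Gamma> A x y \<longleftrightarrow> (\<exists>(n::nat) \<gamma>. (\<forall>i\<le>2 * n. \<gamma> i \<in> \<Gamma> \<and> im (\<gamma> i) \<subseteq> A) \<and>
     \<gamma> 0 0 = x \<and> \<gamma> (2 * n) 1 = y \<and>
     (\<forall>i<n. \<gamma> (2 * i) 1 = \<gamma> (2 * i + 1) 1 \<and> \<gamma> (2 * i + 1) 0 = \<gamma> (2 * i + 2) 0))"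

definition pixel_partition :: "'x set set \<Rightarrow> 'x pth \<Rightarrow> real set list \<Rightarrow> 'x set list \<Rightarrow> bool" where
  "pixel_partition P \<gamma> Is Xs \<longleftrightarrow>
     \<Union>(set Is) = {0..1} \<and>
     (\<forall>i<length Is. is_interval (Is ! i) \<and> Is ! i \<noteq> {}) \<and>
     (\<forall>i j. i < j \<and> j < length Is \<longrightarrow> (\<forall>a\<in>Is ! i. \<forall>b\<in>Is ! j. a < b)) \<and>
     length Xs = length Is \<and> set Xs \<subseteq> P \<and>
     (\<forall>i<length Is. \<gamma> ` (Is ! i) \<subseteq> Xs ! i) \<and>
     (\<forall>i<length Xs. \<forall>j<length Xs. i \<noteq> j \<and> Xs ! i = Xs ! j \<longrightarrow> \<bar>int i - int j\<bar> > 1)"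

locale screen = path_triple X \<Gamma> R
  for X :: "'x set" and \<Gamma> :: "'x pth set" and R :: "'x pth rel" +
  fixes P :: "'x set set"
  assumes partition: "partition_on X P"
    and S1: "\<lbrakk>\<gamma> \<in> \<Gamma>; \<gamma>' \<in> \<Gamma>; parallel \<gamma> \<gamma>'; A \<in> P; im \<gamma> \<subseteq> A\<rbrakk> \<Longrightarrow> (\<gamma>, \<gamma>') \<in> R \<longleftrightarrow> im \<gamma>' \<subseteq> A"
    and S2: "\<lbrakk>A \<in> P; x \<in> A; y \<in> A\<rbrakk> \<Longrightarrow> pixel_walk \<Gamma> A x y"
    and S3: "\<lbrakk>\<rho> \<in> \<Gamma>; \<gamma> \<in> \<Gamma>; \<rho> 0 = \<gamma> 0; in_pixel P \<rho>\<rbrakk> \<Longrightarrow>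
      \<exists>\<rho>'\<in>\<Gamma>. \<exists>\<gamma>'\<in>\<Gamma>. in_pixel P \<rho>' \<and> \<gamma> 1 = \<rho>' 0 \<and> \<rho> 1 = \<gamma>' 0 \<and> (\<gamma> \<cdot>\<^sub>p \<rho>', \<rho> \<cdot>\<^sub>p \<gamma>') \<in> R"
    and S3_dual: "\<lbrakk>\<rho>' \<in> \<Gamma>; \<gamma>' \<in> \<Gamma>; \<rho>' 1 = \<gamma>' 1; in_pixel P \<rho>'\<rbrakk> \<Longrightarrow>
      \<exists>\<rho>\<in>\<Gamma>. \<exists>\<gamma>\<in>\<Gamma>. in_pixel P \<rho> \<and> \<gamma> 1 = \<rho>' 0 \<and> \<rho> 1 = \<gamma>' 0 \<and> (\<gamma> \<cdot>\<^sub>p \<rho>', \<rho> \<cdot>\<^sub>p \<gamma>') \<in> R"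
    and S4: "\<gamma> \<in> \<Gamma> \<Longrightarrow> \<exists>Is Xs. pixel_partition P \<gamma> Is Xs"
    and S5: "\<lbrakk>\<gamma> \<in> \<Gamma>; \<gamma>' \<in> \<Gamma>; parallel \<gamma> \<gamma>'; pixel_partition P \<gamma> Is Xs; pixel_partition P \<gamma>' Is Xs\<rbrakk>
      \<Longrightarrow> (\<gamma>, \<gamma>') \<in> R"

section \<open>Path categories and pixelations\<close>

definition path_cat :: "'x set \<Rightarrow> 'x pth set \<Rightarrow> 'x pth rel \<Rightarrow> ('x, 'x pth set) cat" where
  "path_cat X \<Gamma> R = \<lparr>Obj = X,
     Hom = \<lambda>x y. {R `` {\<gamma>} |\<gamma>. \<gamma> \<in> \<Gamma> \<and> \<gamma> 0 = x \<and> \<gamma> 1 = y},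
     Comp = \<lambda>x y z G F. R `` {rep F \<cdot>\<^sub>p rep G},
     Ident = \<lambda>x. R `` {const_path x}\<rparr>"

definition pixel_mors :: "'x pth set \<Rightarrow> 'x pth rel \<Rightarrow> 'x set set \<Rightarrow> 'x \<Rightarrow> 'x \<Rightarrow> 'x pth set set" where
  "pixel_mors \<Gamma> R P x y = {R `` {\<rho>} |\<rho>. \<rho> \<in> \<Gamma> \<and> \<rho> 0 = x \<and> \<rho> 1 = y \<and> in_pixel P \<rho>}"

type_synonym 'x pixelation_mor = "('x, 'x pth set) zigzag set"

definition pixelation ::
  "'x set \<Rightarrow> 'x pth set \<Rightarrow> 'x pth rel \<Rightarrow> 'x set set
    \<Rightarrow> ('x, 'x pixelation_mor) cat" where
  "pixelation X \<Gamma> R P = localization (path_cat X \<Gamma> R) (pixel_mors \<Gamma> R P)"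

definition lin_path_cat ::
  "'x set \<Rightarrow> 'x pth set \<Rightarrow> 'x pth rel
    \<Rightarrow> ('x option, 'x pth set \<Rightarrow>\<^sub>0 'k::{comm_ring,comm_monoid_mult}, 'k) lincat" where
  "lin_path_cat X \<Gamma> R = adjoin_zero (linearization (path_cat X \<Gamma> R))"

type_synonym ('x, 'k) path_ideal = "'x option \<Rightarrow> 'x option \<Rightarrow> ('x pth set \<Rightarrow>\<^sub>0 'k) set"

definition path_sum :: "'x pth rel \<Rightarrow> nat \<Rightarrow> (nat \<Rightarrow> 'k) \<Rightarrow> (nat \<Rightarrow> 'x pth) \<Rightarrow> ('x pth set \<Rightarrow>\<^sub>0 'k::comm_ring)" where
  "path_sum R n c \<gamma> = (\<Sum>i<n. Poly_Mapping.single (R `` {\<gamma> i}) (c i))"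

definition path_based_ideal ::
  "'x set \<Rightarrow> 'x pth set \<Rightarrow> 'x pth rel \<Rightarrow> ('x, 'k::{comm_ring,comm_monoid_mult}) path_ideal \<Rightarrow> bool" where
  "path_based_ideal X \<Gamma> R I \<longleftrightarrow> (\<exists>S :: ('x, 'k) path_ideal.
     (\<forall>u v. \<forall>f\<in>S u v. \<exists>x y n c \<gamma>. u = Some x \<and> v = Some y \<and> f = path_sum R n c \<gamma> \<and>
        (\<forall>i<n. \<gamma> i \<in> \<Gamma> \<and> \<gamma> i 0 = x \<and> \<gamma> i 1 = y \<and> (\<forall>d. c i * d = 0 \<longrightarrow> d = 0))) \<and>
     (\<forall>u\<in>Obj (lin_path_cat X \<Gamma> R :: (_, _, 'k) lincat). \<forall>v\<in>Obj (lin_path_cat X \<Gamma> R :: (_, _, 'k) lincat).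
        I u v = generated_ideal (lin_path_cat X \<Gamma> R) S u v))"

definition pixel_equiv :: "'x pth set \<Rightarrow> 'x pth rel \<Rightarrow> 'x set set \<Rightarrow> 'x pth \<Rightarrow> 'x pth \<Rightarrow> bool" where
  "pixel_equiv \<Gamma> R P \<gamma> \<gamma>' \<longleftrightarrow> (\<exists>\<rho>1\<in>\<Gamma>. \<exists>\<rho>2\<in>\<Gamma>. \<exists>\<rho>3\<in>\<Gamma>. \<exists>\<rho>4\<in>\<Gamma>.
     (\<exists>A\<in>P. im \<rho>1 \<union> im \<rho>2 \<subseteq> A) \<and> (\<exists>B\<in>P. im \<rho>3 \<union> im \<rho>4 \<subseteq> B) \<and>
     \<rho>1 1 = \<gamma> 0 \<and> \<gamma> 1 = \<rho>3 0 \<and> \<rho>2 1 = \<gamma>' 0 \<and> \<gamma>' 1 = \<rho>4 0 \<and>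
     (\<rho>1 \<cdot>\<^sub>p \<gamma> \<cdot>\<^sub>p \<rho>3, \<rho>2 \<cdot>\<^sub>p \<gamma>' \<cdot>\<^sub>p \<rho>4) \<in> R)"

text \<open>\<open>\<PP>\<close>-equivalence of \<open>f : x \<rightarrow> y\<close> and \<open>g : x' \<rightarrow> y'\<close>; the permutation is absorbed by the existentials.\<close>

definition mor_pixel_equiv ::
  "'x pth set \<Rightarrow> 'x pth rel \<Rightarrow> 'x set set \<Rightarrow> 'x \<Rightarrow> 'x \<Rightarrow> ('x pth set \<Rightarrow>\<^sub>0 'k::comm_ring)
    \<Rightarrow> 'x \<Rightarrow> 'x \<Rightarrow> ('x pth set \<Rightarrow>\<^sub>0 'k) \<Rightarrow> bool" where
  "mor_pixel_equiv \<Gamma> R P x y f x' y' g \<longleftrightarrow>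
     (\<exists>n c \<gamma> \<gamma>'. f = path_sum R n c \<gamma> \<and> g = path_sum R n c \<gamma>' \<and>
        (\<forall>i<n. \<gamma> i \<in> \<Gamma> \<and> \<gamma> i 0 = x \<and> \<gamma> i 1 = y \<and> \<gamma>' i \<in> \<Gamma> \<and> \<gamma>' i 0 = x' \<and> \<gamma>' i 1 = y' \<and>
           pixel_equiv \<Gamma> R P (\<gamma> i) (\<gamma>' i)))"

definition ideal_closure ::
  "'x set \<Rightarrow> 'x pth set \<Rightarrow> 'x pth rel \<Rightarrow> 'x set set
    \<Rightarrow> ('x, 'k::{comm_ring,comm_monoid_mult}) path_ideal \<Rightarrow> ('x, 'k) path_ideal" where
  "ideal_closure X \<Gamma> R P I = generated_ideal (lin_path_cat X \<Gamma> R)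
     (\<lambda>u v. {f. \<exists>x\<in>X. \<exists>y\<in>X. \<exists>x'\<in>X. \<exists>y'\<in>X. \<exists>g\<in>I (Some x') (Some y').
        u = Some x \<and> v = Some y \<and> mor_pixel_equiv \<Gamma> R P x y f x' y' g})"

text \<open>
  For an ideal \<open>J\<close> of \<open>lin_path_cat X \<Gamma> R\<close>, the morphism \<open>[\<gamma>]\<close> of the quotient by \<open>J\<close>.
  It is used with \<open>J = I\<close> and with \<open>J = ideal_closure X \<Gamma> R P I\<close>.
\<close>

definition quotient_path ::
  "'x set \<Rightarrow> 'x pth set \<Rightarrow> 'x pth rel \<Rightarrow> ('x, 'k::{comm_ring,comm_monoid_mult}) path_ideal
    \<Rightarrow> 'x pth \<Rightarrow> ('x pth set \<Rightarrow>\<^sub>0 'k) set" where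
  "quotient_path X \<Gamma> R J \<gamma> = ideal_rel (lin_path_cat X \<Gamma> R) J (Some (\<gamma> 0)) (Some (\<gamma> 1))
     `` {Poly_Mapping.single (R `` {\<gamma>}) 1}"

definition pre_dead ::
  "'x set \<Rightarrow> 'x pth set \<Rightarrow> 'x pth rel \<Rightarrow> 'x set set
    \<Rightarrow> ('x, 'k::{comm_ring,comm_monoid_mult}) path_ideal \<Rightarrow> 'x set \<Rightarrow> bool" where
  "pre_dead X \<Gamma> R P I A \<longleftrightarrow> A \<in> P \<and> (\<exists>\<rho>\<in>\<Gamma>. im \<rho> \<subseteq> A \<and>
     quotient_path X \<Gamma> R I \<rho> = HZero (quotient_lincat (lin_path_cat X \<Gamma> R) I) (Some (\<rho> 0)) (Some (\<rho> 1)))"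

definition closure_quotient ::
  "'x set \<Rightarrow> 'x pth set \<Rightarrow> 'x pth rel \<Rightarrow> 'x set set
    \<Rightarrow> ('x, 'k::{comm_ring,comm_monoid_mult}) path_ideal
    \<Rightarrow> ('x option, ('x pth set \<Rightarrow>\<^sub>0 'k) set, 'k) lincat" where
  "closure_quotient X \<Gamma> R P I = quotient_lincat (lin_path_cat X \<Gamma> R) (ideal_closure X \<Gamma> R P I)"

definition lin_pixel_mors ::
  "'x set \<Rightarrow> 'x pth set \<Rightarrow> 'x pth rel \<Rightarrow> 'x set set
    \<Rightarrow> ('x, 'k::{comm_ring,comm_monoid_mult}) path_ideal
    \<Rightarrow> 'x option \<Rightarrow> 'x option \<Rightarrow> ('x pth set \<Rightarrow>\<^sub>0 'k) set set" where
  "lin_pixel_mors X \<Gamma> R P I u v =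
     {quotient_path X \<Gamma> R (ideal_closure X \<Gamma> R P I) \<rho> |\<rho>.
        \<rho> \<in> \<Gamma> \<and> in_pixel P \<rho> \<and> u = Some (\<rho> 0) \<and> v = Some (\<rho> 1) \<and>
        quotient_path X \<Gamma> R (ideal_closure X \<Gamma> R P I) \<rho> \<noteq> HZero (closure_quotient X \<Gamma> R P I) u v}
     \<union> {HZero (closure_quotient X \<Gamma> R P I) u v |x y A.
        u = Some x \<and> v = Some y \<and> pre_dead X \<Gamma> R P I A \<and> x \<in> A \<and> y \<in> A}"

type_synonym ('x, 'k) lin_pixelation_mor =
  "(('x option, ('x pth set \<Rightarrow>\<^sub>0 'k) set) zigzag \<Rightarrow>\<^sub>0 'k) set"

definition lin_pixelation ::
  "'x set \<Rightarrow> 'x pth set \<Rightarrow> 'x pth rel \<Rightarrow> 'x set set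
    \<Rightarrow> ('x, 'k::{comm_ring,comm_monoid_mult}) path_ideal
    \<Rightarrow> ('x option, ('x, 'k) lin_pixelation_mor, 'k) lincat" where
  "lin_pixelation X \<Gamma> R P I =
     lin_localization (closure_quotient X \<Gamma> R P I) (lin_pixel_mors X \<Gamma> R P I)"

definition dead ::
  "'x set \<Rightarrow> 'x pth set \<Rightarrow> 'x pth rel \<Rightarrow> 'x set set
    \<Rightarrow> ('x, 'k::{comm_ring,comm_monoid_mult}) path_ideal \<Rightarrow> 'x set \<Rightarrow> bool" where
  "dead X \<Gamma> R P I A \<longleftrightarrow> (\<exists>x\<in>A. isomorphic_objs (lin_pixelation X \<Gamma> R P I) (Some x) None)"

section \<open>Categories from quivers\<close>

definition two_pixel_path :: "'x set set \<Rightarrow> 'x pth \<Rightarrow> bool" where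
  "two_pixel_path P \<gamma> \<longleftrightarrow> (\<exists>Is Xs. pixel_partition P \<gamma> Is Xs \<and> length Is = 2)"

definition pseudo_arrow ::
  "'x set \<Rightarrow> 'x pth set \<Rightarrow> 'x pth rel \<Rightarrow> 'x set set
    \<Rightarrow> 'x \<Rightarrow> 'x \<Rightarrow> 'x pixelation_mor \<Rightarrow> bool" where
  "pseudo_arrow X \<Gamma> R P x y f \<longleftrightarrow>
     (\<exists>\<gamma>\<in>\<Gamma>. \<exists>\<sigma>\<in>pixel_mors \<Gamma> R P y (\<gamma> 1). two_pixel_path P \<gamma> \<and> \<gamma> 0 = x \<and>
        f = Comp (pixelation X \<Gamma> R P) x (\<gamma> 1) y
              (loc_inv (path_cat X \<Gamma> R) (pixel_mors \<Gamma> R P) y (\<gamma> 1) \<sigma>)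
              (loc_mor (path_cat X \<Gamma> R) (pixel_mors \<Gamma> R P) x (\<gamma> 1) (R `` {\<gamma>})))"

text \<open>
  The arrows \<open>A \<rightarrow> B\<close>. A pixel \<open>A\<close> may contain points from which a path enters \<open>B\<close> directly
  while every path to \<open>B\<close> from the chosen base point \<open>s A\<close> crosses further pixels. Pseudo arrows
  are therefore taken up to the canonical isomorphisms between the points of a pixel: a pseudo
  arrow \<open>w \<rightarrow> s B\<close> counts as one \<open>s A \<rightarrow> s B\<close> along the inverse of any \<open>\<tau> : w \<rightarrow> s A\<close>
  in \<open>\<Sigma>\<close>. (On the target side, the fraction already allows this; \<open>w = s A\<close> with \<open>\<tau>\<close> the
  identity gives the pseudo arrows that start at \<open>s A\<close> itself.) No uniqueness is imposed.
\<close>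

definition quiver_arrows ::
  "'x set \<Rightarrow> 'x pth set \<Rightarrow> 'x pth rel \<Rightarrow> 'x set set
    \<Rightarrow> ('x set \<Rightarrow> 'x) \<Rightarrow> 'x set \<Rightarrow> 'x set \<Rightarrow> 'x pixelation_mor set" where
  "quiver_arrows X \<Gamma> R P s A B =
     {Comp (pixelation X \<Gamma> R P) (s A) w (s B) p
        (loc_inv (path_cat X \<Gamma> R) (pixel_mors \<Gamma> R P) w (s A) \<tau>) |w \<tau> p.
      \<tau> \<in> pixel_mors \<Gamma> R P w (s A) \<and> pseudo_arrow X \<Gamma> R P w (s B) p}"

definition pixel_quiver ::
  "'x set \<Rightarrow> 'x pth set \<Rightarrow> 'x pth rel \<Rightarrow> 'x set set
    \<Rightarrow> ('x set \<Rightarrow> 'x) \<Rightarrow> ('x set, 'x set \<times> 'x pixelation_mor \<times> 'x set) pre_digraph" where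
  "pixel_quiver X \<Gamma> R P s = quiver P (quiver_arrows X \<Gamma> R P s)"

definition quiver_cat ::
  "'x set \<Rightarrow> 'x pth set \<Rightarrow> 'x pth rel \<Rightarrow> 'x set set
    \<Rightarrow> ('x set \<Rightarrow> 'x) \<Rightarrow> ('x set, ('x set \<times> 'x pixelation_mor \<times> 'x set) list set) cat" where
  "quiver_cat X \<Gamma> R P s = quotient_cat (free_cat (pixel_quiver X \<Gamma> R P s))
     (\<lambda>A B. {(p, q). p \<in> Hom (free_cat (pixel_quiver X \<Gamma> R P s)) A B \<and>
        q \<in> Hom (free_cat (pixel_quiver X \<Gamma> R P s)) A B \<and>
        free_functor (pixelation X \<Gamma> R P) s B p = free_functor (pixelation X \<Gamma> R P) s B q})"

text \<open>The nonzero morphisms \<open>\<sigma>\<inverse> c [\<gamma>]\<close>, with the scalar \<open>c\<close> recorded.\<close>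

definition lin_pseudo_arrow ::
  "'x set \<Rightarrow> 'x pth set \<Rightarrow> 'x pth rel \<Rightarrow> 'x set set
    \<Rightarrow> ('x, 'k::{comm_ring,comm_monoid_mult}) path_ideal
    \<Rightarrow> 'k \<Rightarrow> 'x \<Rightarrow> 'x \<Rightarrow> ('x, 'k) lin_pixelation_mor \<Rightarrow> bool" where
  "lin_pseudo_arrow X \<Gamma> R P I c x y f \<longleftrightarrow>
     (let A = closure_quotient X \<Gamma> R P I; \<Sigma> = lin_pixel_mors X \<Gamma> R P I; D = lin_pixelation X \<Gamma> R P I in
      f \<noteq> HZero D (Some x) (Some y) \<and>
      (\<exists>\<gamma>\<in>\<Gamma>. \<exists>\<sigma>\<in>\<Sigma> (Some y) (Some (\<gamma> 1)). two_pixel_path P \<gamma> \<and> \<gamma> 0 = x \<and>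
         f = Comp D (Some x) (Some (\<gamma> 1)) (Some y)
               (lin_loc_inv A \<Sigma> (Some y) (Some (\<gamma> 1)) \<sigma>)
               (HScale D (Some x) (Some (\<gamma> 1)) c
                 (lin_loc_mor A \<Sigma> (Some x) (Some (\<gamma> 1))
                   (quotient_path X \<Gamma> R (ideal_closure X \<Gamma> R P I) \<gamma>)))))"

text \<open>
  Pseudo arrows modulo scalars, transported to the base points as in the non-linear case: the
  class of \<open>\<sigma>\<inverse> c [\<gamma>]\<close> is represented by \<open>\<sigma>\<inverse> [\<gamma>]\<close>, which is where \<open>\<Phi>\<close> sends it. (Over a general
  ring, scalar multiples of a pseudo arrow need not generate the same submodule, so the
  representative has to be fixed.)
\<close>

definition lin_quiver_arrows ::
  "'x set \<Rightarrow> 'x pth set \<Rightarrow> 'x pth rel \<Rightarrow> 'x set set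
    \<Rightarrow> ('x, 'k::{comm_ring,comm_monoid_mult}) path_ideal
    \<Rightarrow> ('x set \<Rightarrow> 'x) \<Rightarrow> 'x set \<Rightarrow> 'x set \<Rightarrow> ('x, 'k) lin_pixelation_mor set" where
  "lin_quiver_arrows X \<Gamma> R P I s A B =
     {Comp (lin_pixelation X \<Gamma> R P I) (Some (s A)) (Some w) (Some (s B)) p
        (lin_loc_inv (closure_quotient X \<Gamma> R P I) (lin_pixel_mors X \<Gamma> R P I) (Some w) (Some (s A)) \<tau>) |w \<tau> p.
      \<tau> \<in> lin_pixel_mors X \<Gamma> R P I (Some w) (Some (s A)) \<and> lin_pseudo_arrow X \<Gamma> R P I 1 w (s B) p}"

definition lin_pixel_quiver ::
  "'x set \<Rightarrow> 'x pth set \<Rightarrow> 'x pth rel \<Rightarrow> 'x set set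
    \<Rightarrow> ('x, 'k::{comm_ring,comm_monoid_mult}) path_ideal
    \<Rightarrow> ('x set \<Rightarrow> 'x) \<Rightarrow> ('x set, 'x set \<times> ('x, 'k) lin_pixelation_mor \<times> 'x set) pre_digraph" where
  "lin_pixel_quiver X \<Gamma> R P I s = quiver {A \<in> P. \<not> dead X \<Gamma> R P I A} (lin_quiver_arrows X \<Gamma> R P I s)"

definition free_lin_quiver_cat ::
  "'x set \<Rightarrow> 'x pth set \<Rightarrow> 'x pth rel \<Rightarrow> 'x set set
    \<Rightarrow> ('x, 'k::{comm_ring,comm_monoid_mult}) path_ideal
    \<Rightarrow> ('x set \<Rightarrow> 'x) \<Rightarrow> ('x set option, ('x set \<times> ('x, 'k) lin_pixelation_mor \<times> 'x set) list \<Rightarrow>\<^sub>0 'k, 'k) lincat" where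
  "free_lin_quiver_cat X \<Gamma> R P I s =
     adjoin_zero (linearization (free_cat (lin_pixel_quiver X \<Gamma> R P I s)))"

definition Phi ::
  "'x set \<Rightarrow> 'x pth set \<Rightarrow> 'x pth rel \<Rightarrow> 'x set set
    \<Rightarrow> ('x, 'k::{comm_ring,comm_monoid_mult}) path_ideal
    \<Rightarrow> ('x set \<Rightarrow> 'x) \<Rightarrow> 'x set option \<Rightarrow> 'x set option \<Rightarrow> (('x set \<times> ('x, 'k) lin_pixelation_mor \<times> 'x set) list \<Rightarrow>\<^sub>0 'k) \<Rightarrow> ('x, 'k) lin_pixelation_mor" where
  "Phi X \<Gamma> R P I s u v h =
     (case (u, v) of
        (Some A, Some B) \<Rightarrow>
          finsum (hom_module (lin_pixelation X \<Gamma> R P I) (Some (s A)) (Some (s B)))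
            (\<lambda>p. HScale (lin_pixelation X \<Gamma> R P I) (Some (s A)) (Some (s B)) (Poly_Mapping.lookup h p)
                   (free_functor (lin_pixelation X \<Gamma> R P I) (Some \<circ> s) B p))
            (Poly_Mapping.keys h)
      | _ \<Rightarrow> HZero (lin_pixelation X \<Gamma> R P I) (map_option s u) (map_option s v))"

definition lin_quiver_cat ::
  "'x set \<Rightarrow> 'x pth set \<Rightarrow> 'x pth rel \<Rightarrow> 'x set set
    \<Rightarrow> ('x, 'k::{comm_ring,comm_monoid_mult}) path_ideal
    \<Rightarrow> ('x set \<Rightarrow> 'x) \<Rightarrow> ('x set option, (('x set \<times> ('x, 'k) lin_pixelation_mor \<times> 'x set) list \<Rightarrow>\<^sub>0 'k) set, 'k) lincat" where
  "lin_quiver_cat X \<Gamma> R P I s = quotient_lincat (free_lin_quiver_cat X \<Gamma> R P I s)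
     (\<lambda>u v. {h \<in> Hom (free_lin_quiver_cat X \<Gamma> R P I s) u v.
        Phi X \<Gamma> R P I s u v h = HZero (lin_pixelation X \<Gamma> R P I) (map_option s u) (map_option s v)})"

end

theory Submission
  imports Defs "HOL-Analysis.Convex_Euclidean_Space"
begin

text \<open>
  The functors \<open>\<Psi>\<close> and \<open>\<Phi>\<close> become faithful by construction of the quotients, so only essential
  surjectivity and fullness matter. By (S1)--(S3), any two points of a pixel are the feet of a roof of
  paths inside the pixel, and the resulting isomorphism in the pixelation does not depend on the roof;
  this moves every point canonically to the base point of its pixel. By (S4) every path is a
  composite of paths inside pixels, which become identities after this transport, and of paths
  crossing from one pixel to a second one. A crossing can be prolonged inside its two pixels until
  its ends are joined to the base points by honest paths, and then it is a pseudo arrow.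

  In the linear case, pixels that are not dead contain no path that vanishes modulo the ideal
  closure, so the same argument applies to them, while all points of dead pixels are zero objects.
\<close>

section \<open>Categories and equivalences\<close>

text \<open>Neither localization is described through fractions: its morphisms are words in path
  classes and formal inverses. Being the value of a walk after transport to the base points is
  stable under composition, and in the linear case under sums and scalars, so fullness only has to
  be checked on the letters of a word. The obstacle is the shape of a pseudo arrow: a crossing found
  by cutting a path starts and ends anywhere in its two pixels, whereas an arrow of the quiver needs
  a path into the base point at the source and one out of the base point at the target. The linear
  case adds two difficulties. The inverse of a path in a pixel may be written down only when the
  class of the path is nonzero modulo the ideal closure, or when its pixel is pre-dead; since the
  closure is given by generators, this calls for an explicit ideal that bounds it from above. And
  pseudo arrows are nonzero by definition, so a crossing whose transport vanishes must come from 0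
  instead of an arrow.\<close>

definition inverse_mors :: "('o, 'm, 'z) cat_scheme \<Rightarrow> 'o \<Rightarrow> 'o \<Rightarrow> 'm \<Rightarrow> 'm \<Rightarrow> bool" where
  "inverse_mors C x y f g \<longleftrightarrow> f \<in> Hom C x y \<and> g \<in> Hom C y x \<and>
     Comp C x y x g f = Ident C x \<and> Comp C y x y f g = Ident C y"

lemma iso_mor_iff: "iso_mor C x y f \<longleftrightarrow> (\<exists>g. inverse_mors C x y f g)"
  by (auto simp: iso_mor_def inverse_mors_def)

lemma inverse_mors_sym: "inverse_mors C x y f g \<Longrightarrow> inverse_mors C y x g f"
  by (auto simp: inverse_mors_def)

context category
begin

lemma inverse_mors_cancel_right:
  assumes "x \<in> Obj C" "y \<in> Obj C" "z \<in> Obj C" "inverse_mors C x y f g" "h \<in> Hom C x z"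
  shows "Comp C x y z (Comp C y x z h g) f = h"
  using assms Comp_assoc[of x y x z f g h] by (simp add: inverse_mors_def Comp_Ident_right)

lemma inverse_mors_Comp:
  assumes "x \<in> Obj C" "y \<in> Obj C" "z \<in> Obj C" "inverse_mors C x y f g" "inverse_mors C y z h k"
  shows "inverse_mors C x z (Comp C x y z h f) (Comp C z y x g k)"
  using assms inverse_mors_cancel_right[of y z x h k g]
    inverse_mors_cancel_right[of y x z g f h]
    Comp_assoc[of x y z x f h "Comp C z y x g k"] Comp_assoc[of z y x z k g "Comp C x y z h f"]
  by (auto simp: inverse_mors_def Comp_in)

lemma inverse_mors_unique:
  assumes "x \<in> Obj C" "y \<in> Obj C" "inverse_mors C x y f g" "inverse_mors C x y f g'"
  shows "g = g'"
  using assms inverse_mors_cancel_right[of y x x g f g'] inverse_mors_sym[of C x y f g]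
  by (simp add: inverse_mors_def Comp_Ident_left)

lemma inverse_mors_Ident: "x \<in> Obj C \<Longrightarrow> inverse_mors C x x (Ident C x) (Ident C x)"
  by (simp add: inverse_mors_def Ident_in Comp_Ident_left)

end

text \<open>In both applications \<open>b\<close> sends a point to the base point of its pixel and
  \<open>\<theta>\<close> is a canonical isomorphism; in the linear case the points of dead pixels
  go to the adjoined zero object instead. The inverse \<open>\<iota>\<close> is part of the data so
  that conjugation is a formula.\<close>

locale iso_family = category D for D :: "('o, 'm, 'z) cat_scheme" +
  fixes b :: "'o \<Rightarrow> 'o" and \<theta> \<iota> :: "'o \<Rightarrow> 'm"
  assumes b_in: "u \<in> Obj D \<Longrightarrow> b u \<in> Obj D"
    and inverse: "u \<in> Obj D \<Longrightarrow> inverse_mors D u (b u) (\<theta> u) (\<iota> u)"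
begin

text \<open>The morphism part of a functor that is \<open>b\<close> on objects;
  \<open>\<theta>\<close> is natural from the identity functor to it, which is
  \<open>conj_mor_theta\<close>.\<close>

definition conj_mor :: "'o \<Rightarrow> 'o \<Rightarrow> 'm \<Rightarrow> 'm" where
  "conj_mor u v f = Comp D (b u) v (b v) (\<theta> v) (Comp D (b u) u v f (\<iota> u))"

lemma theta_in: "u \<in> Obj D \<Longrightarrow> \<theta> u \<in> Hom D u (b u)"
  and iota_in: "u \<in> Obj D \<Longrightarrow> \<iota> u \<in> Hom D (b u) u"
  using inverse by (auto simp: inverse_mors_def)

lemma conj_mor_in:
  "u \<in> Obj D \<Longrightarrow> v \<in> Obj D \<Longrightarrow> f \<in> Hom D u v \<Longrightarrow> conj_mor u v f \<in> Hom D (b u) (b v)"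
  unfolding conj_mor_def by (intro Comp_in b_in theta_in iota_in)

lemma conj_mor_Ident: "u \<in> Obj D \<Longrightarrow> conj_mor u u (Ident D u) = Ident D (b u)"
  using inverse[of u] by (simp add: conj_mor_def b_in Comp_Ident_left inverse_mors_def)

lemma conj_mor_theta:
  assumes "u \<in> Obj D" "v \<in> Obj D" "f \<in> Hom D u v"
  shows "Comp D u (b u) (b v) (conj_mor u v f) (\<theta> u) = Comp D u v (b v) (\<theta> v) f"
proof -
  have "conj_mor u v f = Comp D (b u) u (b v) (Comp D u v (b v) (\<theta> v) f) (\<iota> u)"
    unfolding conj_mor_def using assms by (intro Comp_assoc b_in iota_in theta_in)
  then show ?thesis
    using assms by (simp add: inverse_mors_cancel_right inverse Comp_in b_in theta_in)
qed

text \<open>Regrouping lets \<open>conj_mor v w g\<close> meet \<open>\<theta> v\<close>, and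
  naturality then moves the isomorphism to the far end.\<close>

lemma conj_mor_Comp:
  assumes "u \<in> Obj D" "v \<in> Obj D" "w \<in> Obj D" "f \<in> Hom D u v" "g \<in> Hom D v w"
  shows "conj_mor u w (Comp D u v w g f) = Comp D (b u) (b v) (b w) (conj_mor v w g) (conj_mor u v f)"
proof -
  note in_simps = assms b_in theta_in iota_in Comp_in conj_mor_in
  have "Comp D (b u) (b v) (b w) (conj_mor v w g) (conj_mor u v f)
      = Comp D (b u) v (b w) (Comp D v (b v) (b w) (conj_mor v w g) (\<theta> v)) (Comp D (b u) u v f (\<iota> u))"
    unfolding conj_mor_def[of u v f] by (intro Comp_assoc in_simps)
  also have "\<dots> = Comp D (b u) v (b w) (Comp D v w (b w) (\<theta> w) g) (Comp D (b u) u v f (\<iota> u))"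
    by (simp add: conj_mor_theta assms)
  also have "\<dots> = Comp D (b u) w (b w) (\<theta> w) (Comp D (b u) v w g (Comp D (b u) u v f (\<iota> u)))"
    by (intro Comp_assoc[symmetric] in_simps)
  also have "Comp D (b u) v w g (Comp D (b u) u v f (\<iota> u)) = Comp D (b u) u w (Comp D u v w g f) (\<iota> u)"
    by (intro Comp_assoc in_simps)
  finally show ?thesis by (simp add: conj_mor_def)
qed

text \<open>
  Requiring the isomorphisms \<open>u \<cong> FO (a u)\<close> to be identities on the image of \<open>FO\<close> makes the
  composite on \<open>Q\<close> the identity functor.
\<close>
lemma quasi_inverse_of_retraction:
  fixes Q :: "('p, 'n, 'y) cat_scheme"
  assumes F: "is_functor Q D FO FM"
    and faithful: "\<And>x y p q. \<lbrakk>x \<in> Obj Q; y \<in> Obj Q; p \<in> Hom Q x y; q \<in> Hom Q x y; FM x y p = FM x y q\<rbrakk>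
      \<Longrightarrow> p = q"
    and a_in: "\<And>u. u \<in> Obj D \<Longrightarrow> a u \<in> Obj Q"
    and b_eq: "\<And>u. u \<in> Obj D \<Longrightarrow> b u = FO (a u)"
    and a_FO: "\<And>x. x \<in> Obj Q \<Longrightarrow> a (FO x) = x"
    and \<theta>_FO: "\<And>x. x \<in> Obj Q \<Longrightarrow> \<theta> (FO x) = Ident D (FO x)"
    and full: "\<And>u v f. \<lbrakk>u \<in> Obj D; v \<in> Obj D; f \<in> Hom D u v\<rbrakk>
      \<Longrightarrow> conj_mor u v f \<in> FM (a u) (a v) ` Hom Q (a u) (a v)"
  obtains GM where "is_functor D Q a GM" "quasi_inverse D Q a GM FO FM"
    "\<And>u v f. \<lbrakk>u \<in> Obj D; v \<in> Obj D; f \<in> Hom D u v\<rbrakk>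
      \<Longrightarrow> GM u v f \<in> Hom Q (a u) (a v) \<and> FM (a u) (a v) (GM u v f) = conj_mor u v f"
proof -
  interpret F: is_functor Q D FO FM by (rule F)
  \<comment> \<open>Fullness supplies a preimage of the conjugate and faithfulness makes it the only
    one, so every equation for \<open>GM\<close> can be checked after applying
    \<open>FM\<close>.\<close>
  define GM where "GM u v f = (SOME p. p \<in> Hom Q (a u) (a v) \<and> FM (a u) (a v) p = conj_mor u v f)"
    for u v f
  have GM: "GM u v f \<in> Hom Q (a u) (a v) \<and> FM (a u) (a v) (GM u v f) = conj_mor u v f"
    if "u \<in> Obj D" "v \<in> Obj D" "f \<in> Hom D u v" for u v f
    unfolding GM_def by (rule someI_ex) (use full[OF that] in force)
  have G: "is_functor D Q a GM"
  proof
    show "a u \<in> Obj Q" if "u \<in> Obj D" for u by (rule a_in[OF that])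
    show "GM u v f \<in> Hom Q (a u) (a v)" if "u \<in> Obj D" "v \<in> Obj D" "f \<in> Hom D u v" for u v f
      using GM[OF that] by blast
    show "GM u u (Ident D u) = Ident Q (a u)" if u: "u \<in> Obj D" for u
      by (rule faithful[of "a u" "a u"])
        (use u GM[of u u "Ident D u"] in \<open>simp_all add: a_in Ident_in F.C.Ident_in F.FM_Ident conj_mor_Ident b_eq\<close>)
    show "GM u w (Comp D u v w g f) = Comp Q (a u) (a v) (a w) (GM v w g) (GM u v f)"
      if "u \<in> Obj D" "v \<in> Obj D" "w \<in> Obj D" "f \<in> Hom D u v" "g \<in> Hom D v w" for u v w f g
      by (rule faithful[of "a u" "a w"])
        (use that GM[of u v f] GM[of v w g] GM[of u w "Comp D u v w g f"] in
          \<open>simp_all add: a_in Comp_in F.C.Comp_in F.FM_Comp conj_mor_Comp b_eq\<close>)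
  qed
  \<comment> \<open>Inverses are unique, so \<open>\<iota>\<close> is an identity wherever
    \<open>\<theta>\<close> is. Conjugation then does nothing on the image of \<open>FO\<close>,
    which gives \<open>GF\<close>.\<close>
  have \<iota>_FO: "\<iota> (FO x) = Ident D (FO x)" if x: "x \<in> Obj Q" for x
    using inverse[of "FO x"] x inverse_mors_Ident[of "FO x"] inverse_mors_unique[of "FO x" "FO x"]
    by (simp add: F.FO_in b_eq a_FO \<theta>_FO)
  have GF: "GM (FO x) (FO y) (FM x y f) = f" if "x \<in> Obj Q" "y \<in> Obj Q" "f \<in> Hom Q x y" for x y f
    by (rule faithful[of x y])
      (use that GM[of "FO x" "FO y" "FM x y f"] in
        \<open>simp_all add: F.FO_in F.FM_in a_FO conj_mor_def b_eq \<theta>_FO \<iota>_FO Comp_Ident_left Comp_Ident_right\<close>)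
  have "nat_iso D D (\<lambda>x. x) (\<lambda>x y f. f) (\<lambda>x. FO (a x)) (\<lambda>x y f. FM (a x) (a y) (GM x y f)) \<theta>"
    unfolding nat_iso_def using inverse GM conj_mor_theta by (auto simp: iso_mor_iff b_eq)
  moreover have "nat_iso Q Q (\<lambda>u. a (FO u)) (\<lambda>u v g. GM (FO u) (FO v) (FM u v g)) (\<lambda>u. u) (\<lambda>u v g. g) (Ident Q)"
    unfolding nat_iso_def using F.C.inverse_mors_Ident
    by (auto simp: iso_mor_iff a_FO GF F.C.Comp_Ident_left F.C.Comp_Ident_right)
  ultimately have "quasi_inverse D Q a GM FO FM"
    unfolding quasi_inverse_def by blast
  with G GM show thesis using that by blast
qed

end

section \<open>Quotients by congruences and by kernels of functors\<close>

lemma rep_in: "x \<in> K \<Longrightarrow> rep K \<in> K"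
  unfolding rep_def by (rule someI)

locale quotient_category = category K for K :: "('o, 'm, 'z) cat_scheme" +
  fixes E :: "'o \<Rightarrow> 'o \<Rightarrow> 'm rel"
  assumes congruence: "cat_congruence K E"
begin

abbreviation cls :: "'o \<Rightarrow> 'o \<Rightarrow> 'm \<Rightarrow> 'm set" where
  "cls x y f \<equiv> E x y `` {f}"

abbreviation Q :: "('o, 'm set) cat" where
  "Q \<equiv> quotient_cat K E"

lemma equiv_E: "x \<in> Obj K \<Longrightarrow> y \<in> Obj K \<Longrightarrow> equiv (Hom K x y) (E x y)"
  using congruence by (simp add: cat_congruence_def)

lemma E_Comp: "\<lbrakk>x \<in> Obj K; y \<in> Obj K; z \<in> Obj K; (f, f') \<in> E x y; (g, g') \<in> E y z\<rbrakk>
    \<Longrightarrow> (Comp K x y z g f, Comp K x y z g' f') \<in> E x z"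
  using congruence by (simp add: cat_congruence_def)

lemma Obj_Q [simp]: "Obj Q = Obj K"
  by (simp add: quotient_cat_def)

lemma cls_in: "\<lbrakk>x \<in> Obj K; y \<in> Obj K; f \<in> Hom K x y\<rbrakk> \<Longrightarrow> cls x y f \<in> Hom Q x y"
  by (simp add: quotient_cat_def quotientI)

lemma Hom_Q_cases:
  assumes "F \<in> Hom Q x y"
  obtains f where "f \<in> Hom K x y" "F = cls x y f"
  using assms by (auto simp: quotient_cat_def elim: quotientE)

lemma cls_eq_iff:
  "\<lbrakk>x \<in> Obj K; y \<in> Obj K; f \<in> Hom K x y; g \<in> Hom K x y\<rbrakk> \<Longrightarrow> cls x y f = cls x y g \<longleftrightarrow> (f, g) \<in> E x y"
  using eq_equiv_class_iff[OF equiv_E] by blast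

lemma rep_cls:
  assumes "x \<in> Obj K" "y \<in> Obj K" "f \<in> Hom K x y"
  shows "(f, rep (cls x y f)) \<in> E x y" "rep (cls x y f) \<in> Hom K x y"
proof -
  have "f \<in> cls x y f" by (rule equiv_class_self[OF equiv_E]) fact+
  then have "rep (cls x y f) \<in> cls x y f" by (rule rep_in)
  then show "(f, rep (cls x y f)) \<in> E x y" by simp
  then show "rep (cls x y f) \<in> Hom K x y"
    using equiv_E[OF assms(1,2)] by (auto simp: equiv_def refl_on_def)
qed

text \<open>Composition in the quotient is defined through chosen representatives; compatibility of
  the congruence with composition makes the choice immaterial.\<close>

lemma Comp_Q: "\<lbrakk>x \<in> Obj K; y \<in> Obj K; z \<in> Obj K; f \<in> Hom K x y; g \<in> Hom K y z\<rbrakk>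
    \<Longrightarrow> Comp Q x y z (cls y z g) (cls x y f) = cls x z (Comp K x y z g f)"
  unfolding quotient_cat_def
  using equiv_class_eq[OF equiv_E E_Comp[OF _ _ _ rep_cls(1) rep_cls(1)]] by simp

lemma Ident_Q: "Ident Q x = cls x x (Ident K x)"
  by (simp add: quotient_cat_def)

lemma category_Q: "category Q"
proof
  fix x assume "x \<in> Obj Q"
  then show "Ident Q x \<in> Hom Q x x" by (simp add: Ident_Q cls_in Ident_in)
next
  fix x y z F G assume "x \<in> Obj Q" "y \<in> Obj Q" "z \<in> Obj Q" "F \<in> Hom Q x y" "G \<in> Hom Q y z"
  then show "Comp Q x y z G F \<in> Hom Q x z"
    by (elim Hom_Q_cases) (simp add: Comp_Q cls_in Comp_in)
next
  fix x y F assume "x \<in> Obj Q" "y \<in> Obj Q" "F \<in> Hom Q x y"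
  then show "Comp Q x x y F (Ident Q x) = F" "Comp Q x y y (Ident Q y) F = F"
    by (elim Hom_Q_cases, simp add: Comp_Q Ident_Q Ident_in Comp_Ident_left Comp_Ident_right)+
next
  fix w x y z F G H
  assume "w \<in> Obj Q" "x \<in> Obj Q" "y \<in> Obj Q" "z \<in> Obj Q" "F \<in> Hom Q w x" "G \<in> Hom Q x y" "H \<in> Hom Q y z"
  then show "Comp Q w y z H (Comp Q w x y G F) = Comp Q w x z (Comp Q x y z H G) F"
    by (elim Hom_Q_cases) (simp add: Comp_Q Comp_in Comp_assoc)
qed

end

text \<open>With the evaluation of walks for \<open>FM\<close>, this is the relation by which
  \<open>quiver_cat\<close> divides the free category.\<close>

definition kernel_rel :: "('o, 'm, 'z) cat_scheme \<Rightarrow> ('o \<Rightarrow> 'o \<Rightarrow> 'm \<Rightarrow> 'n) \<Rightarrow> 'o \<Rightarrow> 'o \<Rightarrow> 'm rel" where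
  "kernel_rel C FM x y = {(p, q). p \<in> Hom C x y \<and> q \<in> Hom C x y \<and> FM x y p = FM x y q}"

lemma kernel_relD: "(p, q) \<in> kernel_rel C FM x y \<Longrightarrow> FM x y p = FM x y q"
  by (simp add: kernel_rel_def)

context is_functor
begin

lemma quotient_kernel: "quotient_category C (kernel_rel C FM)"
  by unfold_locales
    (auto simp: cat_congruence_def kernel_rel_def equiv_def refl_on_def sym_def trans_def C.Comp_in FM_Comp)

lemma FM_rep_kernel:
  assumes "x \<in> Obj C" "y \<in> Obj C" "f \<in> Hom C x y"
  shows "FM x y (rep (kernel_rel C FM x y `` {f})) = FM x y f"
  using kernel_relD[OF quotient_category.rep_cls(1)[OF quotient_kernel assms]] by simp

text \<open>All members of a class have the same image, so evaluating on the chosen representative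
  is well defined.\<close>

lemma functor_quotient_kernel: "is_functor (quotient_cat C (kernel_rel C FM)) D FO (\<lambda>x y F. FM x y (rep F))"
proof -
  interpret Q: quotient_category C "kernel_rel C FM" by (rule quotient_kernel)
  interpret CQ: category Q.Q by (rule Q.category_Q)
  show ?thesis
  proof
    fix x y F assume "x \<in> Obj Q.Q" "y \<in> Obj Q.Q" "F \<in> Hom Q.Q x y"
    then show "FM x y (rep F) \<in> Hom D (FO x) (FO y)"
      by (elim Q.Hom_Q_cases) (simp add: FM_rep_kernel FM_in)
  next
    fix x y z F G assume "x \<in> Obj Q.Q" "y \<in> Obj Q.Q" "z \<in> Obj Q.Q" "F \<in> Hom Q.Q x y" "G \<in> Hom Q.Q y z"
    then show "FM x z (rep (Comp Q.Q x y z G F)) = Comp D (FO x) (FO y) (FO z) (FM y z (rep G)) (FM x y (rep F))"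
      by (elim Q.Hom_Q_cases) (simp add: Q.Comp_Q FM_rep_kernel FM_Comp C.Comp_in)
  qed (simp_all add: FO_in Q.Ident_Q FM_rep_kernel C.Ident_in FM_Ident)
qed

lemma faithful_quotient_kernel:
  assumes "x \<in> Obj C" "y \<in> Obj C" "F \<in> Hom (quotient_cat C (kernel_rel C FM)) x y"
    "G \<in> Hom (quotient_cat C (kernel_rel C FM)) x y" "FM x y (rep F) = FM x y (rep G)"
  shows "F = G"
proof -
  interpret Q: quotient_category C "kernel_rel C FM" by (rule quotient_kernel)
  from assms show ?thesis
    by (elim Q.Hom_Q_cases) (simp add: FM_rep_kernel Q.cls_eq_iff, simp add: kernel_rel_def)
qed

text \<open>Allows fullness to be tested before dividing by the kernel, that is, on walks.\<close>

lemma image_quotient_kernel: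
  assumes "x \<in> Obj C" "y \<in> Obj C"
  shows "(\<lambda>F. FM x y (rep F)) ` Hom (quotient_cat C (kernel_rel C FM)) x y = FM x y ` Hom C x y"
proof -
  interpret Q: quotient_category C "kernel_rel C FM" by (rule quotient_kernel)
  show ?thesis
  proof (intro equalityI subsetI; elim imageE)
    fix g F assume "g = FM x y (rep F)" "F \<in> Hom Q.Q x y"
    with assms show "g \<in> FM x y ` Hom C x y" by (elim Q.Hom_Q_cases) (simp add: FM_rep_kernel)
  next
    fix g f assume "g = FM x y f" "f \<in> Hom C x y"
    with assms show "g \<in> (\<lambda>F. FM x y (rep F)) ` Hom Q.Q x y"
      by (intro image_eqI[of _ _ "Q.cls x y f"]) (simp_all add: FM_rep_kernel Q.cls_in)
  qed
qed

end

section \<open>Linear categories\<close>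

lemma cring_scalar_ring: "cring (scalar_ring :: 'k::{comm_ring,comm_monoid_mult} ring)"
  unfolding scalar_ring_def
  by (intro cringI abelian_groupI comm_monoidI)
    (auto simp: algebra_simps intro: exI[of _ "- x" for x])

text \<open>The records have no field for negatives; the scalar \<open>- 1\<close> provides the
  additive inverse.\<close>

lemma module_hom_moduleI:
  fixes A :: "('o, 'm, 'k::{comm_ring,comm_monoid_mult}, 'z) lincat_scheme"
  assumes "\<And>f g. f \<in> Hom A x y \<Longrightarrow> g \<in> Hom A x y \<Longrightarrow> HAdd A x y f g \<in> Hom A x y"
    and "HZero A x y \<in> Hom A x y"
    and "\<And>c f. f \<in> Hom A x y \<Longrightarrow> HScale A x y c f \<in> Hom A x y"
    and "\<And>f g h. f \<in> Hom A x y \<Longrightarrow> g \<in> Hom A x y \<Longrightarrow> h \<in> Hom A x y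
      \<Longrightarrow> HAdd A x y (HAdd A x y f g) h = HAdd A x y f (HAdd A x y g h)"
    and "\<And>f g. f \<in> Hom A x y \<Longrightarrow> g \<in> Hom A x y \<Longrightarrow> HAdd A x y f g = HAdd A x y g f"
    and "\<And>f. f \<in> Hom A x y \<Longrightarrow> HAdd A x y (HZero A x y) f = f"
    and "\<And>f. f \<in> Hom A x y \<Longrightarrow> HAdd A x y (HScale A x y (- 1) f) f = HZero A x y"
    and "\<And>c d f. f \<in> Hom A x y \<Longrightarrow> HScale A x y (c + d) f = HAdd A x y (HScale A x y c f) (HScale A x y d f)"
    and "\<And>c f g. f \<in> Hom A x y \<Longrightarrow> g \<in> Hom A x y
      \<Longrightarrow> HScale A x y c (HAdd A x y f g) = HAdd A x y (HScale A x y c f) (HScale A x y c g)"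
    and "\<And>c d f. f \<in> Hom A x y \<Longrightarrow> HScale A x y (c * d) f = HScale A x y c (HScale A x y d f)"
    and "\<And>f. f \<in> Hom A x y \<Longrightarrow> HScale A x y 1 f = f"
  shows "Module.module scalar_ring (hom_module A x y)"
proof (rule Module.module.intro)
  show "cring (scalar_ring :: 'k ring)" by (rule cring_scalar_ring)
  show "abelian_group (hom_module A x y)"
  proof (rule abelian_groupI)
    fix f assume "f \<in> carrier (hom_module A x y)"
    then show "\<exists>g\<in>carrier (hom_module A x y). g \<oplus>\<^bsub>hom_module A x y\<^esub> f = \<zero>\<^bsub>hom_module A x y\<^esub>"
      using assms(3,7) by (auto simp: hom_module_def)
  qed (use assms in \<open>auto simp: hom_module_def\<close>)
  show "module_axioms scalar_ring (hom_module A x y)"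
    by unfold_locales (use assms in \<open>auto simp: hom_module_def scalar_ring_def\<close>)
qed

context lin_category
begin

lemma
  assumes "x \<in> Obj A" "y \<in> Obj A"
  shows HZero_in: "HZero A x y \<in> Hom A x y"
    and HAdd_in: "\<lbrakk>f \<in> Hom A x y; g \<in> Hom A x y\<rbrakk> \<Longrightarrow> HAdd A x y f g \<in> Hom A x y"
    and HScale_in: "f \<in> Hom A x y \<Longrightarrow> HScale A x y c f \<in> Hom A x y"
    and HAdd_assoc: "\<lbrakk>f \<in> Hom A x y; g \<in> Hom A x y; h \<in> Hom A x y\<rbrakk>
      \<Longrightarrow> HAdd A x y (HAdd A x y f g) h = HAdd A x y f (HAdd A x y g h)"
    and HAdd_commute: "\<lbrakk>f \<in> Hom A x y; g \<in> Hom A x y\<rbrakk> \<Longrightarrow> HAdd A x y f g = HAdd A x y g f"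
    and HAdd_HZero_left: "f \<in> Hom A x y \<Longrightarrow> HAdd A x y (HZero A x y) f = f"
    and HAdd_HZero_right: "f \<in> Hom A x y \<Longrightarrow> HAdd A x y f (HZero A x y) = f"
    and HScale_add_left: "f \<in> Hom A x y \<Longrightarrow> HScale A x y (c + d) f = HAdd A x y (HScale A x y c f) (HScale A x y d f)"
    and HScale_add_right: "\<lbrakk>f \<in> Hom A x y; g \<in> Hom A x y\<rbrakk>
      \<Longrightarrow> HScale A x y c (HAdd A x y f g) = HAdd A x y (HScale A x y c f) (HScale A x y c g)"
    and HScale_mult: "f \<in> Hom A x y \<Longrightarrow> HScale A x y (c * d) f = HScale A x y c (HScale A x y d f)"
    and HScale_one: "f \<in> Hom A x y \<Longrightarrow> HScale A x y 1 f = f"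
    and HScale_zero_left: "f \<in> Hom A x y \<Longrightarrow> HScale A x y 0 f = HZero A x y"
    and HScale_HZero: "HScale A x y c (HZero A x y) = HZero A x y"
proof -
  interpret M: Module.module "scalar_ring :: 'k ring" "hom_module A x y"
    by (rule module_Hom[OF assms])
  note M_simps = hom_module_def scalar_ring_def
  show "HZero A x y \<in> Hom A x y" using M.zero_closed by (simp add: M_simps)
  show "\<lbrakk>f \<in> Hom A x y; g \<in> Hom A x y\<rbrakk> \<Longrightarrow> HAdd A x y f g \<in> Hom A x y"
    using M.add.m_closed[of f g] by (simp add: M_simps)
  show "f \<in> Hom A x y \<Longrightarrow> HScale A x y c f \<in> Hom A x y"
    using M.smult_closed[of c f] by (simp add: M_simps)
  show "\<lbrakk>f \<in> Hom A x y; g \<in> Hom A x y; h \<in> Hom A x y\<rbrakk>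
      \<Longrightarrow> HAdd A x y (HAdd A x y f g) h = HAdd A x y f (HAdd A x y g h)"
    using M.add.m_assoc[of f g h] by (simp add: M_simps)
  show "\<lbrakk>f \<in> Hom A x y; g \<in> Hom A x y\<rbrakk> \<Longrightarrow> HAdd A x y f g = HAdd A x y g f"
    using M.add.m_comm[of f g] by (simp add: M_simps)
  show "f \<in> Hom A x y \<Longrightarrow> HAdd A x y (HZero A x y) f = f"
    using M.add.l_one[of f] by (simp add: M_simps)
  show "f \<in> Hom A x y \<Longrightarrow> HAdd A x y f (HZero A x y) = f"
    using M.add.r_one[of f] by (simp add: M_simps)
  show "f \<in> Hom A x y \<Longrightarrow> HScale A x y (c + d) f = HAdd A x y (HScale A x y c f) (HScale A x y d f)"
    using M.smult_l_distr[of c d f] by (simp add: M_simps)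
  show "\<lbrakk>f \<in> Hom A x y; g \<in> Hom A x y\<rbrakk>
      \<Longrightarrow> HScale A x y c (HAdd A x y f g) = HAdd A x y (HScale A x y c f) (HScale A x y c g)"
    using M.smult_r_distr[of c f g] by (simp add: M_simps)
  show "f \<in> Hom A x y \<Longrightarrow> HScale A x y (c * d) f = HScale A x y c (HScale A x y d f)"
    using M.smult_assoc1[of c d f] by (simp add: M_simps)
  show "f \<in> Hom A x y \<Longrightarrow> HScale A x y 1 f = f"
    using M.smult_one[of f] by (simp add: M_simps)
  show "f \<in> Hom A x y \<Longrightarrow> HScale A x y 0 f = HZero A x y"
    using M.smult_l_null[of f] by (simp add: M_simps)
  show "HScale A x y c (HZero A x y) = HZero A x y"
    using M.smult_r_null[of c] by (simp add: M_simps)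
qed

lemma HAdd_neg:
  assumes "x \<in> Obj A" "y \<in> Obj A" "f \<in> Hom A x y"
  shows "HAdd A x y (HScale A x y (- 1) f) f = HZero A x y" "HAdd A x y f (HScale A x y (- 1) f) = HZero A x y"
  using HScale_add_left[OF assms, of "- 1" 1] HScale_add_left[OF assms, of 1 "- 1"] assms
  by (simp_all add: HScale_one HScale_zero_left)

lemma HAdd_left_commute:
  "\<lbrakk>x \<in> Obj A; y \<in> Obj A; f \<in> Hom A x y; g \<in> Hom A x y; h \<in> Hom A x y\<rbrakk>
    \<Longrightarrow> HAdd A x y f (HAdd A x y g h) = HAdd A x y g (HAdd A x y f h)"
  by (metis HAdd_assoc HAdd_commute)

lemma HAdd_neg_cancel:
  assumes "x \<in> Obj A" "y \<in> Obj A" "f \<in> Hom A x y" "g \<in> Hom A x y"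
  shows "HAdd A x y f (HAdd A x y (HScale A x y (- 1) f) g) = g"
  using assms HAdd_assoc[of x y f "HScale A x y (- 1) f" g]
  by (simp add: HScale_in HAdd_neg HAdd_HZero_left)

lemma Comp_HZero_right:
  assumes "x \<in> Obj A" "y \<in> Obj A" "z \<in> Obj A" "g \<in> Hom A y z"
  shows "Comp A x y z g (HZero A x y) = HZero A x z"
  using Comp_scale_right[OF assms(1-3) HZero_in[OF assms(1,2)] assms(4), of 0] assms
  by (simp add: HScale_HZero HScale_zero_left Comp_in HZero_in)

lemma Comp_HZero_left:
  assumes "x \<in> Obj A" "y \<in> Obj A" "z \<in> Obj A" "f \<in> Hom A x y"
  shows "Comp A x y z (HZero A y z) f = HZero A x z"
  using Comp_scale_left[OF assms(1-4) HZero_in[OF assms(2,3)], of 0] assms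
  by (simp add: HScale_HZero HScale_zero_left Comp_in HZero_in)

lemma HScale_commute:
  "\<lbrakk>x \<in> Obj A; y \<in> Obj A; f \<in> Hom A x y\<rbrakk> \<Longrightarrow> HScale A x y c (HScale A x y d f) = HScale A x y d (HScale A x y c f)"
  by (simp add: mult.commute flip: HScale_mult)

text \<open>In a linear category the vanishing of the identity is equivalent to being initial and
  terminal, and it is what an inverted zero morphism yields directly.\<close>

definition zero_object :: "'o \<Rightarrow> bool" where
  "zero_object x \<longleftrightarrow> x \<in> Obj A \<and> Ident A x = HZero A x x"

lemma zero_object_Hom:
  assumes "x \<in> Obj A" "y \<in> Obj A" "zero_object x \<or> zero_object y" "f \<in> Hom A x y"
  shows "f = HZero A x y"
  using assms Comp_Ident_right[of x y f] Comp_Ident_left[of x y f]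
  by (auto simp: zero_object_def Comp_HZero_left Comp_HZero_right)

text \<open>A morphism into a zero object vanishes, so the identity of \<open>x\<close>, a composite
  with it, vanishes too.\<close>

lemma zero_object_isomorphic:
  assumes "x \<in> Obj A" "zero_object y" "isomorphic_objs A x y"
  shows "zero_object x"
proof -
  from assms obtain f g where fg: "inverse_mors A x y f g"
    unfolding isomorphic_objs_def iso_mor_iff by blast
  with assms have "f = HZero A x y" by (intro zero_object_Hom) (auto simp: inverse_mors_def zero_object_def)
  with fg assms have "Ident A x = HZero A x x"
    using Comp_HZero_right[of x y x g] by (auto simp: inverse_mors_def zero_object_def)
  with assms show ?thesis by (simp add: zero_object_def)
qed

text \<open>Provides the isomorphism from a point of a dead pixel to the adjoined zero
  object.\<close>

lemma zero_objects_inverse_mors: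
  assumes "zero_object x" "zero_object y"
  shows "inverse_mors A x y (HZero A x y) (HZero A y x)"
  using assms by (auto simp: zero_object_def inverse_mors_def HZero_in Comp_HZero_left)

end

section \<open>Quotients of linear categories by ideals\<close>

locale quotient_lin_category = lin_category A
  for A :: "('o, 'm, 'k::{comm_ring,comm_monoid_mult}, 'z) lincat_scheme" +
  fixes I :: "'o \<Rightarrow> 'o \<Rightarrow> 'm set"
  assumes ideal: "lin_ideal A I"
begin

lemma
  assumes "x \<in> Obj A" "y \<in> Obj A"
  shows I_subset: "f \<in> I x y \<Longrightarrow> f \<in> Hom A x y"
    and I_zero: "HZero A x y \<in> I x y"
    and I_add: "\<lbrakk>f \<in> I x y; g \<in> I x y\<rbrakk> \<Longrightarrow> HAdd A x y f g \<in> I x y"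
    and I_scale: "f \<in> I x y \<Longrightarrow> HScale A x y c f \<in> I x y"
    and I_Comp_left: "\<lbrakk>z \<in> Obj A; f \<in> I x y; g \<in> Hom A y z\<rbrakk> \<Longrightarrow> Comp A x y z g f \<in> I x z"
    and I_Comp_right: "\<lbrakk>z \<in> Obj A; f \<in> Hom A x y; g \<in> I y z\<rbrakk> \<Longrightarrow> Comp A x y z g f \<in> I x z"
  using ideal assms unfolding lin_ideal_def by blast+

abbreviation E :: "'o \<Rightarrow> 'o \<Rightarrow> 'm rel" where
  "E \<equiv> ideal_rel A I"

lemma E_iff: "(f, g) \<in> E x y \<longleftrightarrow> f \<in> Hom A x y \<and> g \<in> Hom A x y \<and> (\<exists>i\<in>I x y. g = HAdd A x y f i)"
  by (simp add: ideal_rel_def)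

lemma equiv_ideal_rel:
  assumes "x \<in> Obj A" "y \<in> Obj A"
  shows "equiv (Hom A x y) (E x y)"
proof (rule equivI)
  show "E x y \<subseteq> Hom A x y \<times> Hom A x y" by (auto simp: E_iff)
  show "refl_on (Hom A x y) (E x y)"
    using assms by (auto simp: refl_on_def E_iff intro!: bexI[OF _ I_zero] simp: HAdd_HZero_right)
  show "sym (E x y)"
  proof (rule symI)
    fix f g assume "(f, g) \<in> E x y"
    then obtain i where i: "f \<in> Hom A x y" "i \<in> I x y" "g = HAdd A x y f i" by (auto simp: E_iff)
    have "f = HAdd A x y (HAdd A x y f i) (HScale A x y (- 1) i)"
      using i assms by (simp add: HAdd_assoc I_subset HScale_in HAdd_neg HAdd_HZero_right)
    with i assms show "(g, f) \<in> E x y"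
      using I_scale[OF assms i(2), of "- 1"] by (auto simp: E_iff HAdd_in I_subset)
  qed
  show "trans (E x y)"
  proof (rule transI)
    fix f g h assume "(f, g) \<in> E x y" "(g, h) \<in> E x y"
    then obtain i j where i: "f \<in> Hom A x y" "i \<in> I x y" "j \<in> I x y" "h = HAdd A x y (HAdd A x y f i) j"
      by (auto simp: E_iff)
    with assms show "(f, h) \<in> E x y"
      by (auto simp: E_iff HAdd_in I_subset HAdd_assoc intro!: bexI[of _ "HAdd A x y i j"] I_add)
  qed
qed

sublocale quotient_category A E
proof
  show "cat_congruence A E"
    unfolding cat_congruence_def
  proof (intro conjI ballI allI impI)
    fix x y assume "x \<in> Obj A" "y \<in> Obj A"
    then show "equiv (Hom A x y) (E x y)" by (rule equiv_ideal_rel)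
  next
    fix x y z f f' g g'
    assume o: "x \<in> Obj A" "y \<in> Obj A" "z \<in> Obj A" and f: "(f, f') \<in> E x y" and g: "(g, g') \<in> E y z"
    from f obtain i where i: "f \<in> Hom A x y" "i \<in> I x y" "f' = HAdd A x y f i" by (auto simp: E_iff)
    from g obtain j where j: "g \<in> Hom A y z" "j \<in> I y z" "g' = HAdd A y z g j" by (auto simp: E_iff)
    note in_simps = o i(1) j(1) i(2) j(2) I_subset HAdd_in Comp_in HZero_in
    have f': "f' \<in> Hom A x y" using i in_simps by simp
    \<comment> \<open>Expanding \<open>g'\<close> first and \<open>f'\<close> only in the first
      summand leaves two error terms, each with one factor in the ideal.\<close>
    have "Comp A x y z g' f' = HAdd A x z (Comp A x y z g f') (Comp A x y z j f')"
      using j f' by (simp add: Comp_add_left in_simps)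
    also have "Comp A x y z g f' = HAdd A x z (Comp A x y z g f) (Comp A x y z g i)"
      using i by (simp add: Comp_add_right in_simps)
    finally have "Comp A x y z g' f'
        = HAdd A x z (Comp A x y z g f) (HAdd A x z (Comp A x y z g i) (Comp A x y z j f'))"
      using f' by (simp add: HAdd_assoc in_simps)
    moreover have "HAdd A x z (Comp A x y z g i) (Comp A x y z j f') \<in> I x z"
      using f' I_Comp_left[of x y z i g] I_Comp_right[of x y z f' j] in_simps by (intro I_add) auto
    ultimately show "(Comp A x y z g f, Comp A x y z g' f') \<in> E x z"
      using f' j by (auto simp: E_iff in_simps)
  qed
qed

abbreviation L :: "('o, 'm set, 'k) lincat" where
  "L \<equiv> quotient_lincat A I"

lemma L_simps [simp]:
  "Obj L = Obj A" "Hom L = Hom Q" "Comp L = Comp Q" "Ident L = Ident Q"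
  "HZero L = (\<lambda>x y. cls x y (HZero A x y))"
  by (simp_all add: quotient_lincat_def Let_def quotient_cat_def)

lemma E_HAdd:
  assumes o: "x \<in> Obj A" "y \<in> Obj A" and f: "(f, f') \<in> E x y" and g: "(g, g') \<in> E x y"
  shows "(HAdd A x y f g, HAdd A x y f' g') \<in> E x y"
proof -
  from f obtain i where i: "f \<in> Hom A x y" "i \<in> I x y" "f' = HAdd A x y f i" by (auto simp: E_iff)
  from g obtain j where j: "g \<in> Hom A x y" "j \<in> I x y" "g' = HAdd A x y g j" by (auto simp: E_iff)
  note in_simps = o i(1) j(1) i(2) j(2) I_subset HAdd_in
  have "HAdd A x y f' g' = HAdd A x y (HAdd A x y f g) (HAdd A x y i j)"
    using i j by (simp add: in_simps HAdd_assoc HAdd_left_commute[of x y i])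
  moreover have "HAdd A x y i j \<in> I x y" by (intro I_add in_simps)
  ultimately show ?thesis using i j by (auto simp: E_iff in_simps)
qed

lemma E_HScale:
  assumes "x \<in> Obj A" "y \<in> Obj A" "(f, f') \<in> E x y"
  shows "(HScale A x y c f, HScale A x y c f') \<in> E x y"
  using assms by (auto simp: E_iff HScale_in HScale_add_right I_subset intro: I_scale)

lemma HAdd_L: "\<lbrakk>x \<in> Obj A; y \<in> Obj A; f \<in> Hom A x y; g \<in> Hom A x y\<rbrakk>
    \<Longrightarrow> HAdd L x y (cls x y f) (cls x y g) = cls x y (HAdd A x y f g)"
  using equiv_class_eq[OF equiv_E E_HAdd[OF _ _ rep_cls(1) rep_cls(1)]]
  by (simp add: quotient_lincat_def Let_def)

lemma HScale_L: "\<lbrakk>x \<in> Obj A; y \<in> Obj A; f \<in> Hom A x y\<rbrakk>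
    \<Longrightarrow> HScale L x y c (cls x y f) = cls x y (HScale A x y c f)"
  using equiv_class_eq[OF equiv_E E_HScale[OF _ _ rep_cls(1)]]
  by (simp add: quotient_lincat_def Let_def)

lemma cls_eq_HZero_iff:
  assumes "x \<in> Obj A" "y \<in> Obj A" "f \<in> Hom A x y"
  shows "cls x y f = HZero L x y \<longleftrightarrow> f \<in> I x y"
proof -
  have "cls x y f = HZero L x y \<longleftrightarrow> (HZero A x y, f) \<in> E x y"
    using assms cls_eq_iff[of x y "HZero A x y" f] by (auto simp: HZero_in)
  also have "\<dots> \<longleftrightarrow> f \<in> I x y"
    using assms by (auto simp: E_iff HZero_in HAdd_HZero_left I_subset)
  finally show ?thesis .
qed

lemma lin_category_L: "lin_category L"
proof (intro lin_category.intro lin_category_axioms.intro)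
  show "category L" using category_Q by (simp add: category_def)
next
  fix x y assume o: "x \<in> Obj L" "y \<in> Obj L"
  note simps = HAdd_L HScale_L cls_in HAdd_in HZero_in HScale_in HAdd_HZero_left HAdd_neg HScale_add_left
    HScale_add_right HScale_mult HScale_one
  show "Module.module scalar_ring (hom_module L x y)"
  proof (rule module_hom_moduleI)
    fix F G H assume "F \<in> Hom L x y" "G \<in> Hom L x y" "H \<in> Hom L x y"
    then show "HAdd L x y (HAdd L x y F G) H = HAdd L x y F (HAdd L x y G H)"
      unfolding L_simps using o by (elim Hom_Q_cases) (simp add: simps HAdd_assoc)
  next
    fix F G assume "F \<in> Hom L x y" "G \<in> Hom L x y"
    then show "HAdd L x y F G = HAdd L x y G F"
      unfolding L_simps using o by (elim Hom_Q_cases) (simp add: simps HAdd_commute)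
  qed (unfold L_simps, use o in \<open>auto elim!: Hom_Q_cases simp: simps\<close>)
next
  fix x y z f f' g assume "x \<in> Obj L" "y \<in> Obj L" "z \<in> Obj L" "f \<in> Hom L x y" "f' \<in> Hom L x y" "g \<in> Hom L y z"
  then show "Comp L x y z g (HAdd L x y f f') = HAdd L x z (Comp L x y z g f) (Comp L x y z g f')"
    unfolding L_simps by (elim Hom_Q_cases) (simp add: HAdd_L Comp_Q HAdd_in Comp_in Comp_add_right)
next
  fix x y z f g g' assume "x \<in> Obj L" "y \<in> Obj L" "z \<in> Obj L" "f \<in> Hom L x y" "g \<in> Hom L y z" "g' \<in> Hom L y z"
  then show "Comp L x y z (HAdd L y z g g') f = HAdd L x z (Comp L x y z g f) (Comp L x y z g' f)"
    unfolding L_simps by (elim Hom_Q_cases) (simp add: HAdd_L Comp_Q HAdd_in Comp_in Comp_add_left)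
next
  fix x y z f g c assume "x \<in> Obj L" "y \<in> Obj L" "z \<in> Obj L" "f \<in> Hom L x y" "g \<in> Hom L y z"
  then show "Comp L x y z g (HScale L x y c f) = HScale L x z c (Comp L x y z g f)"
    "Comp L x y z (HScale L y z c g) f = HScale L x z c (Comp L x y z g f)"
    unfolding L_simps
    by (elim Hom_Q_cases, simp add: HScale_L Comp_Q HScale_in Comp_in Comp_scale_left Comp_scale_right)+
qed

end

section \<open>Generated ideals and kernels of linear functors\<close>

lemma lin_ideal_generated_ideal:
  assumes "lin_category A"
  shows "lin_ideal A (generated_ideal A S)"
proof -
  interpret lin_category A by (rule assms)
  show ?thesis
    unfolding lin_ideal_def generated_ideal_def
    by (auto simp: HZero_in HAdd_in HScale_in Comp_in)
qed

lemma generated_ideal_minimal: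
  assumes "f \<in> generated_ideal A S x y" "lin_ideal A J" "\<And>u v g. u \<in> Obj A \<Longrightarrow> v \<in> Obj A \<Longrightarrow> g \<in> S u v \<Longrightarrow> g \<in> J u v"
  shows "f \<in> J x y"
  using assms unfolding generated_ideal_def by blast

lemma generated_ideal_generator:
  "\<lbrakk>x \<in> Obj A; y \<in> Obj A; f \<in> S x y; f \<in> Hom A x y\<rbrakk> \<Longrightarrow> f \<in> generated_ideal A S x y"
  unfolding generated_ideal_def by blast

context is_lin_functor
begin

text \<open>With \<open>Phi\<close> for \<open>FM\<close>, this is the ideal by which
  \<open>lin_quiver_cat\<close> divides the free linear category.\<close>

definition kernel_ideal :: "'o \<Rightarrow> 'o \<Rightarrow> 'm set" where
  "kernel_ideal x y = {h \<in> Hom C x y. FM x y h = HZero D (FO x) (FO y)}"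

lemma FM_zero: "x \<in> Obj C \<Longrightarrow> y \<in> Obj C \<Longrightarrow> FM x y (HZero C x y) = HZero D (FO x) (FO y)"
  using FM_scale[of x y "HZero C x y" 0]
  by (simp add: C.HScale_HZero C.HZero_in D.HScale_zero_left FM_in FO_in)

lemma quotient_kernel_ideal: "quotient_lin_category C kernel_ideal"
proof
  show "lin_ideal C kernel_ideal"
    unfolding lin_ideal_def kernel_ideal_def
    by (auto simp: C.HZero_in C.HAdd_in C.HScale_in C.Comp_in FM_zero FM_add FM_scale FM_Comp FM_in FO_in
        D.HAdd_HZero_left D.HScale_HZero D.HZero_in D.Comp_HZero_left D.Comp_HZero_right)
qed

text \<open>Two parallel morphisms have the same image exactly when their difference, formed with
  the scalar \<open>- 1\<close>, is killed. This makes the results on \<open>kernel_rel\<close>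
  available for quotients by ideals.\<close>

lemma ideal_rel_kernel_ideal:
  assumes "x \<in> Obj C" "y \<in> Obj C"
  shows "ideal_rel C kernel_ideal x y = kernel_rel C FM x y"
proof (intro equalityI subsetI; clarify)
  fix f g assume "(f, g) \<in> ideal_rel C kernel_ideal x y"
  with assms show "(f, g) \<in> kernel_rel C FM x y"
    by (auto simp: ideal_rel_def kernel_rel_def kernel_ideal_def FM_add FM_in FO_in D.HAdd_HZero_right)
next
  fix f g assume "(f, g) \<in> kernel_rel C FM x y"
  then have fg: "f \<in> Hom C x y" "g \<in> Hom C x y" "FM x y f = FM x y g" by (auto simp: kernel_rel_def)
  let ?i = "HAdd C x y (HScale C x y (- 1) f) g"
  have "?i \<in> kernel_ideal x y"
    using assms fg by (simp add: kernel_ideal_def C.HAdd_in C.HScale_in FM_add FM_scale FM_in FO_in D.HAdd_neg)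
  moreover have "g = HAdd C x y f ?i"
    using assms fg by (simp add: C.HAdd_neg_cancel)
  ultimately show "(f, g) \<in> ideal_rel C kernel_ideal x y"
    using fg by (auto simp: ideal_rel_def)
qed

lemma FM_rep_kernel_ideal:
  assumes "x \<in> Obj C" "y \<in> Obj C" "f \<in> Hom C x y"
  shows "FM x y (rep (ideal_rel C kernel_ideal x y `` {f})) = FM x y f"
  using assms by (simp add: ideal_rel_kernel_ideal FM_rep_kernel)

lemma lin_functor_quotient_kernel:
  "is_lin_functor (quotient_lincat C kernel_ideal) D FO (\<lambda>x y F. FM x y (rep F))"
proof -
  interpret Q: quotient_lin_category C kernel_ideal by (rule quotient_kernel_ideal)
  interpret L: lin_category Q.L by (rule Q.lin_category_L)
  note rep = FM_rep_kernel_ideal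
  show ?thesis
  proof
    fix x y F assume "x \<in> Obj Q.L" "y \<in> Obj Q.L" "F \<in> Hom Q.L x y"
    then show "FM x y (rep F) \<in> Hom D (FO x) (FO y)"
      unfolding Q.L_simps by (elim Q.Hom_Q_cases) (simp add: rep FM_in)
  next
    fix x y z F G assume "x \<in> Obj Q.L" "y \<in> Obj Q.L" "z \<in> Obj Q.L" "F \<in> Hom Q.L x y" "G \<in> Hom Q.L y z"
    then show "FM x z (rep (Comp Q.L x y z G F)) = Comp D (FO x) (FO y) (FO z) (FM y z (rep G)) (FM x y (rep F))"
      unfolding Q.L_simps by (elim Q.Hom_Q_cases) (simp add: Q.Comp_Q rep FM_Comp C.Comp_in)
  next
    fix x y F G assume "x \<in> Obj Q.L" "y \<in> Obj Q.L" "F \<in> Hom Q.L x y" "G \<in> Hom Q.L x y"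
    then show "FM x y (rep (HAdd Q.L x y F G)) = HAdd D (FO x) (FO y) (FM x y (rep F)) (FM x y (rep G))"
      unfolding Q.L_simps by (elim Q.Hom_Q_cases) (simp add: Q.HAdd_L rep FM_add C.HAdd_in)
  next
    fix x y F c assume "x \<in> Obj Q.L" "y \<in> Obj Q.L" "F \<in> Hom Q.L x y"
    then show "FM x y (rep (HScale Q.L x y c F)) = HScale D (FO x) (FO y) c (FM x y (rep F))"
      unfolding Q.L_simps by (elim Q.Hom_Q_cases) (simp add: Q.HScale_L rep FM_scale C.HScale_in)
  qed (simp_all add: FO_in Q.Ident_Q rep C.Ident_in FM_Ident)
qed

lemma faithful_quotient_kernel_ideal:
  assumes "x \<in> Obj C" "y \<in> Obj C" "F \<in> Hom (quotient_lincat C kernel_ideal) x y"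
    "G \<in> Hom (quotient_lincat C kernel_ideal) x y" "FM x y (rep F) = FM x y (rep G)"
  shows "F = G"
proof -
  interpret Q: quotient_lin_category C kernel_ideal by (rule quotient_kernel_ideal)
  from assms show ?thesis
    unfolding Q.L_simps
    by (elim Q.Hom_Q_cases)
      (simp add: FM_rep_kernel_ideal Q.cls_eq_iff, simp add: ideal_rel_kernel_ideal kernel_rel_def)
qed

lemma image_quotient_kernel_ideal:
  assumes "x \<in> Obj C" "y \<in> Obj C"
  shows "FM x y ` Hom C x y \<subseteq> (\<lambda>F. FM x y (rep F)) ` Hom (quotient_lincat C kernel_ideal) x y"
proof -
  interpret Q: quotient_lin_category C kernel_ideal by (rule quotient_kernel_ideal)
  show ?thesis
  proof clarify
    fix f assume "f \<in> Hom C x y"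
    with assms show "FM x y f \<in> (\<lambda>F. FM x y (rep F)) ` Hom Q.L x y"
      by (intro image_eqI[of _ _ "Q.cls x y f"]) (simp_all add: FM_rep_kernel_ideal Q.cls_in)
  qed
qed

end

text \<open>Compared with the plain retraction, only linearity of the quasi-inverse is new.
  Conjugation is linear because composition is bilinear, and faithfulness carries this back through
  \<open>FM\<close>.\<close>

lemma equivalent_lincats_of_retraction:
  fixes Q :: "('p, 'n, 'k::{comm_ring,comm_monoid_mult}, 'y) lincat_scheme"
    and D :: "('o, 'm, 'k, 'z) lincat_scheme"
  assumes "iso_family D b \<theta> \<iota>" and F: "is_lin_functor Q D FO FM"
    and faithful: "\<And>x y p q. \<lbrakk>x \<in> Obj Q; y \<in> Obj Q; p \<in> Hom Q x y; q \<in> Hom Q x y; FM x y p = FM x y q\<rbrakk>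
      \<Longrightarrow> p = q"
    and a_in: "\<And>u. u \<in> Obj D \<Longrightarrow> a u \<in> Obj Q"
    and b_eq: "\<And>u. u \<in> Obj D \<Longrightarrow> b u = FO (a u)"
    and a_FO: "\<And>x. x \<in> Obj Q \<Longrightarrow> a (FO x) = x"
    and \<theta>_FO: "\<And>x. x \<in> Obj Q \<Longrightarrow> \<theta> (FO x) = Ident D (FO x)"
    and full: "\<And>u v f. \<lbrakk>u \<in> Obj D; v \<in> Obj D; f \<in> Hom D u v\<rbrakk>
      \<Longrightarrow> iso_family.conj_mor D b \<theta> \<iota> u v f \<in> FM (a u) (a v) ` Hom Q (a u) (a v)"
  shows "equivalent_lincats D Q"
proof -
  interpret iso_family D b \<theta> \<iota> by (rule assms)
  interpret F: is_lin_functor Q D FO FM by (rule F)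
  obtain GM where G: "is_functor D Q a GM" and quasi: "quasi_inverse D Q a GM FO FM"
    and GM: "\<And>u v f. \<lbrakk>u \<in> Obj D; v \<in> Obj D; f \<in> Hom D u v\<rbrakk>
      \<Longrightarrow> GM u v f \<in> Hom Q (a u) (a v) \<and> FM (a u) (a v) (GM u v f) = conj_mor u v f"
    by (rule quasi_inverse_of_retraction[OF F.is_functor_axioms, where a = a])
      (simp_all add: a_in b_eq a_FO \<theta>_FO full, blast intro: faithful)
  interpret G: is_functor D Q a GM by (rule G)
  have "is_lin_functor D Q a GM"
  proof
    fix u v f g assume *: "u \<in> Obj D" "v \<in> Obj D" "f \<in> Hom D u v" "g \<in> Hom D u v"
    have "conj_mor u v (HAdd D u v f g) = HAdd D (b u) (b v) (conj_mor u v f) (conj_mor u v g)"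
      using * by (simp add: conj_mor_def F.D.Comp_add_right F.D.Comp_add_left b_in theta_in iota_in Comp_in)
    with * show "GM u v (HAdd D u v f g) = HAdd Q (a u) (a v) (GM u v f) (GM u v g)"
      by (intro faithful[of "a u" "a v"])
        (simp_all add: a_in GM F.D.HAdd_in F.C.HAdd_in F.FM_add b_eq)
  next
    fix u v f c assume *: "u \<in> Obj D" "v \<in> Obj D" "f \<in> Hom D u v"
    have "conj_mor u v (HScale D u v c f) = HScale D (b u) (b v) c (conj_mor u v f)"
      using * by (simp add: conj_mor_def F.D.Comp_scale_right F.D.Comp_scale_left b_in theta_in iota_in Comp_in)
    with * show "GM u v (HScale D u v c f) = HScale Q (a u) (a v) c (GM u v f)"
      by (intro faithful[of "a u" "a v"])
        (simp_all add: a_in GM F.D.HScale_in F.C.HScale_in F.FM_scale b_eq)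
  qed
  with F quasi show ?thesis unfolding equivalent_lincats_def by blast
qed

section \<open>Free categories, linearizations and localizations\<close>

lemma awalk_quiver_Nil: "pre_digraph.awalk (quiver V Arr) u [] v \<longleftrightarrow> u = v \<and> u \<in> V"
  by (auto simp: pre_digraph.awalk_def pre_digraph.cas.simps quiver_def)

lemma awalk_quiver_Cons: "pre_digraph.awalk (quiver V Arr) u ((a, e, b) # p) v \<longleftrightarrow>
    u = a \<and> a \<in> V \<and> b \<in> V \<and> e \<in> Arr a b \<and> pre_digraph.awalk (quiver V Arr) b p v"
  by (auto simp: pre_digraph.awalk_def pre_digraph.cas.simps quiver_def)

lemmas awalk_quiver = awalk_quiver_Nil awalk_quiver_Cons

lemma awalk_quiver_ends:
  assumes "pre_digraph.awalk (quiver V Arr) u p v"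
  shows "u \<in> V" "v \<in> V"
proof -
  show "u \<in> V" using assms by (cases p) (auto simp: awalk_quiver)
  show "v \<in> V" using assms by (induction p arbitrary: u) (auto simp: awalk_quiver)
qed

lemma awalk_quiver_append:
  "pre_digraph.awalk (quiver V Arr) u p v \<Longrightarrow> pre_digraph.awalk (quiver V Arr) v q w
    \<Longrightarrow> pre_digraph.awalk (quiver V Arr) u (p @ q) w"
  by (induction p arbitrary: u) (auto simp: awalk_quiver)

lemma free_cat_simps [simp]:
  "Obj (free_cat (quiver V Arr)) = V"
  "p \<in> Hom (free_cat (quiver V Arr)) u v \<longleftrightarrow> pre_digraph.awalk (quiver V Arr) u p v"
  "Comp (free_cat (quiver V Arr)) u v w q p = p @ q"
  "Ident (free_cat (quiver V Arr)) u = []"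
  by (simp_all add: free_cat_def quiver_def)

lemma category_free_cat: "category (free_cat (quiver V Arr))"
  by unfold_locales (auto simp: awalk_quiver intro: awalk_quiver_append)

context category
begin

context
  fixes V :: "'v set" and oo :: "'v \<Rightarrow> 'o" and Arr :: "'v \<Rightarrow> 'v \<Rightarrow> 'm set"
  assumes oo: "u \<in> V \<Longrightarrow> oo u \<in> Obj C"
    and Arr: "\<lbrakk>u \<in> V; v \<in> V; a \<in> Arr u v\<rbrakk> \<Longrightarrow> a \<in> Hom C (oo u) (oo v)"
begin

lemma free_functor_in:
  "pre_digraph.awalk (quiver V Arr) u p v \<Longrightarrow> free_functor C oo v p \<in> Hom C (oo u) (oo v)"
proof (induction p arbitrary: u)
  case Nil
  then show ?case by (auto simp: awalk_quiver Ident_in oo)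
next
  case (Cons e p)
  obtain a f b where "e = (a, f, b)" by (cases e)
  with Cons show ?case
    by (auto simp: awalk_quiver oo Arr intro!: Comp_in dest: awalk_quiver_ends)
qed

lemma free_functor_append:
  assumes "pre_digraph.awalk (quiver V Arr) u p v" and q: "pre_digraph.awalk (quiver V Arr) v q w"
  shows "free_functor C oo w (p @ q)
    = Comp C (oo u) (oo v) (oo w) (free_functor C oo w q) (free_functor C oo v p)"
  using assms(1)
proof (induction p arbitrary: u)
  case Nil
  then show ?case
    using awalk_quiver_ends[OF q] free_functor_in[OF q] by (auto simp: awalk_quiver Comp_Ident_right oo)
next
  case (Cons e p)
  obtain a f b where e: "e = (a, f, b)" by (cases e)
  with Cons.prems have p: "pre_digraph.awalk (quiver V Arr) b p v" and "u = a" "a \<in> V" "b \<in> V" "f \<in> Arr a b"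
    by (auto simp: awalk_quiver)
  then show ?case
    using awalk_quiver_ends[OF q]
    by (simp add: e Cons.IH[OF p] Comp_assoc[symmetric] oo Arr free_functor_in[OF p] free_functor_in[OF q])
qed

lemma is_functor_free_functor: "is_functor (free_cat (quiver V Arr)) C oo (\<lambda>u v. free_functor C oo v)"
proof -
  interpret F: category "free_cat (quiver V Arr)" by (rule category_free_cat)
  show ?thesis
    by unfold_locales (auto simp: oo free_functor_in free_functor_append)
qed

end

end

text \<open>The generated relation is an intersection of congruences, cut down to pairs in the
  hom-sets, and each clause of the definition passes to intersections.\<close>

lemma cat_congruence_generated:
  assumes "category K"
  shows "cat_congruence K (generated_congruence K S)"
proof -
  interpret category K by (rule assms)
  let ?G = "generated_congruence K S"
  have "equiv (Hom K x y) (?G x y)" if o: "x \<in> Obj K" "y \<in> Obj K" for x y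
  proof -
    have "(f, f) \<in> E x y" if "cat_congruence K E" "f \<in> Hom K x y" for E f
      using that o unfolding cat_congruence_def equiv_def refl_on_def by blast
    moreover have "(g, f) \<in> E x y" if "cat_congruence K E" "(f, g) \<in> E x y" for E f g
      using that o unfolding cat_congruence_def equiv_def sym_def by blast
    moreover have "(f, h) \<in> E x y" if "cat_congruence K E" "(f, g) \<in> E x y" "(g, h) \<in> E x y" for E f g h
      using that o unfolding cat_congruence_def equiv_def trans_def by blast
    ultimately show ?thesis
      by (intro equivI symI transI refl_onI) (unfold generated_congruence_def, blast+)
  qed
  moreover have "(Comp K x y z g f, Comp K x y z g' f') \<in> ?G x z"
    if "x \<in> Obj K" "y \<in> Obj K" "z \<in> Obj K" "(f, f') \<in> ?G x y" "(g, g') \<in> ?G y z" for x y z f f' g g'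
  proof -
    have "(Comp K x y z g f, Comp K x y z g' f') \<in> E x z"
      if "cat_congruence K E" "\<forall>u\<in>Obj K. \<forall>v\<in>Obj K. \<forall>p q. S u v p q \<longrightarrow> (p, q) \<in> E u v" for E
    proof -
      have "(f, f') \<in> E x y" "(g, g') \<in> E y z"
        using that \<open>(f, f') \<in> ?G x y\<close> \<open>(g, g') \<in> ?G y z\<close> unfolding generated_congruence_def by blast+
      with that(1) \<open>x \<in> Obj K\<close> \<open>y \<in> Obj K\<close> \<open>z \<in> Obj K\<close> show ?thesis
        unfolding cat_congruence_def by blast
    qed
    with that show ?thesis
      unfolding generated_congruence_def by (auto intro: Comp_in)
  qed
  ultimately show ?thesis unfolding cat_congruence_def by blast
qed

lemma generated_congruence_generator:
  "\<lbrakk>x \<in> Obj K; y \<in> Obj K; p \<in> Hom K x y; q \<in> Hom K x y; S x y p q\<rbrakk> \<Longrightarrow> (p, q) \<in> generated_congruence K S x y"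
  unfolding generated_congruence_def by blast

subsection \<open>Linearizations\<close>

lemma lookup_map_mult: "Poly_Mapping.lookup (Poly_Mapping.map ((*) c) f) k = c * Poly_Mapping.lookup f k"
  for c :: "'k::comm_ring"
  by (simp add: Poly_Mapping.map.rep_eq when_def)

lemma poly_mapping_sum_single: "f = (\<Sum>k\<in>Poly_Mapping.keys f. Poly_Mapping.single k (Poly_Mapping.lookup f k))"
  for f :: "'a \<Rightarrow>\<^sub>0 'k::comm_ring"
proof (rule poly_mapping_eqI)
  fix k
  have "(\<Sum>j\<in>Poly_Mapping.keys f. Poly_Mapping.lookup f j when j = k) = Poly_Mapping.lookup f k"
    by (simp add: when_def in_keys_iff)
  then show "Poly_Mapping.lookup f k
      = Poly_Mapping.lookup (\<Sum>j\<in>Poly_Mapping.keys f. Poly_Mapping.single j (Poly_Mapping.lookup f j)) k"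
    by (simp add: lookup_sum lookup_single)
qed

lemma keys_add_subset:
  "Poly_Mapping.keys f \<subseteq> H \<Longrightarrow> Poly_Mapping.keys g \<subseteq> H \<Longrightarrow> Poly_Mapping.keys (f + g) \<subseteq> H"
  using Poly_Mapping.keys_add[of f g] by blast

text \<open>Induction over the finite support. Additive statements on linear combinations are
  reduced to multiples of one basis element, and nested uses treat multilinear ones.\<close>

lemma keys_subset_induct [consumes 1, case_names zero single add]:
  fixes f :: "'a \<Rightarrow>\<^sub>0 'k::comm_ring"
  assumes f: "Poly_Mapping.keys f \<subseteq> H"
    and zero: "P 0"
    and single: "\<And>p c. p \<in> H \<Longrightarrow> P (Poly_Mapping.single p c)"
    and add: "\<And>f g. \<lbrakk>Poly_Mapping.keys f \<subseteq> H; Poly_Mapping.keys g \<subseteq> H; P f; P g\<rbrakk> \<Longrightarrow> P (f + g)"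
  shows "P f"
proof -
  \<comment> \<open>The bound on the support is proved along with \<open>P\<close>, because the
    hypothesis \<open>add\<close> asks for it on the partial sums.\<close>
  have "Poly_Mapping.keys (\<Sum>k\<in>S. Poly_Mapping.single k (Poly_Mapping.lookup f k)) \<subseteq> H
      \<and> P (\<Sum>k\<in>S. Poly_Mapping.single k (Poly_Mapping.lookup f k))"
    if "finite S" "S \<subseteq> H" for S
    using that
  proof (induction S rule: finite_induct)
    case (insert k S)
    let ?g = "Poly_Mapping.single k (Poly_Mapping.lookup f k)"
      and ?h = "\<Sum>k\<in>S. Poly_Mapping.single k (Poly_Mapping.lookup f k)"
    have "Poly_Mapping.keys ?g \<subseteq> H" "Poly_Mapping.keys ?h \<subseteq> H" "P ?g" "P ?h"
      using insert by (auto intro: single)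
    then have "Poly_Mapping.keys (?g + ?h) \<subseteq> H \<and> P (?g + ?h)" by (simp add: add keys_add_subset)
    then show ?case using insert.hyps by simp
  qed (simp add: zero)
  from this[of "Poly_Mapping.keys f"] f show ?thesis
    using poly_mapping_sum_single[of f] by simp
qed

lemma linearization_simps [simp]:
  "Obj (linearization C) = Obj C"
  "f \<in> Hom (linearization C) x y \<longleftrightarrow> Poly_Mapping.keys f \<subseteq> Hom C x y"
  "Ident (linearization C) x = Poly_Mapping.single (Ident C x) 1"
  "HZero (linearization C) x y = 0"
  "HAdd (linearization C) x y f g = f + g"
  "HScale (linearization C) x y c f = Poly_Mapping.map ((*) c) f"
  by (simp_all add: linearization_def)

context
  fixes C :: "('o, 'm, 'z) cat_scheme"
begin

abbreviation lin :: "('o, 'm \<Rightarrow>\<^sub>0 'k::{comm_ring,comm_monoid_mult}, 'k) lincat" where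
  "lin \<equiv> linearization C"

text \<open>The extra terms have coefficient zero. Bilinearity needs this freedom: the two summands
  of a sum must be expanded over a common range.\<close>

lemma lin_Comp_eq:
  assumes "finite S" "finite T" "Poly_Mapping.keys f \<subseteq> S" "Poly_Mapping.keys g \<subseteq> T"
  shows "Comp lin x y z g f = (\<Sum>a\<in>S. \<Sum>b\<in>T.
    Poly_Mapping.single (Comp C x y z b a) (Poly_Mapping.lookup g b * Poly_Mapping.lookup f a))"
proof -
  have "(\<Sum>b\<in>Poly_Mapping.keys g.
      Poly_Mapping.single (Comp C x y z b a) (Poly_Mapping.lookup g b * Poly_Mapping.lookup f a))
    = (\<Sum>b\<in>T. Poly_Mapping.single (Comp C x y z b a) (Poly_Mapping.lookup g b * Poly_Mapping.lookup f a))"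
    for a
    using assms by (intro sum.mono_neutral_left) (auto simp: in_keys_iff)
  then show ?thesis
    unfolding linearization_def using assms by (simp, intro sum.mono_neutral_left) (auto simp: in_keys_iff)
qed

lemma lin_Comp_add_right: "Comp lin x y z g (f + f') = Comp lin x y z g f + Comp lin x y z g f'"
proof -
  let ?S = "Poly_Mapping.keys f \<union> Poly_Mapping.keys f'" and ?T = "Poly_Mapping.keys g"
  show ?thesis
    using Poly_Mapping.keys_add[of f f']
    by (simp add: lin_Comp_eq[of ?S ?T] lookup_add distrib_left single_add sum.distrib)
qed

lemma lin_Comp_add_left: "Comp lin x y z (g + g') f = Comp lin x y z g f + Comp lin x y z g' f"
proof -
  let ?S = "Poly_Mapping.keys f" and ?T = "Poly_Mapping.keys g \<union> Poly_Mapping.keys g'"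
  show ?thesis
    using Poly_Mapping.keys_add[of g g']
    by (simp add: lin_Comp_eq[of ?S ?T] lookup_add distrib_right single_add sum.distrib)
qed

lemma lin_Comp_single: "Comp lin x y z (Poly_Mapping.single b d) (Poly_Mapping.single a c)
    = Poly_Mapping.single (Comp C x y z b a) (d * c)"
  by (simp add: lin_Comp_eq[of "{a}" "{b}"])

lemma lin_Comp_zero: "Comp lin x y z 0 f = 0" "Comp lin x y z g 0 = 0"
  by (simp_all add: linearization_def)

lemma map_mult_add: "Poly_Mapping.map ((*) c) (f + g) = Poly_Mapping.map ((*) c) f + Poly_Mapping.map ((*) c) g"
  for c :: "'k::{comm_ring,comm_monoid_mult}"
  by (rule poly_mapping_eqI) (simp add: lookup_map_mult lookup_add distrib_left)

lemma map_mult_zero: "Poly_Mapping.map ((*) c) 0 = 0"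
  for c :: "'k::{comm_ring,comm_monoid_mult}"
  by (rule poly_mapping_eqI) (simp add: lookup_map_mult)

lemma keys_map_mult: "Poly_Mapping.keys (Poly_Mapping.map ((*) c) f) \<subseteq> Poly_Mapping.keys f"
  for c :: "'k::{comm_ring,comm_monoid_mult}"
  by (auto simp: in_keys_iff lookup_map_mult)

end

context category
begin

lemma lin_Comp_keys:
  assumes o: "x \<in> Obj C" "y \<in> Obj C" "z \<in> Obj C"
    and "Poly_Mapping.keys f \<subseteq> Hom C x y" "Poly_Mapping.keys g \<subseteq> Hom C y z"
  shows "Poly_Mapping.keys (Comp (lin C) x y z g f) \<subseteq> Hom C x z"
  using assms(4)
proof (induction f rule: keys_subset_induct)
  case zero
  then show ?case by (simp add: lin_Comp_zero)
next
  case (single p c)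
  from assms(5) show ?case
  proof (induction g rule: keys_subset_induct)
    case (add f g)
    then show ?case unfolding lin_Comp_add_left by (intro keys_add_subset)
  qed (use o single in \<open>auto simp: lin_Comp_zero lin_Comp_single Comp_in\<close>)
next
  case (add f g)
  then show ?case unfolding lin_Comp_add_right by (intro keys_add_subset)
qed

lemma lin_category_linearization:
  "lin_category (linearization C :: ('o, 'm \<Rightarrow>\<^sub>0 'k::{comm_ring,comm_monoid_mult}, 'k) lincat)"
proof (intro lin_category.intro lin_category_axioms.intro category.intro)
  let ?L = "lin C :: ('o, 'm \<Rightarrow>\<^sub>0 'k, 'k) lincat"
  fix x assume "x \<in> Obj ?L"
  then show "Ident ?L x \<in> Hom ?L x x" by (simp add: Ident_in)
next
  let ?L = "lin C :: ('o, 'm \<Rightarrow>\<^sub>0 'k, 'k) lincat"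
  fix x y z f g assume "x \<in> Obj ?L" "y \<in> Obj ?L" "z \<in> Obj ?L" "f \<in> Hom ?L x y" "g \<in> Hom ?L y z"
  then show "Comp ?L x y z g f \<in> Hom ?L x z" by (simp add: lin_Comp_keys)
next
  let ?L = "lin C :: ('o, 'm \<Rightarrow>\<^sub>0 'k, 'k) lincat"
  fix x y f assume o: "x \<in> Obj ?L" "y \<in> Obj ?L" and "f \<in> Hom ?L x y"
  from this(3) have f: "Poly_Mapping.keys f \<subseteq> Hom C x y" by simp
  from f show "Comp ?L x x y f (Ident ?L x) = f"
    by (induction f rule: keys_subset_induct)
      (use o in \<open>auto simp: lin_Comp_zero lin_Comp_single lin_Comp_add_left Comp_Ident_right\<close>)
  from f show "Comp ?L x y y (Ident ?L y) f = f"
    by (induction f rule: keys_subset_induct)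
      (use o in \<open>auto simp: lin_Comp_zero lin_Comp_single lin_Comp_add_right Comp_Ident_left\<close>)
next
  let ?L = "lin C :: ('o, 'm \<Rightarrow>\<^sub>0 'k, 'k) lincat"
  fix w x y z f g h
  assume o: "w \<in> Obj ?L" "x \<in> Obj ?L" "y \<in> Obj ?L" "z \<in> Obj ?L"
    and "f \<in> Hom ?L w x" "g \<in> Hom ?L x y" "h \<in> Hom ?L y z"
  then have f: "Poly_Mapping.keys f \<subseteq> Hom C w x" and g: "Poly_Mapping.keys g \<subseteq> Hom C x y"
    and h: "Poly_Mapping.keys h \<subseteq> Hom C y z" by simp_all
  note simps = lin_Comp_zero lin_Comp_add_left lin_Comp_add_right
  \<comment> \<open>Both sides are additive in each of the three morphisms, so three nested
    inductions leave associativity of \<open>C\<close> and of the ring.\<close>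
  from f show "Comp ?L w y z h (Comp ?L w x y g f) = Comp ?L w x z (Comp ?L x y z h g) f"
  proof (induction f rule: keys_subset_induct)
    case (single a c)
    from g show ?case
    proof (induction g rule: keys_subset_induct)
      case (single b d)
      from h show ?case
      proof (induction h rule: keys_subset_induct)
        case (single e u)
        with o \<open>a \<in> Hom C w x\<close> \<open>b \<in> Hom C x y\<close> show ?case
          by (simp add: lin_Comp_single Comp_assoc mult.assoc)
      qed (simp_all add: simps)
    qed (simp_all add: simps)
  qed (simp_all add: simps)
next
  let ?L = "lin C :: ('o, 'm \<Rightarrow>\<^sub>0 'k, 'k) lincat"
  fix x y
  show "Module.module scalar_ring (hom_module ?L x y)"
  proof (rule module_hom_moduleI)
    fix f g assume "f \<in> Hom ?L x y" "g \<in> Hom ?L x y"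
    then show "HAdd ?L x y f g \<in> Hom ?L x y"
      using Poly_Mapping.keys_add[of f g] by auto
  next
    fix c f assume "f \<in> Hom ?L x y"
    then show "HScale ?L x y c f \<in> Hom ?L x y" using keys_map_mult[of c f] by auto
  qed (auto intro!: poly_mapping_eqI simp: lookup_map_mult lookup_add algebra_simps)
next
  let ?L = "lin C :: ('o, 'm \<Rightarrow>\<^sub>0 'k, 'k) lincat"
  fix x y z :: 'o and f g :: "'m \<Rightarrow>\<^sub>0 'k" and c
  assume "f \<in> Hom ?L x y" "g \<in> Hom ?L y z"
  then have f: "Poly_Mapping.keys f \<subseteq> Hom C x y" and g: "Poly_Mapping.keys g \<subseteq> Hom C y z" by simp_all
  note simps = lin_Comp_zero lin_Comp_add_left lin_Comp_add_right map_mult_add map_mult_zero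
  show "Comp ?L x y z g (HScale ?L x y c f) = HScale ?L x z c (Comp ?L x y z g f)"
    unfolding linearization_simps using f
  proof (induction f rule: keys_subset_induct)
    case (single a d)
    from g show ?case
      by (induction g rule: keys_subset_induct) (simp_all add: simps lin_Comp_single mult.left_commute)
  qed (simp_all add: simps)
  show "Comp ?L x y z (HScale ?L y z c g) f = HScale ?L x z c (Comp ?L x y z g f)"
    unfolding linearization_simps using f
  proof (induction f rule: keys_subset_induct)
    case (single a d)
    from g show ?case
      by (induction g rule: keys_subset_induct) (simp_all add: simps lin_Comp_single mult.assoc)
  qed (simp_all add: simps)
qed (simp_all add: lin_Comp_add_right lin_Comp_add_left)

end

section \<open>Linear extension of functors to linearizations\<close>

definition lin_extension ::
  "('p, 'n, 'k::{comm_ring,comm_monoid_mult}, 'y) lincat_scheme \<Rightarrow> ('o \<Rightarrow> 'p) \<Rightarrow> ('o \<Rightarrow> 'o \<Rightarrow> 'm \<Rightarrow> 'n)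
    \<Rightarrow> 'o \<Rightarrow> 'o \<Rightarrow> ('m \<Rightarrow>\<^sub>0 'k) \<Rightarrow> 'n" where
  "lin_extension D FO FM x y h = finsum (hom_module D (FO x) (FO y))
     (\<lambda>p. HScale D (FO x) (FO y) (Poly_Mapping.lookup h p) (FM x y p)) (Poly_Mapping.keys h)"

locale functor_to_lin = is_functor C D FO FM + D: lin_category D
  for C :: "('o, 'm, 'z) cat_scheme" and D :: "('p, 'n, 'k::{comm_ring,comm_monoid_mult}, 'y) lincat_scheme"
    and FO FM
begin

abbreviation "ext \<equiv> lin_extension D FO FM"

context
  fixes x y assumes o: "x \<in> Obj C" "y \<in> Obj C"
begin

lemma module_FO: "Module.module scalar_ring (hom_module D (FO x) (FO y))"
  by (rule D.module_Hom) (use o FO_in in auto)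

lemma hom_module_simps:
  "carrier (hom_module D (FO x) (FO y)) = Hom D (FO x) (FO y)"
  "\<zero>\<^bsub>hom_module D (FO x) (FO y)\<^esub> = HZero D (FO x) (FO y)"
  "add (hom_module D (FO x) (FO y)) = HAdd D (FO x) (FO y)"
  by (simp_all add: hom_module_def)

text \<open>As for composition of linear combinations, additivity needs a common range of
  summation.\<close>

lemma ext_superset:
  assumes "finite S" "Poly_Mapping.keys h \<subseteq> S" "S \<subseteq> Hom C x y"
  shows "ext x y h = finsum (hom_module D (FO x) (FO y))
    (\<lambda>p. HScale D (FO x) (FO y) (Poly_Mapping.lookup h p) (FM x y p)) S"
proof -
  interpret M: Module.module "scalar_ring :: 'k ring" "hom_module D (FO x) (FO y)"
    by (rule module_FO)
  show ?thesis
    unfolding lin_extension_def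
  proof (rule M.add.finprod_mono_neutral_cong_left)
    fix i assume "i \<in> S - Poly_Mapping.keys h"
    then show "HScale D (FO x) (FO y) (Poly_Mapping.lookup h i) (FM x y i) = \<zero>\<^bsub>hom_module D (FO x) (FO y)\<^esub>"
      using assms(3) o by (auto simp: in_keys_iff hom_module_simps D.HScale_zero_left FM_in FO_in)
  qed (use assms o in \<open>auto simp: hom_module_simps D.HScale_in FM_in FO_in\<close>)
qed

lemma ext_zero: "ext x y 0 = HZero D (FO x) (FO y)"
proof -
  interpret M: Module.module "scalar_ring :: 'k ring" "hom_module D (FO x) (FO y)"
    by (rule module_FO)
  show ?thesis by (simp add: lin_extension_def hom_module_simps)
qed

lemma ext_add:
  assumes "Poly_Mapping.keys f \<subseteq> Hom C x y" "Poly_Mapping.keys g \<subseteq> Hom C x y"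
  shows "ext x y (f + g) = HAdd D (FO x) (FO y) (ext x y f) (ext x y g)"
proof -
  let ?S = "Poly_Mapping.keys f \<union> Poly_Mapping.keys g"
  interpret M: Module.module "scalar_ring :: 'k ring" "hom_module D (FO x) (FO y)"
    by (rule module_FO)
  let ?term = "\<lambda>h p. HScale D (FO x) (FO y) (Poly_Mapping.lookup h p) (FM x y p)"
  have S: "?S \<subseteq> Hom C x y" using assms by auto
  have "Poly_Mapping.keys (f + g) \<subseteq> ?S" by (rule Poly_Mapping.keys_add)
  then have "ext x y (f + g) = finsum (hom_module D (FO x) (FO y)) (?term (f + g)) ?S"
    using S by (intro ext_superset) auto
  also have "\<dots> = finsum (hom_module D (FO x) (FO y))
      (\<lambda>p. ?term f p \<oplus>\<^bsub>hom_module D (FO x) (FO y)\<^esub> ?term g p) ?S"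
    using S o
    by (intro M.finsum_cong')
      (auto simp: lookup_add D.HScale_add_left FM_in FO_in hom_module_simps D.HScale_in D.HAdd_in)
  also have "\<dots> = finsum (hom_module D (FO x) (FO y)) (?term f) ?S
      \<oplus>\<^bsub>hom_module D (FO x) (FO y)\<^esub> finsum (hom_module D (FO x) (FO y)) (?term g) ?S"
    using S o by (intro M.finsum_addf) (auto simp: hom_module_simps D.HScale_in FM_in FO_in)
  also have "\<dots> = HAdd D (FO x) (FO y) (ext x y f) (ext x y g)"
    using S by (simp add: ext_superset[of ?S] hom_module_simps)
  finally show ?thesis .
qed

lemma ext_single:
  assumes "p \<in> Hom C x y"
  shows "ext x y (Poly_Mapping.single p c) = HScale D (FO x) (FO y) c (FM x y p)"
proof -
  interpret M: Module.module "scalar_ring :: 'k ring" "hom_module D (FO x) (FO y)"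
    by (rule module_FO)
  show ?thesis
    using assms o M.add.finprod_insert[of "{}" p
        "\<lambda>q. HScale D (FO x) (FO y) (Poly_Mapping.lookup (Poly_Mapping.single p c) q) (FM x y q)"]
    by (subst ext_superset[of "{p}"])
      (auto simp: hom_module_simps D.HScale_in FM_in FO_in D.HAdd_HZero_right)
qed

lemma ext_in:
  assumes "Poly_Mapping.keys f \<subseteq> Hom C x y"
  shows "ext x y f \<in> Hom D (FO x) (FO y)"
  using assms
proof (induction f rule: keys_subset_induct)
  case zero
  show ?case using o by (simp add: ext_zero D.HZero_in FO_in)
next
  case (single p c)
  then show ?case using o by (simp add: ext_single D.HScale_in FM_in FO_in)
next
  case (add f g)
  then show ?case using o by (simp add: ext_add D.HAdd_in FO_in)
qed

lemma ext_scale: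
  assumes "Poly_Mapping.keys f \<subseteq> Hom C x y"
  shows "ext x y (Poly_Mapping.map ((*) c) f) = HScale D (FO x) (FO y) c (ext x y f)"
  using assms
proof (induction f rule: keys_subset_induct)
  case (add f g)
  then have "Poly_Mapping.keys (Poly_Mapping.map ((*) c) f) \<subseteq> Hom C x y"
    "Poly_Mapping.keys (Poly_Mapping.map ((*) c) g) \<subseteq> Hom C x y"
    by (simp_all add: subset_trans[OF keys_map_mult])
  with add o show ?case
    by (simp add: map_mult_add ext_add D.HScale_add_right ext_in FO_in)
qed (use o in \<open>simp_all add: map_mult_zero ext_zero ext_single D.HScale_HZero D.HScale_mult FM_in FO_in\<close>)

end

text \<open>Both sides are bilinear, so functoriality on basis morphisms decides; the two scalars
  that come out are exchanged by commutativity of the ring.\<close>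

lemma ext_Comp:
  assumes o: "x \<in> Obj C" "y \<in> Obj C" "z \<in> Obj C"
    and f: "Poly_Mapping.keys f \<subseteq> Hom C x y" and g: "Poly_Mapping.keys g \<subseteq> Hom C y z"
  shows "ext x z (Comp (lin C) x y z g f) = Comp D (FO x) (FO y) (FO z) (ext y z g) (ext x y f)"
  using f
proof (induction f rule: keys_subset_induct)
  case zero
  then show ?case using o g by (simp add: lin_Comp_zero ext_zero ext_in D.Comp_HZero_right FO_in)
next
  case (add f f')
  then show ?case
    using o g by (simp add: lin_Comp_add_right ext_add C.lin_Comp_keys D.Comp_add_right ext_in FO_in)
next
  case (single a c)
  from g show ?case
  proof (induction g rule: keys_subset_induct)
    case zero
    with o single show ?case
      by (simp add: lin_Comp_zero ext_zero ext_single D.Comp_HZero_left FO_in FM_in D.HScale_in)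
  next
    case (add g g')
    with o single show ?case
      by (simp add: lin_Comp_add_left ext_add ext_single C.lin_Comp_keys D.Comp_add_left FO_in FM_in ext_in
          D.HScale_in)
  next
    case (single b d)
    with o \<open>a \<in> Hom C x y\<close> show ?case
      by (simp add: lin_Comp_single ext_single D.Comp_scale_left D.Comp_scale_right FO_in FM_in C.Comp_in
          FM_Comp D.HScale_in D.Comp_in D.HScale_commute[of _ _ _ c d] D.HScale_mult)
  qed
qed

lemma is_lin_functor_ext: "is_lin_functor (linearization C) D FO ext"
proof -
  interpret L: lin_category "linearization C :: ('o, 'm \<Rightarrow>\<^sub>0 'k, 'k) lincat"
    by (rule C.lin_category_linearization)
  show ?thesis
    by unfold_locales
      (auto simp: FO_in ext_in ext_single C.Ident_in FM_Ident D.HScale_one D.Ident_in ext_Comp ext_add ext_scale)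
qed

end

section \<open>Adjoining a zero object\<close>

lemma adjoin_zero_simps [simp]:
  "Obj (adjoin_zero A) = insert None (Some ` Obj A)"
  "Hom (adjoin_zero A) (Some x) (Some y) = Hom A x y"
  "Hom (adjoin_zero A) None v = {0}" "Hom (adjoin_zero A) u None = {0}"
  "Comp (adjoin_zero A) (Some x) (Some y) (Some z) g f = Comp A x y z g f"
  "Comp (adjoin_zero A) None v w g f = 0" "Comp (adjoin_zero A) u None w g f = 0"
  "Comp (adjoin_zero A) u v None g f = 0"
  "Ident (adjoin_zero A) (Some x) = Ident A x" "Ident (adjoin_zero A) None = 0"
  "HZero (adjoin_zero A) (Some x) (Some y) = HZero A x y"
  "HZero (adjoin_zero A) None v = 0" "HZero (adjoin_zero A) u None = 0"
  "HAdd (adjoin_zero A) (Some x) (Some y) = HAdd A x y"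
  "HAdd (adjoin_zero A) None v f g = 0" "HAdd (adjoin_zero A) u None f g = 0"
  "HScale (adjoin_zero A) (Some x) (Some y) = HScale A x y"
  "HScale (adjoin_zero A) None v c f = 0" "HScale (adjoin_zero A) u None c f = 0"
  by (simp_all add: adjoin_zero_def fun_eq_iff split: option.splits)

text \<open>A composite through \<open>None\<close> is the value 0 of the type by definition. This
  fits together with \<open>A\<close> because its zero morphisms are assumed to be that same
  value.\<close>

lemma lin_category_adjoin_zero:
  fixes A :: "('o, 'm::zero, 'k::{comm_ring,comm_monoid_mult}) lincat"
  assumes "lin_category A" and HZero: "\<And>x y. HZero A x y = 0"
  shows "lin_category (adjoin_zero A)"
proof -
  interpret lin_category A by (rule assms(1))
  note zero = HZero_in Comp_HZero_left Comp_HZero_right HAdd_HZero_left HAdd_HZero_right HScale_HZero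
  note zero = zero[unfolded HZero]
  let ?Z = "adjoin_zero A"
  have module: "Module.module scalar_ring (hom_module ?Z u v)" if "u \<in> Obj ?Z" "v \<in> Obj ?Z" for u v
  proof (cases "\<exists>x y. u = Some x \<and> v = Some y")
    case True
    then obtain x y where "u = Some x" "v = Some y" by auto
    then show ?thesis using that module_Hom[of x y] by (simp add: hom_module_def image_iff)
  next
    case False
    then have "u = None \<or> v = None" by auto
    then show ?thesis by (intro module_hom_moduleI) auto
  qed
  show ?thesis
  proof (intro lin_category.intro lin_category_axioms.intro category.intro)
    fix u v assume "u \<in> Obj ?Z" "v \<in> Obj ?Z"
    then show "Module.module scalar_ring (hom_module ?Z u v)" by (rule module)
  next
    fix t u v w f g h
    assume "t \<in> Obj ?Z" "u \<in> Obj ?Z" "v \<in> Obj ?Z" "w \<in> Obj ?Z"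
      "f \<in> Hom ?Z t u" "g \<in> Hom ?Z u v" "h \<in> Hom ?Z v w"
    then show "Comp ?Z t v w h (Comp ?Z t u v g f) = Comp ?Z t u w (Comp ?Z u v w h g) f"
      by (cases t; cases u; cases v; cases w) (auto simp: zero Comp_in Comp_assoc)
  next
    fix u v w f g
    assume "u \<in> Obj ?Z" "v \<in> Obj ?Z" "w \<in> Obj ?Z" "f \<in> Hom ?Z u v" "g \<in> Hom ?Z v w"
    then show "Comp ?Z u v w g f \<in> Hom ?Z u w"
      by (cases u; cases v; cases w) (auto simp: zero Comp_in)
  next
    fix u v w f g c
    assume "u \<in> Obj ?Z" "v \<in> Obj ?Z" "w \<in> Obj ?Z" "f \<in> Hom ?Z u v" "g \<in> Hom ?Z v w"
    then show "Comp ?Z u v w g (HScale ?Z u v c f) = HScale ?Z u w c (Comp ?Z u v w g f)"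
      "Comp ?Z u v w (HScale ?Z v w c g) f = HScale ?Z u w c (Comp ?Z u v w g f)"
      by (cases u; cases v; cases w; auto simp: zero Comp_scale_left Comp_scale_right)+
  next
    fix u v w f f' g
    assume "u \<in> Obj ?Z" "v \<in> Obj ?Z" "w \<in> Obj ?Z" "f \<in> Hom ?Z u v" "f' \<in> Hom ?Z u v" "g \<in> Hom ?Z v w"
    then show "Comp ?Z u v w g (HAdd ?Z u v f f') = HAdd ?Z u w (Comp ?Z u v w g f) (Comp ?Z u v w g f')"
      by (cases u; cases v; cases w) (auto simp: zero Comp_add_right)
  next
    fix u v w f g g'
    assume "u \<in> Obj ?Z" "v \<in> Obj ?Z" "w \<in> Obj ?Z" "f \<in> Hom ?Z u v" "g \<in> Hom ?Z v w" "g' \<in> Hom ?Z v w"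
    then show "Comp ?Z u v w (HAdd ?Z v w g g') f = HAdd ?Z u w (Comp ?Z u v w g f) (Comp ?Z u v w g' f)"
      by (cases u; cases v; cases w) (auto simp: zero Comp_add_left)
  next
    fix u assume "u \<in> Obj ?Z"
    then show "Ident ?Z u \<in> Hom ?Z u u" by (cases u) (auto simp: Ident_in)
  next
    fix u v f assume "u \<in> Obj ?Z" "v \<in> Obj ?Z" "f \<in> Hom ?Z u v"
    then show "Comp ?Z u u v f (Ident ?Z u) = f" "Comp ?Z u v v (Ident ?Z v) f = f"
      by (cases u; cases v; auto simp: Comp_Ident_left Comp_Ident_right)+
  qed
qed

text \<open>The new object may go to any zero object of \<open>D\<close>, after which all morphisms
  from or to it are forced to be zero. Applied to the linear extension of the evaluation of walks,
  this yields \<open>Phi\<close>.\<close>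

lemma is_lin_functor_adjoin_zero:
  fixes A :: "('o, 'm::zero, 'k::{comm_ring,comm_monoid_mult}) lincat"
  assumes F: "is_lin_functor A D FO FM" and HZero: "\<And>x y. HZero A x y = 0"
    and z: "lin_category.zero_object D z"
  defines "FO' \<equiv> \<lambda>u. case u of Some x \<Rightarrow> FO x | None \<Rightarrow> z"
  shows "is_lin_functor (adjoin_zero A) D FO'
    (\<lambda>u v h. case (u, v) of (Some x, Some y) \<Rightarrow> FM x y h | _ \<Rightarrow> HZero D (FO' u) (FO' v))"
    (is "is_lin_functor ?Z D FO' ?FM")
proof -
  interpret F: is_lin_functor A D FO FM by (rule F)
  interpret Z: lin_category "adjoin_zero A" by (rule lin_category_adjoin_zero) (fact F.C.lin_category_axioms HZero)+
  have FO'_simps [simp]: "FO' (Some x) = FO x" "FO' None = z" for x by (simp_all add: FO'_def)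
  have z_in: "z \<in> Obj D" using z by (simp add: F.D.zero_object_def)
  note simps = z_in F.FO_in F.FM_in F.D.HZero_in F.D.Comp_HZero_left F.D.Comp_HZero_right F.D.HScale_HZero
    F.D.HAdd_HZero_left F.D.Comp_in F.FM_zero[unfolded HZero]
  show ?thesis
  proof
    fix u assume "u \<in> Obj ?Z"
    then show "FO' u \<in> Obj D" "?FM u u (Ident ?Z u) = Ident D (FO' u)"
      using z by (auto simp: simps F.FM_Ident F.D.zero_object_def)
  next
    fix u v f assume "u \<in> Obj ?Z" "v \<in> Obj ?Z" "f \<in> Hom ?Z u v"
    then show "?FM u v f \<in> Hom D (FO' u) (FO' v)"
      by (cases u; cases v) (auto simp: simps)
  next
    fix u v f g assume "u \<in> Obj ?Z" "v \<in> Obj ?Z" "f \<in> Hom ?Z u v" "g \<in> Hom ?Z u v"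
    then show "?FM u v (HAdd ?Z u v f g) = HAdd D (FO' u) (FO' v) (?FM u v f) (?FM u v g)"
      by (cases u; cases v) (auto simp: simps F.FM_add)
  next
    fix u v f c assume "u \<in> Obj ?Z" "v \<in> Obj ?Z" "f \<in> Hom ?Z u v"
    then show "?FM u v (HScale ?Z u v c f) = HScale D (FO' u) (FO' v) c (?FM u v f)"
      by (cases u; cases v) (auto simp: simps F.FM_scale)
  next
    fix u v w f g
    assume *: "u \<in> Obj ?Z" "v \<in> Obj ?Z" "w \<in> Obj ?Z" "f \<in> Hom ?Z u v" "g \<in> Hom ?Z v w"
    \<comment> \<open>A composite of two morphisms through \<open>None\<close> lies outside the
      functoriality of \<open>FM\<close> even when \<open>u\<close> and \<open>w\<close> are old
      objects, so it is treated separately.\<close>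
    then have "HZero D (FO' u) (FO' w) = Comp D (FO' u) (FO' v) (FO' w) (?FM v w g) (?FM u v f)" if "v = None"
      using that by (auto simp: simps)
    with * show "?FM u w (Comp ?Z u v w g f) = Comp D (FO' u) (FO' v) (FO' w) (?FM v w g) (?FM u v f)"
      by (cases u; cases v; cases w) (auto simp: simps F.FM_Comp)
  qed
qed

subsection \<open>Localizations\<close>

locale localizing = category C for C :: "('o, 'm, 'z) cat_scheme" +
  fixes \<Sigma> :: "'o \<Rightarrow> 'o \<Rightarrow> 'm set"
  assumes \<Sigma>_in: "\<lbrakk>x \<in> Obj C; y \<in> Obj C; \<sigma> \<in> \<Sigma> x y\<rbrakk> \<Longrightarrow> \<sigma> \<in> Hom C x y"
begin

abbreviation K :: "('o, ('o, 'm) zigzag) cat" where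
  "K \<equiv> free_cat (zigzag_quiver C \<Sigma>)"

lemma Obj_K [simp]: "Obj K = Obj C"
  and Comp_K [simp]: "Comp K x y z q p = p @ q"
  and Ident_K [simp]: "Ident K x = []"
  by (simp_all add: zigzag_quiver_def)

lemma Nil_in_K: "[] \<in> Hom K x y \<longleftrightarrow> x = y \<and> x \<in> Obj C"
  and Cons_in_K: "(a, e, b) # p \<in> Hom K x y \<longleftrightarrow>
    x = a \<and> a \<in> Obj C \<and> b \<in> Obj C \<and> e \<in> Inl ` Hom C a b \<union> Inr ` \<Sigma> b a \<and> p \<in> Hom K b y"
  by (simp_all add: zigzag_quiver_def awalk_quiver)

lemma category_K: "category K"
  unfolding zigzag_quiver_def by (rule category_free_cat)

lemma Hom_K_ends: "p \<in> Hom K x y \<Longrightarrow> x \<in> Obj C \<and> y \<in> Obj C"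
  unfolding zigzag_quiver_def free_cat_simps by (blast dest: awalk_quiver_ends)

lemma zigzag_cases:
  assumes "e \<in> Inl ` Hom C a b \<union> Inr ` \<Sigma> b a"
  obtains f where "f \<in> Hom C a b" "e = Inl f" | \<sigma> where "\<sigma> \<in> \<Sigma> b a" "e = Inr \<sigma>"
  using assms by auto

lemma loc_rel_in_K:
  assumes "loc_rel C \<Sigma> x y p q"
  shows "x \<in> Obj C \<and> y \<in> Obj C \<and> p \<in> Hom K x y \<and> q \<in> Hom K x y"
  using assms by cases (auto simp: Cons_in_K Nil_in_K Comp_in Ident_in \<Sigma>_in)

interpretation Loc: quotient_category K "loc_congruence C \<Sigma>"
  unfolding loc_congruence_def
  by (intro quotient_category.intro quotient_category_axioms.intro cat_congruence_generated category_K)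

abbreviation D :: "('o, ('o, 'm) zigzag set) cat" where
  "D \<equiv> localization C \<Sigma>"

abbreviation "wrd \<equiv> Loc.cls"

lemma D_eq: "D = Loc.Q"
  by (simp add: localization_def)

lemma Obj_D [simp]: "Obj D = Obj C"
  by (simp add: D_eq)

lemma category_D: "category D"
  unfolding D_eq by (rule Loc.category_Q)

lemma wrd_in: "p \<in> Hom K x y \<Longrightarrow> wrd x y p \<in> Hom D x y"
  unfolding D_eq using Hom_K_ends[of p x y] by (intro Loc.cls_in) auto

lemma wrd_append:
  assumes "p \<in> Hom K x y" "q \<in> Hom K y z"
  shows "Comp D x y z (wrd y z q) (wrd x y p) = wrd x z (p @ q)"
  unfolding D_eq using assms Hom_K_ends[OF assms(1)] Hom_K_ends[OF assms(2)]
  by (subst Loc.Comp_Q) auto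

lemma wrd_loc_rel:
  assumes "loc_rel C \<Sigma> x y p q"
  shows "wrd x y p = wrd x y q"
proof -
  have "(p, q) \<in> loc_congruence C \<Sigma> x y"
    unfolding loc_congruence_def
    by (rule generated_congruence_generator) (use assms loc_rel_in_K[OF assms] in simp_all)
  then show ?thesis using loc_rel_in_K[OF assms] by (subst Loc.cls_eq_iff) auto
qed

lemma Ident_D: "Ident D x = wrd x x []"
  unfolding D_eq by (simp add: Loc.Ident_Q)

lemma loc_mor_in: "\<lbrakk>x \<in> Obj C; y \<in> Obj C; f \<in> Hom C x y\<rbrakk> \<Longrightarrow> loc_mor C \<Sigma> x y f \<in> Hom D x y"
  unfolding loc_mor_def by (rule wrd_in) (simp add: Cons_in_K Nil_in_K)

lemma loc_mor_Ident: "x \<in> Obj C \<Longrightarrow> loc_mor C \<Sigma> x x (Ident C x) = Ident D x"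
  unfolding loc_mor_def Ident_D by (intro wrd_loc_rel loc_rel.ident)

lemma loc_mor_Comp:
  assumes "x \<in> Obj C" "y \<in> Obj C" "z \<in> Obj C" "f \<in> Hom C x y" "g \<in> Hom C y z"
  shows "loc_mor C \<Sigma> x z (Comp C x y z g f) = Comp D x y z (loc_mor C \<Sigma> y z g) (loc_mor C \<Sigma> x y f)"
  unfolding loc_mor_def using assms
  by (simp add: wrd_append Cons_in_K Nil_in_K wrd_loc_rel[OF loc_rel.comp])

lemma loc_inverse:
  assumes "x \<in> Obj C" "y \<in> Obj C" "\<sigma> \<in> \<Sigma> x y"
  shows "inverse_mors D x y (loc_mor C \<Sigma> x y \<sigma>) (loc_inv C \<Sigma> x y \<sigma>)"
proof -
  have "[(x, Inl \<sigma>, y)] \<in> Hom K x y" "[(y, Inr \<sigma>, x)] \<in> Hom K y x"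
    using assms by (auto simp: Cons_in_K Nil_in_K \<Sigma>_in)
  then show ?thesis
    unfolding inverse_mors_def loc_mor_def loc_inv_def Ident_D
    using assms by (simp add: wrd_in wrd_append wrd_loc_rel[OF loc_rel.inv_left] wrd_loc_rel[OF loc_rel.inv_right])
qed

text \<open>Each class contains a word, and a word is a composite of images of morphisms and of
  inverses. A property stable under composition thus holds everywhere once it holds for these;
  fullness is proved in this way.\<close>

lemma localization_induct:
  assumes "f \<in> Hom D x y" "x \<in> Obj C" "y \<in> Obj C"
    and Ident: "\<And>x. x \<in> Obj C \<Longrightarrow> T x x (Ident D x)"
    and mor: "\<And>x y f. \<lbrakk>x \<in> Obj C; y \<in> Obj C; f \<in> Hom C x y\<rbrakk> \<Longrightarrow> T x y (loc_mor C \<Sigma> x y f)"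
    and inv: "\<And>x y \<sigma>. \<lbrakk>x \<in> Obj C; y \<in> Obj C; \<sigma> \<in> \<Sigma> x y\<rbrakk> \<Longrightarrow> T y x (loc_inv C \<Sigma> x y \<sigma>)"
    and Comp: "\<And>x y z f g. \<lbrakk>x \<in> Obj C; y \<in> Obj C; z \<in> Obj C; f \<in> Hom D x y; g \<in> Hom D y z; T x y f; T y z g\<rbrakk>
      \<Longrightarrow> T x z (Comp D x y z g f)"
  shows "T x y f"
proof -
  have "T x y (wrd x y p)" if "p \<in> Hom K x y" for p
    using that
  proof (induction p arbitrary: x)
    case Nil
    then show ?case using Ident by (auto simp: Nil_in_K Ident_D)
  next
    case (Cons e p)
    obtain a g b where e: "e = (a, g, b)" by (cases e)
    with Cons.prems have g: "x = a" "a \<in> Obj C" "b \<in> Obj C" "g \<in> Inl ` Hom C a b \<union> Inr ` \<Sigma> b a"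
      and p: "p \<in> Hom K b y" by (auto simp: Cons_in_K)
    then have single: "[e] \<in> Hom K a b" by (simp add: e Cons_in_K Nil_in_K)
    from g(4) have "T a b (wrd a b [e])"
      by (cases rule: zigzag_cases) (use g mor[of a b] inv[of b a] in \<open>auto simp: e loc_mor_def loc_inv_def\<close>)
    then have "T a y (Comp D a b y (wrd b y p) (wrd a b [e]))"
      using single p g Hom_K_ends[OF p] Cons.IH[OF p] by (intro Comp wrd_in) auto
    then show ?case using wrd_append[OF single p] g by simp
  qed
  with assms(1) show ?thesis unfolding D_eq by (elim Loc.Hom_Q_cases) simp
qed

end

section \<open>Localization of linear categories\<close>

locale lin_localizing = lin_category A + Walks: localizing A \<Sigma>
  for A :: "('o, 'm, 'k::{comm_ring,comm_monoid_mult}) lincat" and \<Sigma>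
begin

abbreviation "K \<equiv> Walks.K"

abbreviation lin_K :: "('o, ('o, 'm) zigzag \<Rightarrow>\<^sub>0 'k, 'k) lincat" where
  "lin_K \<equiv> linearization K"

lemma lin_category_lin_K: "lin_category lin_K"
  by (rule category.lin_category_linearization[OF Walks.category_K])

interpretation Loc: quotient_lin_category lin_K "lin_loc_ideal A \<Sigma>"
  unfolding lin_loc_ideal_def
  by (intro quotient_lin_category.intro quotient_lin_category_axioms.intro lin_ideal_generated_ideal
      lin_category_lin_K)

abbreviation D :: "('o, (('o, 'm) zigzag \<Rightarrow>\<^sub>0 'k) set, 'k) lincat" where
  "D \<equiv> lin_localization A \<Sigma>"

lemma D_eq: "D = Loc.L"
  by (simp add: lin_localization_def)

sublocale D: lin_category D
  unfolding D_eq by (rule Loc.lin_category_L)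

lemma Obj_D [simp]: "Obj D = Obj A"
  by (simp add: D_eq)

lemma lin_loc_class_eq: "lin_loc_class A \<Sigma> x y p = Loc.cls x y (Poly_Mapping.single p 1)"
  by (simp add: lin_loc_class_def)

lemma lin_loc_class_in: "p \<in> Hom K x y \<Longrightarrow> lin_loc_class A \<Sigma> x y p \<in> Hom D x y"
  unfolding D_eq lin_loc_class_eq using Walks.Hom_K_ends[of p x y] by (simp add: Loc.cls_in)

lemma lin_loc_class_append:
  assumes "p \<in> Hom K x y" "q \<in> Hom K y z"
  shows "Comp D x y z (lin_loc_class A \<Sigma> y z q) (lin_loc_class A \<Sigma> x y p) = lin_loc_class A \<Sigma> x z (p @ q)"
  unfolding D_eq lin_loc_class_eq using assms Walks.Hom_K_ends[OF assms(1)] Walks.Hom_K_ends[OF assms(2)]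
  by (simp add: Loc.Comp_Q lin_Comp_single)

lemma Ident_D: "Ident D x = lin_loc_class A \<Sigma> x x []"
  unfolding D_eq lin_loc_class_eq by (simp add: Loc.Ident_Q)

text \<open>The generators of the ideal are differences of the two sides of a relation; each becomes
  an equation between classes.\<close>

lemma cls_eqI:
  assumes "x \<in> Obj A" "y \<in> Obj A" "f \<in> Hom lin_K x y" "g \<in> Hom lin_K x y"
    and "f - g \<in> lin_loc_rel A \<Sigma> x y"
  shows "Loc.cls x y f = Loc.cls x y g"
proof -
  have "Poly_Mapping.keys (f - g) \<subseteq> Hom K x y"
    using assms(3,4) Poly_Mapping.keys_diff[of f g] by auto
  then have "f - g \<in> lin_loc_ideal A \<Sigma> x y"
    unfolding lin_loc_ideal_def using assms(1,2,5) by (intro generated_ideal_generator) auto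
  then have "(g, f) \<in> Loc.E x y"
    using assms(3,4) by (auto simp: Loc.E_iff intro!: bexI[of _ "f - g"])
  then show ?thesis using assms(1-4) Loc.cls_eq_iff[of x y g f] by simp
qed

lemma lin_loc_class_loc_rel:
  assumes "loc_rel A \<Sigma> x y p q"
  shows "lin_loc_class A \<Sigma> x y p = lin_loc_class A \<Sigma> x y q"
  unfolding lin_loc_class_eq
  by (rule cls_eqI) (use Walks.loc_rel_in_K[OF assms] lin_loc_rel.loc[OF assms] in auto)

lemma single_in_K: "\<lbrakk>x \<in> Obj A; y \<in> Obj A; f \<in> Hom A x y\<rbrakk> \<Longrightarrow> [(x, Inl f, y)] \<in> Hom K x y"
  by (simp add: Walks.Cons_in_K Walks.Nil_in_K)

lemma lin_loc_mor_in: "\<lbrakk>x \<in> Obj A; y \<in> Obj A; f \<in> Hom A x y\<rbrakk> \<Longrightarrow> lin_loc_mor A \<Sigma> x y f \<in> Hom D x y"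
  unfolding lin_loc_mor_def by (intro lin_loc_class_in single_in_K)

lemma lin_loc_mor_Ident: "x \<in> Obj A \<Longrightarrow> lin_loc_mor A \<Sigma> x x (Ident A x) = Ident D x"
  unfolding lin_loc_mor_def Ident_D by (intro lin_loc_class_loc_rel loc_rel.ident)

lemma lin_loc_mor_Comp:
  assumes "x \<in> Obj A" "y \<in> Obj A" "z \<in> Obj A" "f \<in> Hom A x y" "g \<in> Hom A y z"
  shows "lin_loc_mor A \<Sigma> x z (Comp A x y z g f)
    = Comp D x y z (lin_loc_mor A \<Sigma> y z g) (lin_loc_mor A \<Sigma> x y f)"
  unfolding lin_loc_mor_def using assms
  by (simp add: lin_loc_class_append single_in_K lin_loc_class_loc_rel[OF loc_rel.comp])

lemma lin_loc_inverse:
  assumes "x \<in> Obj A" "y \<in> Obj A" "\<sigma> \<in> \<Sigma> x y"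
  shows "inverse_mors D x y (lin_loc_mor A \<Sigma> x y \<sigma>) (lin_loc_inv A \<Sigma> x y \<sigma>)"
proof -
  have "[(x, Inl \<sigma>, y)] \<in> Hom K x y" "[(y, Inr \<sigma>, x)] \<in> Hom K y x"
    using assms by (auto simp: Walks.Cons_in_K Walks.Nil_in_K Walks.\<Sigma>_in)
  then show ?thesis
    unfolding inverse_mors_def lin_loc_mor_def lin_loc_inv_def Ident_D
    using assms by (simp add: lin_loc_class_in lin_loc_class_append
      lin_loc_class_loc_rel[OF loc_rel.inv_left] lin_loc_class_loc_rel[OF loc_rel.inv_right])
qed

lemma lin_loc_mor_add:
  assumes o: "x \<in> Obj A" "y \<in> Obj A" and fg: "f \<in> Hom A x y" "g \<in> Hom A x y"
  shows "lin_loc_mor A \<Sigma> x y (HAdd A x y f g)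
    = HAdd D x y (lin_loc_mor A \<Sigma> x y f) (lin_loc_mor A \<Sigma> x y g)"
proof -
  let ?s = "\<lambda>h. Poly_Mapping.single [(x, Inl h, y)] 1 :: ('o, 'm) zigzag \<Rightarrow>\<^sub>0 'k"
  have s: "?s h \<in> Hom lin_K x y" if "h \<in> Hom A x y" for h
    using that o by (simp add: single_in_K)
  have "Loc.cls x y (?s (HAdd A x y f g)) = Loc.cls x y (?s f + ?s g)"
  proof (rule cls_eqI[OF o])
    show "?s (HAdd A x y f g) - (?s f + ?s g) \<in> lin_loc_rel A \<Sigma> x y"
      using lin_loc_rel.add[OF fg, of \<Sigma>] by (simp add: diff_diff_eq)
    show "?s f + ?s g \<in> Hom lin_K x y"
      using s[OF fg(1)] s[OF fg(2)] by (simp add: keys_add_subset del: keys_single)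
  qed (use s o fg HAdd_in in blast)
  then show ?thesis
    unfolding lin_loc_mor_def lin_loc_class_eq D_eq
    using Loc.HAdd_L[of x y "?s f" "?s g"] s[OF fg(1)] s[OF fg(2)] o by simp
qed

lemma lin_loc_mor_scale:
  assumes o: "x \<in> Obj A" "y \<in> Obj A" and f: "f \<in> Hom A x y"
  shows "lin_loc_mor A \<Sigma> x y (HScale A x y c f) = HScale D x y c (lin_loc_mor A \<Sigma> x y f)"
proof -
  let ?s = "\<lambda>h c. Poly_Mapping.single [(x, Inl h, y)] c :: ('o, 'm) zigzag \<Rightarrow>\<^sub>0 'k"
  have s: "?s h c \<in> Hom lin_K x y" if "h \<in> Hom A x y" for h c
    using that o by (simp add: single_in_K)
  have "Loc.cls x y (?s (HScale A x y c f) 1) = Loc.cls x y (?s f c)"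
    by (rule cls_eqI[OF o s s]) (use o f HScale_in lin_loc_rel.scale[OF f, of c \<Sigma>] in auto)
  also have "\<dots> = HScale D x y c (Loc.cls x y (?s f 1))"
    unfolding D_eq using Loc.HScale_L[of x y "?s f 1" c] s[OF f] o by simp
  finally show ?thesis unfolding lin_loc_mor_def lin_loc_class_eq .
qed

lemma lin_loc_mor_zero:
  assumes "x \<in> Obj A" "y \<in> Obj A"
  shows "lin_loc_mor A \<Sigma> x y (HZero A x y) = HZero D x y"
  using lin_loc_mor_scale[OF assms HZero_in[OF assms], of 0] assms
  by (simp add: HScale_HZero HZero_in D.HScale_zero_left lin_loc_mor_in)

text \<open>Morphisms are now classes of linear combinations of words, so stability under sums and
  scalars is asked for as well. Identities fall under \<open>mor\<close>, being images of
  identities.\<close>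

lemma lin_localization_induct:
  assumes "f \<in> Hom D x y" "x \<in> Obj A" "y \<in> Obj A"
    and mor: "\<And>x y f. \<lbrakk>x \<in> Obj A; y \<in> Obj A; f \<in> Hom A x y\<rbrakk> \<Longrightarrow> T x y (lin_loc_mor A \<Sigma> x y f)"
    and inv: "\<And>x y \<sigma>. \<lbrakk>x \<in> Obj A; y \<in> Obj A; \<sigma> \<in> \<Sigma> x y\<rbrakk> \<Longrightarrow> T y x (lin_loc_inv A \<Sigma> x y \<sigma>)"
    and Comp: "\<And>x y z f g. \<lbrakk>x \<in> Obj A; y \<in> Obj A; z \<in> Obj A; f \<in> Hom D x y; g \<in> Hom D y z; T x y f; T y z g\<rbrakk>
      \<Longrightarrow> T x z (Comp D x y z g f)"
    and add: "\<And>x y f g. \<lbrakk>x \<in> Obj A; y \<in> Obj A; f \<in> Hom D x y; g \<in> Hom D x y; T x y f; T x y g\<rbrakk>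
      \<Longrightarrow> T x y (HAdd D x y f g)"
    and scale: "\<And>x y f c. \<lbrakk>x \<in> Obj A; y \<in> Obj A; f \<in> Hom D x y; T x y f\<rbrakk> \<Longrightarrow> T x y (HScale D x y c f)"
  shows "T x y f"
proof -
  have word: "T x y (lin_loc_class A \<Sigma> x y p)" if "p \<in> Hom K x y" for p x y
    using that
  proof (induction p arbitrary: x)
    case Nil
    then show ?case using mor[OF _ _ Ident_in, of x] by (auto simp: Walks.Nil_in_K Ident_D lin_loc_mor_Ident)
  next
    case (Cons e p)
    obtain a g b where e: "e = (a, g, b)" by (cases e)
    with Cons.prems have g: "x = a" "a \<in> Obj A" "b \<in> Obj A" "g \<in> Inl ` Hom A a b \<union> Inr ` \<Sigma> b a"
      and p: "p \<in> Hom K b y" by (auto simp: Walks.Cons_in_K)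
    then have single: "[e] \<in> Hom K a b" by (simp add: e Walks.Cons_in_K Walks.Nil_in_K)
    from g(4) have "T a b (lin_loc_class A \<Sigma> a b [e])"
      by (cases rule: Walks.zigzag_cases)
        (use g mor[of a b] inv[of b a] in \<open>auto simp: e lin_loc_mor_def lin_loc_inv_def\<close>)
    then have "T a y (Comp D a b y (lin_loc_class A \<Sigma> b y p) (lin_loc_class A \<Sigma> a b [e]))"
      using single p g Walks.Hom_K_ends[OF p] Cons.IH[OF p] by (intro Comp lin_loc_class_in) auto
    then show ?case using lin_loc_class_append[OF single p] g by simp
  qed
  note o = assms(2,3)
  have "Loc.cls x y h \<in> Hom D x y \<and> T x y (Loc.cls x y h)" if "Poly_Mapping.keys h \<subseteq> Hom K x y" for h
    using that
  proof (induction h rule: keys_subset_induct)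
    case zero
    \<comment> \<open>The empty combination is the image of a zero morphism of \<open>A\<close>, so
      \<open>mor\<close> covers it.\<close>
    have "Loc.cls x y 0 = HZero D x y" unfolding D_eq by simp
    then show ?case
      using mor[OF o HZero_in[OF o]] D.HZero_in[of x y] lin_loc_mor_zero[OF o] o by simp
  next
    case (single p c)
    then have "HScale D x y c (lin_loc_class A \<Sigma> x y p) = Loc.cls x y (Poly_Mapping.single p c)"
      unfolding D_eq lin_loc_class_eq
      using Loc.HScale_L[of x y "Poly_Mapping.single p 1" c] o by simp
    with single show ?case
      using scale[OF o, of "lin_loc_class A \<Sigma> x y p" c] D.HScale_in[of x y "lin_loc_class A \<Sigma> x y p" c]
        word[of p x y] lin_loc_class_in[of p x y] o by simp
  next
    case (add h h')
    then have "HAdd D x y (Loc.cls x y h) (Loc.cls x y h') = Loc.cls x y (h + h')"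
      unfolding D_eq using Loc.HAdd_L[of x y h h'] o by simp
    with add show ?case
      using assms(7)[OF o, of "Loc.cls x y h" "Loc.cls x y h'"]
        D.HAdd_in[of x y "Loc.cls x y h" "Loc.cls x y h'"] o by simp
  qed
  with assms(1) show ?thesis unfolding D_eq Loc.L_simps by (elim Loc.Hom_Q_cases) simp
qed

end

section \<open>Paths and pixels\<close>

text \<open>Intervals are the connected subsets of the line, and continuous maps preserve
  connectedness. All reparametrizations used below are piecewise linear.\<close>

lemma reparametrizationI:
  assumes "continuous_on {0..1} \<phi>" "\<And>s t. \<lbrakk>0 \<le> s; s \<le> t; t \<le> 1\<rbrakk> \<Longrightarrow> \<phi> s \<le> \<phi> t"
    and "\<And>s. \<lbrakk>0 \<le> s; s \<le> 1\<rbrakk> \<Longrightarrow> 0 \<le> \<phi> s \<and> \<phi> s \<le> 1"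
  shows "reparametrization \<phi>"
  unfolding reparametrization_def
proof (intro conjI allI impI)
  fix J :: "real set" assume J: "J \<subseteq> {0..1}" "is_interval J"
  then have "connected (\<phi> ` J)"
    using continuous_on_subset[OF assms(1)] by (intro connected_continuous_image) (auto simp: is_interval_connected_1)
  then show "is_interval (\<phi> ` J)" by (simp add: is_interval_connected_1)
qed (use assms in \<open>auto simp: mono_on_def\<close>)

definition subpath :: "real \<Rightarrow> real \<Rightarrow> 'x pth \<Rightarrow> 'x pth" where
  "subpath a b \<gamma> = compose {0..1} \<gamma> (\<lambda>s. a + (b - a) * s)"

lemma affine_bounds:
  fixes a b s :: real
  assumes "0 \<le> a" "a \<le> b" "b \<le> 1" "0 \<le> s" "s \<le> 1"
  shows "a \<le> a + (b - a) * s" "a + (b - a) * s \<le> b"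
  using assms mult_left_le[of s "b - a"] by auto

lemma reparametrization_affine:
  assumes "0 \<le> a" "a \<le> b" "b \<le> 1"
  shows "reparametrization (\<lambda>s. a + (b - a) * s)"
proof (rule reparametrizationI)
  fix s :: real assume "0 \<le> s" "s \<le> 1"
  with affine_bounds[OF assms this] assms show "0 \<le> a + (b - a) * s \<and> a + (b - a) * s \<le> 1" by auto
qed (use assms in \<open>auto intro!: continuous_intros mult_left_mono\<close>)

lemma subpath_ends [simp]: "subpath a b \<gamma> 0 = \<gamma> a" "subpath a b \<gamma> 1 = \<gamma> b"
  by (simp_all add: subpath_def compose_def)

lemma concat_path_ends [simp]: "(\<gamma> \<cdot>\<^sub>p \<gamma>') 0 = \<gamma> 0" "(\<gamma> \<cdot>\<^sub>p \<gamma>') 1 = \<gamma>' 1"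
  by (simp_all add: concat_path_def)

lemma const_path_ends [simp]: "const_path x 0 = x" "const_path x 1 = x"
  by (simp_all add: const_path_def)

lemma im_const_path [simp]: "im (const_path x) = {x}"
  by (simp add: im_def const_path_def image_constant_conv)

lemma ends_in_im: "\<gamma> 0 \<in> im \<gamma>" "\<gamma> 1 \<in> im \<gamma>"
  by (auto simp: im_def)

lemma im_concat_path:
  assumes "\<gamma> 1 = \<gamma>' 0"
  shows "im (\<gamma> \<cdot>\<^sub>p \<gamma>') = im \<gamma> \<union> im \<gamma>'"
proof (intro equalityI subsetI)
  fix x assume "x \<in> im (\<gamma> \<cdot>\<^sub>p \<gamma>')"
  then show "x \<in> im \<gamma> \<union> im \<gamma>'" by (auto simp: im_def concat_path_def split: if_splits)
next
  fix x assume "x \<in> im \<gamma> \<union> im \<gamma>'"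
  then consider s where "0 \<le> s" "s \<le> 1" "x = \<gamma> s" | s where "0 \<le> s" "s \<le> 1" "x = \<gamma>' s"
    by (auto simp: im_def)
  then show "x \<in> im (\<gamma> \<cdot>\<^sub>p \<gamma>')"
  proof cases
    case 1
    then show ?thesis by (auto simp: im_def concat_path_def intro!: image_eqI[of _ _ "s / 2"])
  next
    case 2
    \<comment> \<open>At \<open>s = 0\<close> the parameter is 1/2, where the concatenation still
      follows the first path; the matching ends make up for this.\<close>
    then have "x = (\<gamma> \<cdot>\<^sub>p \<gamma>') ((s + 1) / 2)"
      using assms by (cases "s = 0") (auto simp: concat_path_def field_simps)
    with 2 show ?thesis unfolding im_def by (intro image_eqI[of _ _ "(s + 1) / 2"]) auto
  qed
qed

context path_triple
begin

lemma R_in: "(\<gamma>, \<gamma>') \<in> R \<Longrightarrow> \<gamma> \<in> \<Gamma> \<and> \<gamma>' \<in> \<Gamma>"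
  using equiv_R by (auto simp: equiv_def refl_on_def)

lemma R_refl: "\<gamma> \<in> \<Gamma> \<Longrightarrow> (\<gamma>, \<gamma>) \<in> R"
  using equiv_R by (auto simp: equiv_def refl_on_def)

lemma R_sym: "(\<gamma>, \<gamma>') \<in> R \<Longrightarrow> (\<gamma>', \<gamma>) \<in> R"
  using equiv_R by (auto simp: equiv_def sym_def)

lemma R_trans [trans]: "(\<gamma>, \<gamma>') \<in> R \<Longrightarrow> (\<gamma>', \<gamma>'') \<in> R \<Longrightarrow> (\<gamma>, \<gamma>'') \<in> R"
  using equiv_R by (auto simp: equiv_def trans_def)

lemma R_ends: "(\<gamma>, \<gamma>') \<in> R \<Longrightarrow> \<gamma> 0 = \<gamma>' 0 \<and> \<gamma> 1 = \<gamma>' 1"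
  using R_parallel by (auto simp: parallel_def)

lemma point_in: "\<gamma> \<in> \<Gamma> \<Longrightarrow> 0 \<le> t \<Longrightarrow> t \<le> 1 \<Longrightarrow> \<gamma> t \<in> X"
  using paths by (auto simp: PiE_iff subset_iff)

lemma ends_in: "\<gamma> \<in> \<Gamma> \<Longrightarrow> \<gamma> 0 \<in> X" "\<gamma> \<in> \<Gamma> \<Longrightarrow> \<gamma> 1 \<in> X"
  by (simp_all add: point_in)

lemma R_reparamI:
  assumes "\<gamma> \<in> \<Gamma>" "\<gamma>' = compose {0..1} \<gamma> \<phi>" "continuous_on {0..1} \<phi>"
    and "\<And>s t. \<lbrakk>0 \<le> s; s \<le> t; t \<le> 1\<rbrakk> \<Longrightarrow> \<phi> s \<le> \<phi> t" "\<phi> 0 = 0" "\<phi> 1 = 1"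
  shows "(\<gamma>, \<gamma>') \<in> R"
proof -
  have "0 \<le> \<phi> s \<and> \<phi> s \<le> 1" if "0 \<le> s" "s \<le> 1" for s
    using assms(4)[of 0 s] assms(4)[of s 1] assms(5,6) that by simp
  then show ?thesis using assms R_reparam[OF assms(1) reparametrizationI] by auto
qed

text \<open>The constant path in front makes the traveller wait at the start, which is a weakly
  monotone change of parameter as in axiom (e).\<close>

lemma R_const_left:
  assumes "\<gamma> \<in> \<Gamma>"
  shows "(\<gamma>, const_path (\<gamma> 0) \<cdot>\<^sub>p \<gamma>) \<in> R"
proof (rule R_reparamI)
  show "const_path (\<gamma> 0) \<cdot>\<^sub>p \<gamma> = compose {0..1} \<gamma> (\<lambda>s. max 0 (2 * s - 1))"
  proof
    fix s :: real
    show "(const_path (\<gamma> 0) \<cdot>\<^sub>p \<gamma>) s = compose {0..1} \<gamma> (\<lambda>s. max 0 (2 * s - 1)) s"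
    proof (cases "s = 1/2")
      case True
      show ?thesis unfolding True by (simp add: concat_path_def compose_def const_path_def)
    qed (auto simp: concat_path_def compose_def const_path_def max_def)
  qed
qed (use assms in \<open>auto intro!: continuous_intros\<close>)

lemma R_const_right:
  assumes "\<gamma> \<in> \<Gamma>"
  shows "(\<gamma>, \<gamma> \<cdot>\<^sub>p const_path (\<gamma> 1)) \<in> R"
proof (rule R_reparamI)
  show "\<gamma> \<cdot>\<^sub>p const_path (\<gamma> 1) = compose {0..1} \<gamma> (\<lambda>s. min 1 (2 * s))"
  proof
    fix s :: real
    show "(\<gamma> \<cdot>\<^sub>p const_path (\<gamma> 1)) s = compose {0..1} \<gamma> (\<lambda>s. min 1 (2 * s)) s"
    proof (cases "s = 1/2")
      case True
      show ?thesis unfolding True by (simp add: concat_path_def compose_def const_path_def)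
    qed (auto simp: concat_path_def compose_def const_path_def min_def)
  qed
qed (use assms in \<open>auto intro!: continuous_intros\<close>)

lemma R_assoc:
  assumes "\<gamma> \<in> \<Gamma>" "\<gamma>' \<in> \<Gamma>" "\<gamma>'' \<in> \<Gamma>" "\<gamma> 1 = \<gamma>' 0" "\<gamma>' 1 = \<gamma>'' 0"
  shows "(\<gamma> \<cdot>\<^sub>p (\<gamma>' \<cdot>\<^sub>p \<gamma>''), \<gamma> \<cdot>\<^sub>p \<gamma>' \<cdot>\<^sub>p \<gamma>'') \<in> R"
\<comment> \<open>The breakpoints 1/4 and 1/2 of the right-hand path must go to the breakpoints 1/2
  and 3/4 of the left-hand one. The piecewise linear map that does this has slopes 2, 1 and 1/2;
  being concave, it is the minimum of its three lines.\<close>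
proof (rule R_reparamI)
  show "\<gamma> \<cdot>\<^sub>p (\<gamma>' \<cdot>\<^sub>p \<gamma>'') \<in> \<Gamma>" using assms by (intro concat_in) auto
  show "\<gamma> \<cdot>\<^sub>p \<gamma>' \<cdot>\<^sub>p \<gamma>''
      = compose {0..1} (\<gamma> \<cdot>\<^sub>p (\<gamma>' \<cdot>\<^sub>p \<gamma>'')) (\<lambda>s. min (2 * s) (min (s + 1/4) ((s + 1) / 2)))"
  proof
    fix s :: real
    consider "s < 0 \<or> s > 1" | "0 \<le> s" "s \<le> 1/4" | "1/4 < s" "s \<le> 1/2" | "1/2 < s" "s \<le> 1" by linarith
    then show "(\<gamma> \<cdot>\<^sub>p \<gamma>' \<cdot>\<^sub>p \<gamma>'') s
        = compose {0..1} (\<gamma> \<cdot>\<^sub>p (\<gamma>' \<cdot>\<^sub>p \<gamma>'')) (\<lambda>s. min (2 * s) (min (s + 1/4) ((s + 1) / 2))) s"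
    proof cases
      case 1
      then show ?thesis by (auto simp: concat_path_def compose_def)
    next
      case 2
      then have "min (2 * s) (min (s + 1/4) ((s + 1) / 2)) = 2 * s" by (simp add: min_def field_simps)
      with 2 show ?thesis by (simp add: concat_path_def compose_def)
    next
      case 3
      then have "min (2 * s) (min (s + 1/4) ((s + 1) / 2)) = s + 1/4" by (simp add: min_def field_simps)
      with 3 show ?thesis by (simp add: concat_path_def compose_def algebra_simps)
    next
      case 4
      then have "min (2 * s) (min (s + 1/4) ((s + 1) / 2)) = (s + 1) / 2" by (simp add: min_def field_simps)
      with 4 show ?thesis by (simp add: concat_path_def compose_def field_simps)
    qed
  qed
  show "min (2 * s) (min (s + 1/4) ((s + 1) / 2)) \<le> min (2 * t) (min (t + 1/4) ((t + 1) / 2))"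
    if "s \<le> t" for s t :: real
    using that by (intro min.mono) auto
qed (auto intro!: continuous_intros)

text \<open>Axiom (f) speaks of factors on both sides; a constant path serves as the missing one and
  is removed afterwards.\<close>

lemma R_concat_right:
  assumes "(\<gamma>, \<gamma>') \<in> R" "\<rho> \<in> \<Gamma>" "\<rho> 1 = \<gamma> 0"
  shows "(\<rho> \<cdot>\<^sub>p \<gamma>, \<rho> \<cdot>\<^sub>p \<gamma>') \<in> R"
proof -
  note g = R_in[OF assms(1)] R_ends[OF assms(1)]
  let ?c = "const_path (\<gamma> 1)"
  have c: "?c \<in> \<Gamma>" using g by (intro const_in ends_in) blast
  have 1: "(\<rho> \<cdot>\<^sub>p \<gamma> \<cdot>\<^sub>p ?c, \<rho> \<cdot>\<^sub>p \<gamma>' \<cdot>\<^sub>p ?c) \<in> R"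
    using g c assms(2,3) by (intro R_cancel[THEN iffD1, OF _ _ _ _ _ _ _ _ assms(1)]) simp_all
  have 2: "(\<rho> \<cdot>\<^sub>p \<gamma>, \<rho> \<cdot>\<^sub>p \<gamma> \<cdot>\<^sub>p ?c) \<in> R" and 3: "(\<rho> \<cdot>\<^sub>p \<gamma>', \<rho> \<cdot>\<^sub>p \<gamma>' \<cdot>\<^sub>p ?c) \<in> R"
    using R_const_right[OF concat_in, of \<rho> \<gamma>] R_const_right[OF concat_in, of \<rho> \<gamma>'] assms(2,3) g by simp_all
  show ?thesis by (rule R_trans[OF 2 R_trans[OF 1 R_sym[OF 3]]])
qed

text \<open>As before, but the constant factor now stands in front of a composite, so reassociation
  is needed in addition.\<close>

lemma R_concat_left:
  assumes "(\<gamma>, \<gamma>') \<in> R" "\<rho> \<in> \<Gamma>" "\<gamma> 1 = \<rho> 0"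
  shows "(\<gamma> \<cdot>\<^sub>p \<rho>, \<gamma>' \<cdot>\<^sub>p \<rho>) \<in> R"
proof -
  note g = R_in[OF assms(1)] R_ends[OF assms(1)]
  let ?c = "const_path (\<gamma> 0)"
  have c: "?c \<in> \<Gamma>" using g by (intro const_in ends_in) blast
  have 1: "(?c \<cdot>\<^sub>p \<gamma> \<cdot>\<^sub>p \<rho>, ?c \<cdot>\<^sub>p \<gamma>' \<cdot>\<^sub>p \<rho>) \<in> R"
    using g c assms(2,3) by (intro R_cancel[THEN iffD1, OF _ _ _ _ _ _ _ _ assms(1)]) simp_all
  have 2: "(\<delta> \<cdot>\<^sub>p \<rho>, ?c \<cdot>\<^sub>p \<delta> \<cdot>\<^sub>p \<rho>) \<in> R" if "\<delta> \<in> \<Gamma>" "\<delta> 0 = \<gamma> 0" "\<delta> 1 = \<rho> 0" for \<delta>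
  proof -
    have "(\<delta> \<cdot>\<^sub>p \<rho>, ?c \<cdot>\<^sub>p (\<delta> \<cdot>\<^sub>p \<rho>)) \<in> R"
      using R_const_left[OF concat_in, of \<delta> \<rho>] that assms(2) by simp
    also have "(?c \<cdot>\<^sub>p (\<delta> \<cdot>\<^sub>p \<rho>), ?c \<cdot>\<^sub>p \<delta> \<cdot>\<^sub>p \<rho>) \<in> R"
      using that assms(2) c by (intro R_assoc) auto
    finally show ?thesis .
  qed
  show ?thesis
    by (rule R_trans[OF 2 R_trans[OF 1 R_sym[OF 2]]]) (use assms g in auto)
qed

lemma R_concat:
  assumes "(\<gamma>, \<gamma>') \<in> R" "(\<delta>, \<delta>') \<in> R" "\<gamma> 1 = \<delta> 0"
  shows "(\<gamma> \<cdot>\<^sub>p \<delta>, \<gamma>' \<cdot>\<^sub>p \<delta>') \<in> R"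
  by (rule R_trans[OF R_concat_left R_concat_right])
    (use assms R_in[OF assms(1)] R_in[OF assms(2)] R_ends[OF assms(1)] in auto)

lemma subpath_in: "\<lbrakk>\<gamma> \<in> \<Gamma>; 0 \<le> a; a \<le> b; b \<le> 1\<rbrakk> \<Longrightarrow> subpath a b \<gamma> \<in> \<Gamma>"
  unfolding subpath_def by (intro reparam_in reparametrization_affine)

lemma subpath_whole: "\<gamma> \<in> \<Gamma> \<Longrightarrow> subpath 0 1 \<gamma> = \<gamma>"
  using paths by (auto simp: subpath_def compose_def fun_eq_iff PiE_def extensional_def)

lemma R_subpath_split:
  assumes "\<gamma> \<in> \<Gamma>" "0 \<le> b" "b \<le> c" "c \<le> 1"
  shows "(subpath 0 c \<gamma>, subpath 0 b \<gamma> \<cdot>\<^sub>p subpath b c \<gamma>) \<in> R"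
proof (rule R_reparamI)
  show "subpath 0 c \<gamma> \<in> \<Gamma>" using assms by (intro subpath_in) auto
  \<comment> \<open>\<open>r\<close> is the share of \<open>[0, c]\<close> that belongs to the first
    piece, so \<open>?\<phi>\<close> runs through \<open>[0, r]\<close> and then
    \<open>[r, 1]\<close>. For \<open>c = 0\<close> the division gives 0, and
    \<open>c * r = b\<close> still holds because \<open>b\<close> is 0 as well.\<close>
  define r where "r = b / c"
  let ?\<phi> = "\<lambda>s. r * min 1 (2 * s) + (1 - r) * max 0 (2 * s - 1)"
  have cb: "c * (r) = b" using assms by (cases "c = 0") (auto simp: r_def)
  then have \<phi>: "c * ?\<phi> s = b * min 1 (2 * s) + (c - b) * max 0 (2 * s - 1)" for s
    by (metis (no_types, opaque_lifting) distrib_left mult.assoc mult.right_neutral right_diff_distrib)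
  have r: "0 \<le> r" "r \<le> 1" using assms by (auto simp: r_def divide_le_eq_1)
  have "?\<phi> s \<le> ?\<phi> t" if "0 \<le> s" "s \<le> t" "t \<le> 1" for s t
    using that r by (intro add_mono mult_left_mono) auto
  note mono = this
  show "?\<phi> s \<le> ?\<phi> t" if "0 \<le> s" "s \<le> t" "t \<le> 1" for s t using mono[OF that] .
  have bounds: "0 \<le> ?\<phi> s \<and> ?\<phi> s \<le> 1" if "0 \<le> s" "s \<le> 1" for s
    using mono[of 0 s] mono[of s 1] that by auto
  show "subpath 0 b \<gamma> \<cdot>\<^sub>p subpath b c \<gamma> = compose {0..1} (subpath 0 c \<gamma>) ?\<phi>"
  proof
    fix s
    show "(subpath 0 b \<gamma> \<cdot>\<^sub>p subpath b c \<gamma>) s = compose {0..1} (subpath 0 c \<gamma>) ?\<phi> s"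
    proof (cases "0 \<le> s \<and> s \<le> 1")
      case True
      then have "compose {0..1} (subpath 0 c \<gamma>) ?\<phi> s = \<gamma> (b * min 1 (2 * s) + (c - b) * max 0 (2 * s - 1))"
        using bounds[of s] \<phi>[of s] by (simp add: compose_def subpath_def)
      moreover have "(subpath 0 b \<gamma> \<cdot>\<^sub>p subpath b c \<gamma>) s
          = \<gamma> (b * min 1 (2 * s) + (c - b) * max 0 (2 * s - 1))"
        using True by (cases "s \<le> 1/2") (simp_all add: concat_path_def subpath_def compose_def)
      ultimately show ?thesis by simp
    qed (auto simp: concat_path_def compose_def)
  qed
  show "continuous_on {0..1} ?\<phi>" by (intro continuous_intros)
qed auto

section \<open>The path category\<close>

abbreviation "C \<equiv> path_cat X \<Gamma> R"

lemma Obj_C [simp]: "Obj C = X"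
  by (simp add: path_cat_def)

lemma cls_in_C: "\<gamma> \<in> \<Gamma> \<Longrightarrow> R `` {\<gamma>} \<in> Hom C (\<gamma> 0) (\<gamma> 1)"
  by (auto simp: path_cat_def)

lemma Hom_C_cases:
  assumes "F \<in> Hom C x y"
  obtains \<gamma> where "\<gamma> \<in> \<Gamma>" "\<gamma> 0 = x" "\<gamma> 1 = y" "F = R `` {\<gamma>}"
  using assms by (auto simp: path_cat_def)

lemma cls_eq_iff: "\<gamma> \<in> \<Gamma> \<Longrightarrow> \<gamma>' \<in> \<Gamma> \<Longrightarrow> R `` {\<gamma>} = R `` {\<gamma>'} \<longleftrightarrow> (\<gamma>, \<gamma>') \<in> R"
  using eq_equiv_class_iff[OF equiv_R] by blast

lemma cls_eq: "(\<gamma>, \<gamma>') \<in> R \<Longrightarrow> R `` {\<gamma>} = R `` {\<gamma>'}"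
  using equiv_class_eq[OF equiv_R] .

lemma R_rep: "\<gamma> \<in> \<Gamma> \<Longrightarrow> (\<gamma>, rep (R `` {\<gamma>})) \<in> R"
  using rep_in[OF equiv_class_self[OF equiv_R]] by blast

lemma Comp_C:
  assumes "\<gamma> \<in> \<Gamma>" "\<delta> \<in> \<Gamma>" "\<gamma> 1 = \<delta> 0"
  shows "Comp C x y z (R `` {\<delta>}) (R `` {\<gamma>}) = R `` {\<gamma> \<cdot>\<^sub>p \<delta>}"
  using cls_eq[OF R_concat[OF R_rep[OF assms(1)] R_rep[OF assms(2)] assms(3)]] by (simp add: path_cat_def)

lemma Ident_C: "Ident C x = R `` {const_path x}"
  by (simp add: path_cat_def)

lemma category_C: "category C"
proof
  fix x assume "x \<in> Obj C"
  then show "Ident C x \<in> Hom C x x" using cls_in_C[of "const_path x"] const_in[of x] by (simp add: Ident_C)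
next
  fix x y z F G assume "F \<in> Hom C x y" "G \<in> Hom C y z"
  then show "Comp C x y z G F \<in> Hom C x z"
    using cls_in_C[OF concat_in] by (elim Hom_C_cases) (auto simp: Comp_C)
next
  fix x y F assume "x \<in> Obj C" "y \<in> Obj C" "F \<in> Hom C x y"
  then obtain \<gamma> where \<gamma>: "\<gamma> \<in> \<Gamma>" "\<gamma> 0 = x" "\<gamma> 1 = y" "F = R `` {\<gamma>}" and o: "x \<in> X" "y \<in> X"
    by (auto elim: Hom_C_cases)
  show "Comp C x x y F (Ident C x) = F"
    unfolding Ident_C \<gamma>(4) using \<gamma> o cls_eq[OF R_const_left[OF \<gamma>(1)]] by (subst Comp_C) (auto intro: const_in)
  show "Comp C x y y (Ident C y) F = F"
    unfolding Ident_C \<gamma>(4) using \<gamma> o cls_eq[OF R_const_right[OF \<gamma>(1)]] by (subst Comp_C) (auto intro: const_in)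
next
  fix w x y z F G H assume "F \<in> Hom C w x" "G \<in> Hom C x y" "H \<in> Hom C y z"
  then obtain \<gamma> \<delta> \<epsilon> where "\<gamma> \<in> \<Gamma>" "\<delta> \<in> \<Gamma>" "\<epsilon> \<in> \<Gamma>" "\<gamma> 1 = \<delta> 0" "\<delta> 1 = \<epsilon> 0"
    "F = R `` {\<gamma>}" "G = R `` {\<delta>}" "H = R `` {\<epsilon>}"
    by (elim Hom_C_cases) auto
  then show "Comp C w y z H (Comp C w x y G F) = Comp C w x z (Comp C x y z H G) F"
    using cls_eq[OF R_assoc[of \<gamma> \<delta> \<epsilon>]] by (simp add: Comp_C concat_in)
qed

end

text \<open>A form of a two-piece partition as in (S4) that names no cut point, which could belong
  to either piece: the last clause says that the times spent in \<open>A\<close> form an initial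
  segment. This is easily preserved when the path is prolonged.\<close>

definition crossing :: "'x set \<Rightarrow> 'x set \<Rightarrow> 'x pth \<Rightarrow> bool" where
  "crossing A B \<gamma> \<longleftrightarrow> \<gamma> 0 \<in> A \<and> \<gamma> 1 \<in> B \<and> im \<gamma> \<subseteq> A \<union> B \<and>
     (\<forall>s t. 0 \<le> s \<longrightarrow> s \<le> t \<longrightarrow> t \<le> 1 \<longrightarrow> \<gamma> t \<in> A \<longrightarrow> \<gamma> s \<in> A)"

text \<open>A prolongation inside the first pixel only lengthens the initial segment of times spent
  there.\<close>

lemma crossing_concat_left:
  assumes "crossing A B \<gamma>" "im \<rho> \<subseteq> A" "A \<inter> B = {}" "\<rho> 1 = \<gamma> 0"
  shows "crossing A B (\<rho> \<cdot>\<^sub>p \<gamma>)"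
proof -
  have *: "(\<rho> \<cdot>\<^sub>p \<gamma>) t = (if t \<le> 1/2 then \<rho> (2 * t) else \<gamma> (2 * t - 1))" if "0 \<le> t" "t \<le> 1" for t
    using that by (simp add: concat_path_def)
  have "(\<rho> \<cdot>\<^sub>p \<gamma>) s \<in> A" if "0 \<le> s" "s \<le> t" "t \<le> 1" "(\<rho> \<cdot>\<^sub>p \<gamma>) t \<in> A" for s t
  proof (cases "s \<le> 1/2")
    case True
    then show ?thesis using assms(2) that by (auto simp: * im_def)
  next
    case False
    then have "\<gamma> (2 * t - 1) \<in> A" using that by (auto simp: * split: if_splits)
    then have "\<gamma> (2 * s - 1) \<in> A"
      using assms(1)[unfolded crossing_def, THEN conjunct2, THEN conjunct2, THEN conjunct2,
          rule_format, of "2 * s - 1" "2 * t - 1"] False that by simp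
    with False that show ?thesis by (simp add: *)
  qed
  moreover have "\<rho> 0 \<in> A" using assms(2) by (auto simp: im_def)
  ultimately show ?thesis
    using assms im_concat_path[of \<rho> \<gamma>] unfolding crossing_def by auto
qed

text \<open>The appended times avoid \<open>A\<close> because the two sets are disjoint.\<close>

lemma crossing_concat_right:
  assumes "crossing A B \<gamma>" "im \<rho> \<subseteq> B" "A \<inter> B = {}" "\<gamma> 1 = \<rho> 0"
  shows "crossing A B (\<gamma> \<cdot>\<^sub>p \<rho>)"
proof -
  have *: "(\<gamma> \<cdot>\<^sub>p \<rho>) t = (if t \<le> 1/2 then \<gamma> (2 * t) else \<rho> (2 * t - 1))" if "0 \<le> t" "t \<le> 1" for t
    using that by (simp add: concat_path_def)
  have "(\<gamma> \<cdot>\<^sub>p \<rho>) s \<in> A" if "0 \<le> s" "s \<le> t" "t \<le> 1" "(\<gamma> \<cdot>\<^sub>p \<rho>) t \<in> A" for s t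
  proof (cases "t \<le> 1/2")
    case True
    then have "\<gamma> (2 * t) \<in> A" using that by (auto simp: *)
    then have "\<gamma> (2 * s) \<in> A"
      using assms(1)[unfolded crossing_def, THEN conjunct2, THEN conjunct2, THEN conjunct2,
          rule_format, of "2 * s" "2 * t"] True that by simp
    with True that show ?thesis by (simp add: *)
  next
    case False
    then have "\<rho> (2 * t - 1) \<in> A" "\<rho> (2 * t - 1) \<in> B" using that assms(2) by (auto simp: * im_def)
    with assms(3) show ?thesis by blast
  qed
  moreover have "\<rho> 1 \<in> B" using assms(2) by (auto simp: im_def)
  ultimately show ?thesis
    using assms im_concat_path[of \<gamma> \<rho>] unfolding crossing_def by auto
qed

text \<open>The two intervals are the preimages of \<open>A\<close> and \<open>B\<close>. The first
  is closed downwards, so its complement is an interval too and lies entirely after it.\<close>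

lemma two_pixel_path_crossing:
  assumes "crossing A B \<gamma>" "A \<in> P" "B \<in> P" "A \<noteq> B" "A \<inter> B = {}"
  shows "two_pixel_path P \<gamma>"
proof -
  define I where "I = {t \<in> {0..1}. \<gamma> t \<in> A}"
  define J where "J = {t \<in> {0..1}. \<gamma> t \<in> B}"
  have I_down: "s \<in> I" if "0 \<le> s" "s \<le> t" "t \<in> I" for s t
    using that assms(1) by (auto simp: crossing_def I_def)
  have IJ: "I \<union> J = {0..1}" "I \<inter> J = {}"
    using assms(1,5) by (auto simp: crossing_def I_def J_def im_def image_subset_iff)
  have I01: "I \<subseteq> {0..1}" by (auto simp: I_def)
  have "is_interval I"
    using I_down I01 unfolding is_interval_1 by (meson atLeastAtMost_iff order_trans subsetD)
  moreover have "is_interval J"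
  proof -
    have "x \<in> J" if "a \<in> J" "b \<in> J" "a \<le> x" "x \<le> b" for a b x
    proof (rule ccontr)
      assume "x \<notin> J"
      moreover have "x \<in> {0..1}" using that by (auto simp: J_def)
      ultimately have "x \<in> I" using IJ(1) by blast
      then have "a \<in> I" using I_down[of a x] IJ that by auto
      then show False using IJ that by auto
    qed
    then show ?thesis unfolding is_interval_1 by blast
  qed
  moreover have "0 \<in> I" "1 \<in> J" using assms(1) by (auto simp: crossing_def I_def J_def)
  moreover have "a < b" if "a \<in> I" "b \<in> J" for a b
    using I_down[of b a] that IJ by (metis IntI atLeastAtMost_iff UnI2 empty_iff not_le)
  ultimately have "pixel_partition P \<gamma> [I, J] [A, B]"
    unfolding pixel_partition_def using IJ assms(2-4)
    by (auto simp: less_Suc_eq nth_Cons' I_def J_def)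
  then show ?thesis unfolding two_pixel_path_def by (intro exI[of _ "[I, J]"] exI[of _ "[A, B]"]) simp
qed

text \<open>By (S1) such a path is determined by its ends up to equivalence, so a pixel behaves like
  a preorder inside the path category.\<close>

definition pixel_arrow :: "'x pth set \<Rightarrow> 'x set \<Rightarrow> 'x \<Rightarrow> 'x \<Rightarrow> 'x pth \<Rightarrow> bool" where
  "pixel_arrow \<Gamma> A x y \<rho> \<longleftrightarrow> \<rho> \<in> \<Gamma> \<and> im \<rho> \<subseteq> A \<and> \<rho> 0 = x \<and> \<rho> 1 = y"

lemma pixel_arrow_in: "pixel_arrow \<Gamma> A x y \<rho> \<Longrightarrow> x \<in> A \<and> y \<in> A"
  using ends_in_im[of \<rho>] by (auto simp: pixel_arrow_def)

section \<open>Roofs inside a pixel and the decomposition of paths\<close>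

context screen
begin

lemma pixel_in_X: "A \<in> P \<Longrightarrow> x \<in> A \<Longrightarrow> x \<in> X"
  using partition by (auto simp: partition_on_def)

lemma pixel_disjoint: "A \<in> P \<Longrightarrow> B \<in> P \<Longrightarrow> A \<noteq> B \<Longrightarrow> A \<inter> B = {}"
  using partition by (auto simp: partition_on_def disjoint_def)

lemma pixel_unique: "A \<in> P \<Longrightarrow> B \<in> P \<Longrightarrow> x \<in> A \<Longrightarrow> x \<in> B \<Longrightarrow> A = B"
  using pixel_disjoint by blast

definition pix :: "'x \<Rightarrow> 'x set" where
  "pix x = (THE A. A \<in> P \<and> x \<in> A)"

lemma pix_eqI: "A \<in> P \<Longrightarrow> x \<in> A \<Longrightarrow> pix x = A"
  unfolding pix_def by (rule the_equality) (simp, metis pixel_unique)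

lemma pix: "x \<in> X \<Longrightarrow> pix x \<in> P \<and> x \<in> pix x"
proof -
  assume "x \<in> X"
  then obtain A where "A \<in> P" "x \<in> A" using partition by (auto simp: partition_on_def)
  then show ?thesis by (simp add: pix_eqI)
qed

lemma pixel_arrow_concat:
  "pixel_arrow \<Gamma> A x y \<rho> \<Longrightarrow> pixel_arrow \<Gamma> A y z \<rho>' \<Longrightarrow> pixel_arrow \<Gamma> A x z (\<rho> \<cdot>\<^sub>p \<rho>')"
  by (auto simp: pixel_arrow_def concat_in im_concat_path)

lemma pixel_arrow_const: "A \<in> P \<Longrightarrow> x \<in> A \<Longrightarrow> pixel_arrow \<Gamma> A x x (const_path x)"
  by (simp add: pixel_arrow_def const_in pixel_in_X)

lemma pixel_arrow_unique:
  "A \<in> P \<Longrightarrow> pixel_arrow \<Gamma> A x y \<rho> \<Longrightarrow> pixel_arrow \<Gamma> A x y \<rho>' \<Longrightarrow> (\<rho>, \<rho>') \<in> R"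
  using S1[of \<rho> \<rho>' A] by (auto simp: pixel_arrow_def parallel_def)

text \<open>(S3) puts only one of the two new paths in a pixel. Its end shows that this pixel is
  \<open>A\<close>; since the other composite is equivalent to a path in \<open>A\<close>, (S1)
  confines it to \<open>A\<close>, and its factors with it.\<close>

lemma cospan_completion:
  assumes "A \<in> P" "pixel_arrow \<Gamma> A x z \<rho>" "pixel_arrow \<Gamma> A y z \<rho>'"
  obtains w \<alpha> \<beta> where "pixel_arrow \<Gamma> A w x \<alpha>" "pixel_arrow \<Gamma> A w y \<beta>"
proof -
  from assms have "in_pixel P \<rho>'" by (auto simp: in_pixel_def pixel_arrow_def)
  then obtain \<alpha> \<beta> where *: "\<alpha> \<in> \<Gamma>" "\<beta> \<in> \<Gamma>" "in_pixel P \<alpha>" "\<beta> 1 = y" "\<alpha> 1 = x" "(\<beta> \<cdot>\<^sub>p \<rho>', \<alpha> \<cdot>\<^sub>p \<rho>) \<in> R"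
    using S3_dual[of \<rho>' \<rho>] assms by (auto simp: pixel_arrow_def)
  have "im \<alpha> \<subseteq> A"
    using *(3,5) pixel_arrow_in[OF assms(2)] ends_in_im(2)[of \<alpha>] pixel_unique[OF assms(1)]
    by (auto simp: in_pixel_def)
  then have \<alpha>: "pixel_arrow \<Gamma> A (\<alpha> 0) x \<alpha>" using * by (simp add: pixel_arrow_def)
  then have "pixel_arrow \<Gamma> A (\<alpha> 0) z (\<alpha> \<cdot>\<^sub>p \<rho>)" using assms(2) by (rule pixel_arrow_concat)
  then have "im (\<beta> \<cdot>\<^sub>p \<rho>') \<subseteq> A"
    using *(6) S1[of "\<alpha> \<cdot>\<^sub>p \<rho>" "\<beta> \<cdot>\<^sub>p \<rho>'" A] R_sym[OF *(6)] R_in[OF *(6)] R_ends[OF *(6)] assms(1)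
    by (auto simp: pixel_arrow_def parallel_def)
  then have "im \<beta> \<subseteq> A" using *(4) assms(3) im_concat_path[of \<beta> \<rho>'] by (auto simp: pixel_arrow_def)
  then have "pixel_arrow \<Gamma> A (\<alpha> 0) y \<beta>"
    using * R_ends[OF *(6)] by (simp add: pixel_arrow_def)
  with \<alpha> that show thesis by blast
qed

text \<open>The mirror argument, with the first half of (S3).\<close>

lemma span_completion:
  assumes "A \<in> P" "pixel_arrow \<Gamma> A z x \<rho>" "pixel_arrow \<Gamma> A z y \<rho>'"
  obtains w \<alpha> \<beta> where "pixel_arrow \<Gamma> A x w \<alpha>" "pixel_arrow \<Gamma> A y w \<beta>"
proof -
  from assms have "in_pixel P \<rho>" by (auto simp: in_pixel_def pixel_arrow_def)
  then obtain \<alpha> \<beta> where *: "\<alpha> \<in> \<Gamma>" "\<beta> \<in> \<Gamma>" "in_pixel P \<beta>" "\<beta> 0 = y" "\<alpha> 0 = x" "(\<rho>' \<cdot>\<^sub>p \<beta>, \<rho> \<cdot>\<^sub>p \<alpha>) \<in> R"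
    using S3[of \<rho> \<rho>'] assms by (auto simp: pixel_arrow_def)
  have "im \<beta> \<subseteq> A"
    using *(3,4) pixel_arrow_in[OF assms(3)] ends_in_im(1)[of \<beta>] pixel_unique[OF assms(1)]
    by (auto simp: in_pixel_def)
  then have \<beta>: "pixel_arrow \<Gamma> A y (\<beta> 1) \<beta>" using * by (simp add: pixel_arrow_def)
  with assms(3) have "pixel_arrow \<Gamma> A z (\<beta> 1) (\<rho>' \<cdot>\<^sub>p \<beta>)" by (rule pixel_arrow_concat)
  then have "im (\<rho> \<cdot>\<^sub>p \<alpha>) \<subseteq> A"
    using *(6) S1[of "\<rho>' \<cdot>\<^sub>p \<beta>" "\<rho> \<cdot>\<^sub>p \<alpha>" A] R_in[OF *(6)] R_ends[OF *(6)] assms(1)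
    by (auto simp: pixel_arrow_def parallel_def)
  then have "im \<alpha> \<subseteq> A" using *(5) assms(2) im_concat_path[of \<rho> \<alpha>] by (auto simp: pixel_arrow_def)
  then have "pixel_arrow \<Gamma> A x (\<beta> 1) \<alpha>"
    using * R_ends[OF *(6)] by (simp add: pixel_arrow_def)
  with \<beta> that show thesis by blast
qed

text \<open>The walks of (S2) can be straightened: backward steps are moved to one end by (S3).\<close>

lemma roof:
  assumes A: "A \<in> P" "x \<in> A" "y \<in> A"
  shows "\<exists>w \<alpha> \<beta>. pixel_arrow \<Gamma> A w x \<alpha> \<and> pixel_arrow \<Gamma> A w y \<beta>"
proof -
  define S where "S u v \<longleftrightarrow> (\<exists>w \<alpha> \<beta>. pixel_arrow \<Gamma> A w u \<alpha> \<and> pixel_arrow \<Gamma> A w v \<beta>)" for u v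
  \<comment> \<open>Two roofs that share the foot \<open>v\<close> form a cospan there; completing
    it gives a roof over both.\<close>
  have S_trans: "S u t" if "S u v" "S v t" for u v t
  proof -
    from that obtain w w' \<alpha> \<beta> \<alpha>' \<beta>' where *: "pixel_arrow \<Gamma> A w u \<alpha>" "pixel_arrow \<Gamma> A w v \<beta>"
      "pixel_arrow \<Gamma> A w' v \<alpha>'" "pixel_arrow \<Gamma> A w' t \<beta>'" unfolding S_def by blast
    obtain z \<delta> \<epsilon> where "pixel_arrow \<Gamma> A z w \<delta>" "pixel_arrow \<Gamma> A z w' \<epsilon>"
      using cospan_completion[OF A(1) *(2,3)] by blast
    with * show ?thesis unfolding S_def using pixel_arrow_concat by blast
  qed
  have S_arrow: "S u v \<and> S v u" if "pixel_arrow \<Gamma> A u v \<rho>" for u v \<rho>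
    unfolding S_def using that pixel_arrow_const[OF A(1)] pixel_arrow_in[OF that] by blast
  obtain n :: nat and \<gamma> where walk: "\<forall>i\<le>2 * n. \<gamma> i \<in> \<Gamma> \<and> im (\<gamma> i) \<subseteq> A"
    "\<gamma> 0 0 = x" "\<gamma> (2 * n) 1 = y"
    "\<forall>i<n. \<gamma> (2 * i) 1 = \<gamma> (2 * i + 1) 1 \<and> \<gamma> (2 * i + 1) 0 = \<gamma> (2 * i + 2) 0"
    using S2[OF A] unfolding pixel_walk_def by blast
  note \<gamma> = walk(1)[rule_format] walk(2,3) walk(4)[rule_format]
  have arr: "pixel_arrow \<Gamma> A (\<gamma> i 0) (\<gamma> i 1) (\<gamma> i)" if "i \<le> 2 * n" for i
    using \<gamma>(1)[OF that] by (simp add: pixel_arrow_def)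
  \<comment> \<open>Each round takes one backward and one forward path of the walk. \<open>S\<close>
    holds in both directions along a path, so the orientation does not matter.\<close>
  have "S x (\<gamma> (2 * i) 1)" if "i \<le> n" for i
    using that
  proof (induction i)
    case 0
    then show ?case using arr[of 0] S_arrow \<gamma>(2) by auto
  next
    case (Suc i)
    then have 1: "S x (\<gamma> (2 * i + 1) 1)" using \<gamma>(4)[of i] by simp
    have 2: "S (\<gamma> (2 * i + 1) 1) (\<gamma> (2 * i + 2) 0)"
      using arr[of "2 * i + 1"] S_arrow \<gamma>(4)[of i] Suc.prems by auto
    have 3: "S (\<gamma> (2 * i + 2) 0) (\<gamma> (2 * i + 2) 1)"
      using arr[of "2 * i + 2"] S_arrow Suc.prems by auto
    show ?case using S_trans[OF S_trans[OF 1 2] 3] by simp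
  qed
  from this[of n] \<gamma>(3) show ?thesis by (auto simp: S_def)
qed

lemma coroof:
  assumes A: "A \<in> P" "x \<in> A" "y \<in> A"
  obtains w \<alpha> \<beta> where "pixel_arrow \<Gamma> A x w \<alpha>" "pixel_arrow \<Gamma> A y w \<beta>"
  using roof[OF A] span_completion[OF A(1)] by blast

text \<open>Finitely many points occur at once in two places: three when canonical isomorphisms are
  composed, and one for each summand when linear combinations are prolonged.\<close>

lemma common_roof:
  assumes A: "A \<in> P" and "finite S" "S \<subseteq> A" "S \<noteq> {}"
  shows "\<exists>w\<in>A. \<forall>x\<in>S. \<exists>\<rho>. pixel_arrow \<Gamma> A w x \<rho>"
  using assms(2,4,3)
proof (induction S rule: finite_ne_induct)
  case (singleton x)
  then show ?case using pixel_arrow_const[OF A, of x] by auto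
next
  case (insert x S)
  then obtain w where w: "w \<in> A" "\<forall>x\<in>S. \<exists>\<rho>. pixel_arrow \<Gamma> A w x \<rho>" by auto
  obtain v \<alpha> \<beta> where "pixel_arrow \<Gamma> A v w \<alpha>" "pixel_arrow \<Gamma> A v x \<beta>"
    using roof[OF A, of w x] insert.prems w by auto
  with w show ?case using pixel_arrow_concat pixel_arrow_in by (metis insert_iff)
qed

lemma common_coroof:
  assumes A: "A \<in> P" and "finite S" "S \<subseteq> A" "S \<noteq> {}"
  shows "\<exists>w\<in>A. \<forall>x\<in>S. \<exists>\<rho>. pixel_arrow \<Gamma> A x w \<rho>"
  using assms(2,4,3)
proof (induction S rule: finite_ne_induct)
  case (singleton x)
  then show ?case using pixel_arrow_const[OF A, of x] by auto
next
  case (insert x S)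
  then obtain w where w: "w \<in> A" "\<forall>x\<in>S. \<exists>\<rho>. pixel_arrow \<Gamma> A x w \<rho>" by auto
  obtain v \<alpha> \<beta> where "pixel_arrow \<Gamma> A w v \<alpha>" "pixel_arrow \<Gamma> A x v \<beta>"
    using coroof[OF A, of w x] insert.prems w by blast
  with w show ?case using pixel_arrow_concat pixel_arrow_in by (metis insert_iff)
qed

text \<open>Cutting along a partition as in (S4) leaves only paths in a pixel and crossings.\<close>

lemma path_induct [consumes 1, case_names equiv pixel crossing concat]:
  assumes \<gamma>: "\<gamma> \<in> \<Gamma>"
    and R: "\<And>\<gamma> \<gamma>'. (\<gamma>, \<gamma>') \<in> R \<Longrightarrow> T \<gamma> \<Longrightarrow> T \<gamma>'"
    and pixel: "\<And>A x y \<rho>. A \<in> P \<Longrightarrow> pixel_arrow \<Gamma> A x y \<rho> \<Longrightarrow> T \<rho>"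
    and cross: "\<And>A B \<gamma>. \<lbrakk>A \<in> P; B \<in> P; A \<noteq> B; \<gamma> \<in> \<Gamma>; crossing A B \<gamma>\<rbrakk> \<Longrightarrow> T \<gamma>"
    and concat: "\<And>\<gamma> \<gamma>'. \<lbrakk>\<gamma> \<in> \<Gamma>; \<gamma>' \<in> \<Gamma>; \<gamma> 1 = \<gamma>' 0; T \<gamma>; T \<gamma>'\<rbrakk> \<Longrightarrow> T (\<gamma> \<cdot>\<^sub>p \<gamma>')"
  shows "T \<gamma>"
proof -
  from S4[OF \<gamma>] obtain Is Xs where part: "pixel_partition P \<gamma> Is Xs" by (elim exE)
  let ?n = "length Is"
  have cover: "\<Union>(set Is) = {0..1}" using part by (simp add: pixel_partition_def)
  have ne: "Is ! i \<noteq> {}" if "i < ?n" for i using part that by (simp add: pixel_partition_def)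
  have ord: "a < b" if "i < j" "j < ?n" "a \<in> Is ! i" "b \<in> Is ! j" for i j a b
    using part that unfolding pixel_partition_def by simp
  have Xs: "Xs ! i \<in> P" if "i < ?n" for i
    using part that nth_mem[of i Xs] unfolding pixel_partition_def by auto
  have sub: "\<gamma> t \<in> Xs ! i" if "i < ?n" "t \<in> Is ! i" for i t
    using part that unfolding pixel_partition_def by blast
  have nbr: "Xs ! i \<noteq> Xs ! Suc i" if "Suc i < ?n" for i
  proof
    assume "Xs ! i = Xs ! Suc i"
    then have "\<bar>int i - int (Suc i)\<bar> > 1"
      using part that unfolding pixel_partition_def by (metis Suc_lessD n_not_Suc_n)
    then show False by simp
  qed
  have unit: "0 \<le> t \<and> t \<le> 1" if "i < ?n" "t \<in> Is ! i" for i t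
    using that cover nth_mem by fastforce
  have find: "\<exists>i<?n. t \<in> Is ! i" if "0 \<le> t" "t \<le> 1" for t
    using that cover by (metis UnionE atLeastAtMost_iff in_set_conv_nth)
  \<comment> \<open>For \<open>i = j\<close> this is convexity of the interval; for neighbours it
    says that no third interval fits between them.\<close>
  have between: "t \<in> Is ! i \<or> t \<in> Is ! j" if ij: "i \<le> j" "j \<le> Suc i" "j < ?n"
    and ab: "a \<in> Is ! i" "b \<in> Is ! j" "a \<le> t" "t \<le> b" for a b t i j
  proof -
    obtain k where k: "k < ?n" "t \<in> Is ! k"
      using find[of t] unit[of i a] unit[of j b] ij ab by auto
    have "\<not> k < i" using ord[of k i t a] k ij ab by auto
    moreover have "\<not> j < k" using ord[of j k b t] k ij ab by auto
    ultimately show ?thesis using k ij by (cases "k = i"; cases "k = j") auto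
  qed
  \<comment> \<open>The induction runs over the index of the interval that contains the end time
    \<open>t\<close>, for all such \<open>t\<close> together.\<close>
  have "T (subpath 0 t \<gamma>)" if "i < ?n" "t \<in> Is ! i" for i t
    using that
  proof (induction i arbitrary: t)
    case 0
    obtain k where k: "k < ?n" "0 \<in> Is ! k" using find[of 0] by auto
    \<comment> \<open>If 0 lay in a later interval, the time \<open>t\<close> of the first interval
      would be negative.\<close>
    then have "0 \<in> Is ! 0" using ord[of 0 k t 0] unit[OF 0] 0 by (cases "k = 0") auto
    have "im (subpath 0 t \<gamma>) \<subseteq> Xs ! 0"
    proof (clarsimp simp: im_def subpath_def compose_def)
      fix s :: real assume "0 \<le> s" "s \<le> 1"
      then have "t * s \<in> Is ! 0"
        using between[of 0 0 0 t "t * s"] \<open>0 \<in> Is ! 0\<close> 0 unit[OF 0] by (auto simp: mult_left_le)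
      then show "\<gamma> (t * s) \<in> Xs ! 0" using sub 0 by blast
    qed
    then show ?case
      using pixel[of "Xs ! 0" "\<gamma> 0" "\<gamma> t" "subpath 0 t \<gamma>"] Xs 0 unit[OF 0] subpath_in[OF \<gamma>, of 0 t]
      by (simp add: pixel_arrow_def)
  next
    case (Suc i)
    \<comment> \<open>Any time \<open>u\<close> of the preceding interval can serve as the cut:
      between \<open>u\<close> and \<open>t\<close> only these two intervals occur, and their pixels
      differ by (S4), so the piece is a crossing.\<close>
    from ne[of i] Suc.prems obtain u where u: "u \<in> Is ! i" by auto
    have ut: "u < t" using ord[of i "Suc i" u t] u Suc.prems by auto
    have bounds: "0 \<le> u" "t \<le> 1" using unit[of i u] unit[of "Suc i" t] u Suc.prems by auto
    let ?\<delta> = "subpath u t \<gamma>"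
    let ?p = "\<lambda>s. u + (t - u) * s"
    have \<delta>: "?\<delta> s = \<gamma> (?p s)" "?p s \<in> Is ! i \<or> ?p s \<in> Is ! Suc i" if "0 \<le> s" "s \<le> 1" for s
      using that between[of i "Suc i" u t "?p s"] affine_bounds[of u t s] ut bounds u Suc.prems
      by (auto simp: subpath_def compose_def)
    have disj: "Xs ! i \<inter> Xs ! Suc i = {}"
      using pixel_disjoint Xs nbr Suc.prems by simp
    have "crossing (Xs ! i) (Xs ! Suc i) ?\<delta>"
      unfolding crossing_def
    proof (intro conjI allI impI)
      show "?\<delta> 0 \<in> Xs ! i" "?\<delta> 1 \<in> Xs ! Suc i" using sub u Suc.prems by auto
      show "im ?\<delta> \<subseteq> Xs ! i \<union> Xs ! Suc i"
        using \<delta> sub Suc.prems by (fastforce simp: im_def)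
      fix s r :: real assume sr: "0 \<le> s" "s \<le> r" "r \<le> 1" "?\<delta> r \<in> Xs ! i"
      then have "?p r \<in> Is ! i" using \<delta>[of r] sub[of "Suc i" "?p r"] disj Suc.prems by auto
      moreover have "u \<le> ?p s" "?p s \<le> ?p r" using sr ut by (auto intro: mult_left_mono)
      ultimately have "?p s \<in> Is ! i"
        using between[of i i u "?p r" "?p s"] u Suc.prems by auto
      then show "?\<delta> s \<in> Xs ! i" using \<delta>[of s] sub sr Suc.prems by auto
    qed
    then have "T ?\<delta>"
      using Xs nbr Suc.prems ut bounds by (intro cross[of "Xs ! i" "Xs ! Suc i"] subpath_in \<gamma>) auto
    moreover have "T (subpath 0 u \<gamma>)" using Suc u by auto
    ultimately have "T (subpath 0 u \<gamma> \<cdot>\<^sub>p ?\<delta>)"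
      using ut bounds by (intro concat subpath_in \<gamma>) auto
    then show ?case using R[OF R_sym[OF R_subpath_split[OF \<gamma>, of u t]]] ut bounds by auto
  qed
  moreover obtain i where "i < ?n" "1 \<in> Is ! i" using find[of 1] by auto
  ultimately have "T (subpath 0 1 \<gamma>)" by blast
  then show ?thesis by (simp add: subpath_whole \<gamma>)
qed

end

section \<open>Functors inverting the paths in pixels\<close>

lemma (in category) inverse_mors_epi:
  assumes "x \<in> Obj C" "y \<in> Obj C" "z \<in> Obj C" "inverse_mors C x y f g" "h \<in> Hom C y z" "h' \<in> Hom C y z"
    and "Comp C x y z h f = Comp C x y z h' f"
  shows "h = h'"
  using assms inverse_mors_cancel_right[OF assms(2,1,3) inverse_mors_sym[OF assms(4)]] by metis

text \<open>The setting shared by both halves of the theorem: \<open>L\<close> is a functor on paths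
  that inverts those lying in the pixels of \<open>G\<close>. For the plain pixelation
  \<open>G\<close> is all of \<open>P\<close>; in the linear case it omits the pre-dead
  pixels.\<close>

locale pixel_functor = screen X \<Gamma> R P + D: category D
  for X :: "'x set" and \<Gamma> R P and D :: "('o, 'm, 'z) cat_scheme" +
  fixes Ob :: "'x \<Rightarrow> 'o" and L :: "'x pth \<Rightarrow> 'm" and G :: "'x set set"
  assumes Ob_in: "x \<in> X \<Longrightarrow> Ob x \<in> Obj D"
    and L_in: "\<gamma> \<in> \<Gamma> \<Longrightarrow> L \<gamma> \<in> Hom D (Ob (\<gamma> 0)) (Ob (\<gamma> 1))"
    and L_R: "(\<gamma>, \<gamma>') \<in> R \<Longrightarrow> L \<gamma> = L \<gamma>'"
    and L_concat: "\<lbrakk>\<gamma> \<in> \<Gamma>; \<gamma>' \<in> \<Gamma>; \<gamma> 1 = \<gamma>' 0\<rbrakk>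
      \<Longrightarrow> L (\<gamma> \<cdot>\<^sub>p \<gamma>') = Comp D (Ob (\<gamma> 0)) (Ob (\<gamma>' 0)) (Ob (\<gamma>' 1)) (L \<gamma>') (L \<gamma>)"
    and L_const: "x \<in> X \<Longrightarrow> L (const_path x) = Ident D (Ob x)"
    and G_subset: "A \<in> G \<Longrightarrow> A \<in> P"
    and L_iso: "\<lbrakk>A \<in> G; pixel_arrow \<Gamma> A x y \<rho>\<rbrakk> \<Longrightarrow> iso_mor D (Ob x) (Ob y) (L \<rho>)"
begin

lemma L_arrow: "pixel_arrow \<Gamma> A x y \<rho> \<Longrightarrow> L \<rho> \<in> Hom D (Ob x) (Ob y)"
  using L_in[of \<rho>] by (auto simp: pixel_arrow_def)

lemma L_arrow_concat: "pixel_arrow \<Gamma> A x y \<rho> \<Longrightarrow> pixel_arrow \<Gamma> A y z \<rho>'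
    \<Longrightarrow> L (\<rho> \<cdot>\<^sub>p \<rho>') = Comp D (Ob x) (Ob y) (Ob z) (L \<rho>') (L \<rho>)"
  using L_concat[of \<rho> \<rho>'] by (auto simp: pixel_arrow_def)

text \<open>
  Any roof \<open>x \<leftarrow> w \<rightarrow> y\<close> inside a pixel yields an isomorphism, which does not depend on the roof
  because parallel paths inside a pixel are equivalent by (S1).
\<close>

definition can :: "'x \<Rightarrow> 'x \<Rightarrow> 'm" where
  "can x y = (SOME f. f \<in> Hom D (Ob x) (Ob y) \<and> (\<forall>A\<in>G. \<forall>w \<alpha> \<beta>.
     pixel_arrow \<Gamma> A w x \<alpha> \<longrightarrow> pixel_arrow \<Gamma> A w y \<beta> \<longrightarrow> Comp D (Ob w) (Ob x) (Ob y) f (L \<alpha>) = L \<beta>))"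

context
  fixes A assumes A: "A \<in> G"
begin

lemma AP: "A \<in> P" using A by (rule G_subset)

lemma Ob_A: "x \<in> A \<Longrightarrow> Ob x \<in> Obj D"
  using AP pixel_in_X Ob_in by blast

lemma can_exists:
  assumes "x \<in> A" "y \<in> A"
  shows "\<exists>f. f \<in> Hom D (Ob x) (Ob y) \<and> (\<forall>w \<alpha> \<beta>.
     pixel_arrow \<Gamma> A w x \<alpha> \<longrightarrow> pixel_arrow \<Gamma> A w y \<beta> \<longrightarrow> Comp D (Ob w) (Ob x) (Ob y) f (L \<alpha>) = L \<beta>)"
proof -
  obtain w \<alpha> \<beta> where ab: "pixel_arrow \<Gamma> A w x \<alpha>" "pixel_arrow \<Gamma> A w y \<beta>"
    using roof[OF AP assms] by blast
  obtain g where g: "inverse_mors D (Ob w) (Ob x) (L \<alpha>) g"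
    using L_iso[OF A ab(1)] by (auto simp: iso_mor_iff)
  note w = pixel_arrow_in[OF ab(1)]
  let ?f = "Comp D (Ob x) (Ob w) (Ob y) (L \<beta>) g"
  have f: "?f \<in> Hom D (Ob x) (Ob y)"
    using g w assms L_arrow[OF ab(2)] by (intro D.Comp_in Ob_A) (auto simp: inverse_mors_def)
  have f\<alpha>: "Comp D (Ob w) (Ob x) (Ob y) ?f (L \<alpha>) = L \<beta>"
    using w assms by (intro D.inverse_mors_cancel_right Ob_A g L_arrow[OF ab(2)]) auto
  have "Comp D (Ob w') (Ob x) (Ob y) ?f (L \<alpha>') = L \<beta>'"
    if ab': "pixel_arrow \<Gamma> A w' x \<alpha>'" "pixel_arrow \<Gamma> A w' y \<beta>'" for w' \<alpha>' \<beta>'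
  proof -
    note w' = pixel_arrow_in[OF ab'(1)]
    \<comment> \<open>A roof over the two apexes makes the resulting paths to \<open>x\<close>
      parallel inside \<open>A\<close>, and likewise those to \<open>y\<close>, so that (S1)
      identifies them.\<close>
    obtain z \<delta> \<epsilon> where z: "pixel_arrow \<Gamma> A z w \<delta>" "pixel_arrow \<Gamma> A z w' \<epsilon>"
      using roof[OF AP, of w w'] w w' by blast
    note in_Obj = Ob_A w w' assms pixel_arrow_in[OF z(1)]
    have "L (\<epsilon> \<cdot>\<^sub>p \<alpha>') = L (\<delta> \<cdot>\<^sub>p \<alpha>)" "L (\<epsilon> \<cdot>\<^sub>p \<beta>') = L (\<delta> \<cdot>\<^sub>p \<beta>)"
      by (rule L_R, rule pixel_arrow_unique[OF AP], rule pixel_arrow_concat[OF z(2)], rule ab',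
          rule pixel_arrow_concat[OF z(1)], rule ab)+
    then have eq: "Comp D (Ob z) (Ob w') (Ob x) (L \<alpha>') (L \<epsilon>) = Comp D (Ob z) (Ob w) (Ob x) (L \<alpha>) (L \<delta>)"
      "Comp D (Ob z) (Ob w') (Ob y) (L \<beta>') (L \<epsilon>) = Comp D (Ob z) (Ob w) (Ob y) (L \<beta>) (L \<delta>)"
      using L_arrow_concat[OF z(1) ab(1)] L_arrow_concat[OF z(1) ab(2)]
        L_arrow_concat[OF z(2) ab'(1)] L_arrow_concat[OF z(2) ab'(2)] by simp_all
    \<comment> \<open>\<open>L \<epsilon>\<close> is invertible, so the desired equation may be
      tested after composing with it.\<close>
    obtain h where h: "inverse_mors D (Ob z) (Ob w') (L \<epsilon>) h"
      using L_iso[OF A z(2)] by (auto simp: iso_mor_iff)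
    have "Comp D (Ob z) (Ob w') (Ob y) (Comp D (Ob w') (Ob x) (Ob y) ?f (L \<alpha>')) (L \<epsilon>)
        = Comp D (Ob z) (Ob x) (Ob y) ?f (Comp D (Ob z) (Ob w') (Ob x) (L \<alpha>') (L \<epsilon>))"
      using f L_arrow[OF z(2)] L_arrow[OF ab'(1)] in_Obj by (intro D.Comp_assoc[symmetric]) auto
    also have "\<dots> = Comp D (Ob z) (Ob x) (Ob y) ?f (Comp D (Ob z) (Ob w) (Ob x) (L \<alpha>) (L \<delta>))"
      by (simp only: eq)
    also have "\<dots> = Comp D (Ob z) (Ob w) (Ob y) (Comp D (Ob w) (Ob x) (Ob y) ?f (L \<alpha>)) (L \<delta>)"
      using f L_arrow[OF z(1)] L_arrow[OF ab(1)] in_Obj by (intro D.Comp_assoc) auto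
    also have "\<dots> = Comp D (Ob z) (Ob w') (Ob y) (L \<beta>') (L \<epsilon>)"
      by (simp only: f\<alpha> eq)
    finally show ?thesis
      using in_Obj f L_arrow[OF ab'(1)] L_arrow[OF ab'(2)]
      by - (rule D.inverse_mors_epi[OF _ _ _ h], simp_all add: D.Comp_in)
  qed
  with f show ?thesis by blast
qed

lemma
  assumes "x \<in> A" "y \<in> A"
  shows can_in: "can x y \<in> Hom D (Ob x) (Ob y)"
    and can_roof: "\<lbrakk>pixel_arrow \<Gamma> A w x \<alpha>; pixel_arrow \<Gamma> A w y \<beta>\<rbrakk>
      \<Longrightarrow> Comp D (Ob w) (Ob x) (Ob y) (can x y) (L \<alpha>) = L \<beta>"
proof -
  obtain f where f: "f \<in> Hom D (Ob x) (Ob y)" "\<And>w \<alpha> \<beta>. pixel_arrow \<Gamma> A w x \<alpha> \<Longrightarrow> pixel_arrow \<Gamma> A w y \<beta>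
      \<Longrightarrow> Comp D (Ob w) (Ob x) (Ob y) f (L \<alpha>) = L \<beta>"
    using can_exists[OF assms] by blast
  \<comment> \<open>The property that defines \<open>can\<close> ranges over all pixels of
    \<open>G\<close>, but only the one that contains \<open>x\<close> has paths ending at
    \<open>x\<close>.\<close>
  have "B = A" if "B \<in> G" "pixel_arrow \<Gamma> B w x \<alpha>" for B w \<alpha>
    using pixel_unique[of B A x] that pixel_arrow_in[OF that(2)] assms AP G_subset by blast
  with f have "\<exists>f. f \<in> Hom D (Ob x) (Ob y) \<and> (\<forall>A\<in>G. \<forall>w \<alpha> \<beta>. pixel_arrow \<Gamma> A w x \<alpha> \<longrightarrow>
      pixel_arrow \<Gamma> A w y \<beta> \<longrightarrow> Comp D (Ob w) (Ob x) (Ob y) f (L \<alpha>) = L \<beta>)"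
    by (intro exI[of _ f]) metis
  note some = someI_ex[OF this, folded can_def]
  show "can x y \<in> Hom D (Ob x) (Ob y)" using some by simp
  show "\<lbrakk>pixel_arrow \<Gamma> A w x \<alpha>; pixel_arrow \<Gamma> A w y \<beta>\<rbrakk>
      \<Longrightarrow> Comp D (Ob w) (Ob x) (Ob y) (can x y) (L \<alpha>) = L \<beta>"
    using some A by simp
qed

text \<open>A single roof suffices to recognise \<open>can x y\<close>, because the leg to
  \<open>x\<close> is inverted by \<open>L\<close> and can be cancelled.\<close>

lemma can_unique:
  assumes "pixel_arrow \<Gamma> A w x \<alpha>" "pixel_arrow \<Gamma> A w y \<beta>" "f \<in> Hom D (Ob x) (Ob y)"
    and "Comp D (Ob w) (Ob x) (Ob y) f (L \<alpha>) = L \<beta>"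
  shows "f = can x y"
proof -
  obtain g where "inverse_mors D (Ob w) (Ob x) (L \<alpha>) g"
    using L_iso[OF A assms(1)] by (auto simp: iso_mor_iff)
  then show ?thesis
    using assms pixel_arrow_in[OF assms(1)] pixel_arrow_in[OF assms(2)] can_roof[OF _ _ assms(1,2)]
    by - (rule D.inverse_mors_epi[of "Ob w" "Ob x" "Ob y"], auto intro: can_in Ob_A)
qed

lemma can_Ident: "x \<in> A \<Longrightarrow> can x x = Ident D (Ob x)"
  using can_unique[OF pixel_arrow_const[OF AP] pixel_arrow_const[OF AP], of x "Ident D (Ob x)"]
    L_const[OF pixel_in_X[OF AP]] D.Ident_in[OF Ob_A] D.Comp_Ident_left[OF Ob_A Ob_A] by simp

lemma can_arrow:
  assumes "pixel_arrow \<Gamma> A x y \<rho>"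
  shows "can x y = L \<rho>"
  using can_unique[OF pixel_arrow_const[OF AP] assms L_arrow[OF assms]] pixel_arrow_in[OF assms]
    L_const[OF pixel_in_X[OF AP]] D.Comp_Ident_right[OF Ob_A Ob_A L_arrow[OF assms]] by simp

text \<open>Tested on an apex over all three points, where each canonical map exchanges one leg for
  the next.\<close>

lemma can_Comp:
  assumes "x \<in> A" "y \<in> A" "z \<in> A"
  shows "Comp D (Ob x) (Ob y) (Ob z) (can y z) (can x y) = can x z"
proof -
  obtain w \<alpha> \<beta> \<delta> where w: "w \<in> A" "pixel_arrow \<Gamma> A w x \<alpha>" "pixel_arrow \<Gamma> A w y \<beta>" "pixel_arrow \<Gamma> A w z \<delta>"
    using common_roof[OF AP, of "{x, y, z}"] assms by auto
  have "Comp D (Ob w) (Ob x) (Ob z) (Comp D (Ob x) (Ob y) (Ob z) (can y z) (can x y)) (L \<alpha>)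
      = Comp D (Ob w) (Ob y) (Ob z) (can y z) (Comp D (Ob w) (Ob x) (Ob y) (can x y) (L \<alpha>))"
    using assms w by (intro D.Comp_assoc[symmetric] Ob_A can_in L_arrow)
  also have "\<dots> = L \<delta>" using assms w by (simp add: can_roof)
  finally show ?thesis
    using assms w by (intro can_unique[OF w(2,4)] D.Comp_in Ob_A can_in)
qed

lemma can_inverse: "x \<in> A \<Longrightarrow> y \<in> A \<Longrightarrow> inverse_mors D (Ob x) (Ob y) (can x y) (can y x)"
  by (simp add: inverse_mors_def can_in can_Comp can_Ident)

end

text \<open>
  This is where the base point of a pixel is reached: a crossing is extended at both ends to
  points connected to the base points by honest paths, and the extension is again a crossing.
\<close>

lemma crossing_factor:
  assumes A: "A \<in> G" and B: "B \<in> G" and "A \<noteq> B" and \<gamma>: "\<gamma> \<in> \<Gamma>" "crossing A B \<gamma>" and ab: "a \<in> A" "b \<in> B"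
  obtains w v \<tau> \<sigma> \<delta> where "pixel_arrow \<Gamma> A w a \<tau>" "pixel_arrow \<Gamma> B b v \<sigma>" "\<delta> \<in> \<Gamma>" "\<delta> 0 = w" "\<delta> 1 = v"
    "two_pixel_path P \<delta>"
    "Comp D (Ob a) (Ob (\<gamma> 1)) (Ob b) (can (\<gamma> 1) b) (Comp D (Ob a) (Ob (\<gamma> 0)) (Ob (\<gamma> 1)) (L \<gamma>) (can a (\<gamma> 0)))
     = Comp D (Ob a) (Ob w) (Ob b) (Comp D (Ob w) (Ob v) (Ob b) (can v b) (L \<delta>)) (can a w)"
proof -
  have disj: "A \<inter> B = {}" using assms G_subset by (intro pixel_disjoint) auto
  have g: "\<gamma> 0 \<in> A" "\<gamma> 1 \<in> B" using \<gamma>(2) by (auto simp: crossing_def)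
  \<comment> \<open>The directions are those asked of an arrow of the quiver: \<open>\<tau>\<close>
    runs into the base point of the source, \<open>\<sigma>\<close> out of the base point of the
    target. Hence a roof on one side and its dual on the other.\<close>
  obtain w \<rho> \<tau> where w: "pixel_arrow \<Gamma> A w (\<gamma> 0) \<rho>" "pixel_arrow \<Gamma> A w a \<tau>"
    using roof[OF AP[OF A] g(1) ab(1)] by blast
  obtain v \<kappa> \<sigma> where v: "pixel_arrow \<Gamma> B (\<gamma> 1) v \<kappa>" "pixel_arrow \<Gamma> B b v \<sigma>"
    using coroof[OF AP[OF B] g(2) ab(2)] by blast
  let ?\<delta> = "\<rho> \<cdot>\<^sub>p \<gamma> \<cdot>\<^sub>p \<kappa>"
  have ends: "\<rho> \<in> \<Gamma>" "\<kappa> \<in> \<Gamma>" "\<rho> 1 = \<gamma> 0" "\<gamma> 1 = \<kappa> 0" "\<rho> 0 = w" "\<kappa> 1 = v" "im \<rho> \<subseteq> A" "im \<kappa> \<subseteq> B"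
    using w v by (auto simp: pixel_arrow_def)
  then have \<rho>\<gamma>: "\<rho> \<cdot>\<^sub>p \<gamma> \<in> \<Gamma>" using \<gamma> by (intro concat_in) auto
  have \<delta>: "?\<delta> \<in> \<Gamma>" "?\<delta> 0 = w" "?\<delta> 1 = v" using ends \<rho>\<gamma> by (auto intro: concat_in)
  have "crossing A B ?\<delta>"
    using ends \<gamma> disj by (intro crossing_concat_right crossing_concat_left) auto
  then have two: "two_pixel_path P ?\<delta>"
    using assms disj by (intro two_pixel_path_crossing) (auto intro: G_subset)
  note wv = pixel_arrow_in[OF w(1)] pixel_arrow_in[OF v(1)]
  note in_simps = wv ab Ob_A[OF A] Ob_A[OF B] can_in[OF A] can_in[OF B] L_in[OF \<gamma>(1)] D.Comp_in
  \<comment> \<open>The added ends lie in pixels of \<open>G\<close>, so \<open>L\<close> makes them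
    canonical; together with the surrounding canonical maps they telescope.\<close>
  have L\<delta>: "L ?\<delta> = Comp D (Ob w) (Ob (\<gamma> 1)) (Ob v) (can (\<gamma> 1) v)
      (Comp D (Ob w) (Ob (\<gamma> 0)) (Ob (\<gamma> 1)) (L \<gamma>) (can w (\<gamma> 0)))"
    using L_concat[OF \<rho>\<gamma> ends(2)] L_concat[OF ends(1) \<gamma>(1)] ends
      can_arrow[OF A w(1)] can_arrow[OF B v(1)] by simp
  have "Comp D (Ob w) (Ob v) (Ob b) (can v b) (L ?\<delta>)
      = Comp D (Ob w) (Ob (\<gamma> 1)) (Ob b) (Comp D (Ob (\<gamma> 1)) (Ob v) (Ob b) (can v b) (can (\<gamma> 1) v))
          (Comp D (Ob w) (Ob (\<gamma> 0)) (Ob (\<gamma> 1)) (L \<gamma>) (can w (\<gamma> 0)))"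
    unfolding L\<delta> by (intro D.Comp_assoc) (simp_all add: in_simps)
  also have "\<dots> = Comp D (Ob w) (Ob (\<gamma> 1)) (Ob b) (can (\<gamma> 1) b)
      (Comp D (Ob w) (Ob (\<gamma> 0)) (Ob (\<gamma> 1)) (L \<gamma>) (can w (\<gamma> 0)))"
    by (simp add: in_simps can_Comp[OF B])
  finally have "Comp D (Ob a) (Ob w) (Ob b) (Comp D (Ob w) (Ob v) (Ob b) (can v b) (L ?\<delta>)) (can a w)
      = Comp D (Ob a) (Ob w) (Ob b) (Comp D (Ob w) (Ob (\<gamma> 1)) (Ob b) (can (\<gamma> 1) b)
          (Comp D (Ob w) (Ob (\<gamma> 0)) (Ob (\<gamma> 1)) (L \<gamma>) (can w (\<gamma> 0)))) (can a w)" by simp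
  also have "\<dots> = Comp D (Ob a) (Ob (\<gamma> 1)) (Ob b) (can (\<gamma> 1) b) (Comp D (Ob a) (Ob w) (Ob (\<gamma> 1))
      (Comp D (Ob w) (Ob (\<gamma> 0)) (Ob (\<gamma> 1)) (L \<gamma>) (can w (\<gamma> 0))) (can a w))"
    by (intro D.Comp_assoc[symmetric]) (simp_all add: in_simps)
  also have "Comp D (Ob a) (Ob w) (Ob (\<gamma> 1)) (Comp D (Ob w) (Ob (\<gamma> 0)) (Ob (\<gamma> 1)) (L \<gamma>) (can w (\<gamma> 0))) (can a w)
      = Comp D (Ob a) (Ob (\<gamma> 0)) (Ob (\<gamma> 1)) (L \<gamma>) (Comp D (Ob a) (Ob w) (Ob (\<gamma> 0)) (can w (\<gamma> 0)) (can a w))"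
    by (intro D.Comp_assoc[symmetric]) (simp_all add: in_simps)
  also have "Comp D (Ob a) (Ob w) (Ob (\<gamma> 0)) (can w (\<gamma> 0)) (can a w) = can a (\<gamma> 0)"
    by (simp add: in_simps can_Comp[OF A])
  finally show thesis using that[OF w(2) v(2) \<delta> two] by simp
qed

end

section \<open>The pixelation of the path category\<close>

context screen
begin

abbreviation "\<Sigma> \<equiv> pixel_mors \<Gamma> R P"

lemma localizing_pixel_mors: "localizing C \<Sigma>"
  by (intro localizing.intro localizing_axioms.intro category_C) (auto simp: pixel_mors_def path_cat_def)

interpretation loc: localizing C \<Sigma> by (rule localizing_pixel_mors)

abbreviation "Lmor \<gamma> \<equiv> loc_mor C \<Sigma> (\<gamma> 0) (\<gamma> 1) (R `` {\<gamma>})"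

lemma pixel_arrow_pixel_mors: "A \<in> P \<Longrightarrow> pixel_arrow \<Gamma> A x y \<rho> \<Longrightarrow> R `` {\<rho>} \<in> \<Sigma> x y"
  by (auto simp: pixel_mors_def pixel_arrow_def in_pixel_def)

lemma pixel_mors_cases:
  assumes "\<sigma> \<in> \<Sigma> x y"
  obtains A \<rho> where "A \<in> P" "pixel_arrow \<Gamma> A x y \<rho>" "\<sigma> = R `` {\<rho>}"
  using assms by (auto simp: pixel_mors_def pixel_arrow_def in_pixel_def)

lemma pixel_functor_pixelation: "pixel_functor X \<Gamma> R P (pixelation X \<Gamma> R P) (\<lambda>x. x) Lmor P"
proof (intro pixel_functor.intro pixel_functor_axioms.intro screen_axioms)
  show "category (pixelation X \<Gamma> R P)" unfolding pixelation_def by (rule loc.category_D)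
  fix \<gamma> \<gamma>'
  show "Lmor \<gamma> \<in> Hom (pixelation X \<Gamma> R P) (\<gamma> 0) (\<gamma> 1)" if "\<gamma> \<in> \<Gamma>"
    unfolding pixelation_def using that by (intro loc.loc_mor_in cls_in_C) (simp_all add: ends_in)
  show "Lmor (\<gamma> \<cdot>\<^sub>p \<gamma>') = Comp (pixelation X \<Gamma> R P) (\<gamma> 0) (\<gamma>' 0) (\<gamma>' 1) (Lmor \<gamma>') (Lmor \<gamma>)"
    if g: "\<gamma> \<in> \<Gamma>" "\<gamma>' \<in> \<Gamma>" "\<gamma> 1 = \<gamma>' 0"
  proof -
    have "R `` {\<gamma> \<cdot>\<^sub>p \<gamma>'} = Comp C (\<gamma> 0) (\<gamma>' 0) (\<gamma>' 1) (R `` {\<gamma>'}) (R `` {\<gamma>})"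
      using g by (simp add: Comp_C)
    then show ?thesis
      unfolding pixelation_def
      using loc.loc_mor_Comp[of "\<gamma> 0" "\<gamma>' 0" "\<gamma>' 1" "R `` {\<gamma>}" "R `` {\<gamma>'}"]
        g cls_in_C[OF g(1)] cls_in_C[OF g(2)] ends_in[OF g(1)] ends_in[OF g(2)] by simp
  qed
next
  fix \<gamma> \<gamma>' assume "(\<gamma>, \<gamma>') \<in> R"
  then show "Lmor \<gamma> = Lmor \<gamma>'" using R_ends[of \<gamma> \<gamma>'] cls_eq[of \<gamma> \<gamma>'] by simp
next
  fix x assume "x \<in> X"
  then show "x \<in> Obj (pixelation X \<Gamma> R P)" "Lmor (const_path x) = Ident (pixelation X \<Gamma> R P) x"
    using loc.loc_mor_Ident[of x] by (simp_all add: pixelation_def Ident_C)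
next
  fix A x y \<rho> assume A: "A \<in> P" and \<rho>: "pixel_arrow \<Gamma> A x y \<rho>"
  then have "inverse_mors (pixelation X \<Gamma> R P) x y (loc_mor C \<Sigma> x y (R `` {\<rho>})) (loc_inv C \<Sigma> x y (R `` {\<rho>}))"
    unfolding pixelation_def using pixel_arrow_in[OF \<rho>] pixel_in_X[OF A]
    by (intro loc.loc_inverse pixel_arrow_pixel_mors[OF A]) auto
  with \<rho> show "iso_mor (pixelation X \<Gamma> R P) x y (Lmor \<rho>)"
    by (auto simp: iso_mor_iff pixel_arrow_def)
qed

interpretation D: pixel_functor X \<Gamma> R P "pixelation X \<Gamma> R P" "\<lambda>x. x" Lmor P
  by (rule pixel_functor_pixelation)

abbreviation "Dp \<equiv> pixelation X \<Gamma> R P"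

lemma Obj_Dp [simp]: "Obj Dp = X"
  by (simp add: pixelation_def)

text \<open>Inverses are unique, so formal inverses of pixel paths are canonical maps too. Pseudo
  arrows and their transports can thus be written with \<open>can\<close> alone.\<close>

lemma loc_inv_eq_can:
  assumes "A \<in> P" "pixel_arrow \<Gamma> A x y \<rho>"
  shows "loc_inv C \<Sigma> x y (R `` {\<rho>}) = D.can y x"
proof -
  have xy: "x \<in> A" "y \<in> A" "x \<in> X" "y \<in> X"
    using pixel_arrow_in[OF assms(2)] pixel_in_X[OF assms(1)] by auto
  have "inverse_mors Dp x y (loc_mor C \<Sigma> x y (R `` {\<rho>})) (loc_inv C \<Sigma> x y (R `` {\<rho>}))"
    unfolding pixelation_def using xy by (intro loc.loc_inverse pixel_arrow_pixel_mors[OF assms]) auto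
  moreover have "loc_mor C \<Sigma> x y (R `` {\<rho>}) = D.can x y"
    using D.can_arrow[OF assms] assms(2) by (simp add: pixel_arrow_def)
  ultimately show ?thesis
    using D.can_inverse[OF assms(1) xy(1,2)] xy by (intro D.D.inverse_mors_unique[of x y "D.can x y"]) auto
qed

lemma pseudo_arrow_in: "pseudo_arrow X \<Gamma> R P x y p \<Longrightarrow> y \<in> X \<Longrightarrow> p \<in> Hom Dp x y"
  unfolding pseudo_arrow_def
proof clarify
  fix \<gamma> \<sigma> assume \<gamma>: "\<gamma> \<in> \<Gamma>" and \<sigma>: "\<sigma> \<in> \<Sigma> y (\<gamma> 1)" and y: "y \<in> X"
  obtain A \<rho> where A: "A \<in> P" "pixel_arrow \<Gamma> A y (\<gamma> 1) \<rho>" "\<sigma> = R `` {\<rho>}" using \<sigma> by (rule pixel_mors_cases)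
  then show "Comp Dp (\<gamma> 0) (\<gamma> 1) y (loc_inv C \<Sigma> y (\<gamma> 1) \<sigma>) (Lmor \<gamma>) \<in> Hom Dp (\<gamma> 0) y"
    using \<gamma> y ends_in[OF \<gamma>] D.can_in[OF A(1)] pixel_arrow_in[OF A(2)]
    by (simp add: loc_inv_eq_can D.D.Comp_in D.L_in)
qed

text \<open>\<open>pix\<close> and \<open>s\<close> are the object parts of the two functors. The
  property \<open>T\<close> expresses fullness after transport; it passes from canonical maps and
  crossings to paths, and from paths and formal inverses to words.\<close>

theorem equivalent_pixelation_quiver_cat:
  assumes s: "\<forall>A\<in>P. s A \<in> A"
  shows "equivalent_cats Dp (quiver_cat X \<Gamma> R P s)"
proof -
  let ?Arr = "quiver_arrows X \<Gamma> R P s"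
  let ?K = "free_cat (quiver P ?Arr)" and ?FM = "\<lambda>u v. free_functor Dp s v"
  have sX: "s A \<in> X" if "A \<in> P" for A using s that pixel_in_X by blast
  have Arr: "a \<in> Hom Dp (s A) (s B)" if "A \<in> P" "B \<in> P" "a \<in> ?Arr A B" for A B a
  proof -
    from that(3) obtain w \<tau> p where a: "a = Comp Dp (s A) w (s B) p (loc_inv C \<Sigma> w (s A) \<tau>)"
      and \<tau>: "\<tau> \<in> \<Sigma> w (s A)" and p: "pseudo_arrow X \<Gamma> R P w (s B) p" unfolding quiver_arrows_def by blast
    obtain A' \<rho> where A': "A' \<in> P" "pixel_arrow \<Gamma> A' w (s A) \<rho>" "\<tau> = R `` {\<rho>}" using \<tau> by (rule pixel_mors_cases)
    then show ?thesis
      using pixel_arrow_in[OF A'(2)] D.can_in[OF A'(1)] pseudo_arrow_in[OF p] sX that(1,2)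
        pixel_in_X[OF A'(1)]
      by (simp add: a loc_inv_eq_can D.D.Comp_in)
  qed
  have F: "is_functor ?K Dp s ?FM"
    by (rule D.D.is_functor_free_functor) (use sX Arr in auto)
  interpret F: is_functor ?K Dp s ?FM by (rule F)
  have cat_eq: "quiver_cat X \<Gamma> R P s = quotient_cat ?K (kernel_rel ?K ?FM)"
    unfolding quiver_cat_def pixel_quiver_def kernel_rel_def by simp
  have pixX: "pix x \<in> P" "x \<in> pix x" "s (pix x) \<in> pix x" "s (pix x) \<in> X" if "x \<in> X" for x
    using pix[OF that] s sX by auto
  define b where "b x = s (pix x)" for x
  define \<theta> where "\<theta> x = D.can x (b x)" for x
  define \<iota> where "\<iota> x = D.can (b x) x" for x
  interpret iso_family Dp b \<theta> \<iota>
  proof (intro iso_family.intro iso_family_axioms.intro D.D.category_axioms)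
    fix x assume "x \<in> Obj Dp"
    then have x: "x \<in> X" by simp
    show "b x \<in> Obj Dp" using pixX(4)[OF x] by (simp add: b_def)
    show "inverse_mors Dp x (b x) (\<theta> x) (\<iota> x)"
      unfolding b_def \<theta>_def \<iota>_def by (rule D.can_inverse) (rule pixX[OF x])+
  qed
  have pix_s: "pix (s A) = A" if "A \<in> P" for A using s that by (intro pix_eqI) auto
  \<comment> \<open>Transport to the base point turns a canonical map into an identity, which is the
    value of the empty walk.\<close>
  have conj_can: "conj_mor x y (D.can x y) = ?FM (pix x) (pix y) []" if "A \<in> P" "x \<in> A" "y \<in> A" for A x y
    using that s by (simp add: conj_mor_def b_def \<theta>_def \<iota>_def pix_eqI[of A] D.can_Comp[of A] D.can_Ident[of A])
  define T where "T x y f \<longleftrightarrow> conj_mor x y f \<in> ?FM (pix x) (pix y) ` Hom ?K (pix x) (pix y)" for x y f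
  have T_Nil: "T x y (D.can x y)" if "A \<in> P" "x \<in> A" "y \<in> A" for A x y
    unfolding T_def conj_can[OF that] by (rule imageI) (use that in \<open>simp add: pix_eqI awalk_quiver\<close>)
  have T_Comp: "T x z (Comp Dp x y z g f)"
    if o: "x \<in> X" "y \<in> X" "z \<in> X" and fg: "f \<in> Hom Dp x y" "g \<in> Hom Dp y z" "T x y f" "T y z g" for x y z f g
  proof -
    from fg(3,4) obtain p q where p: "p \<in> Hom ?K (pix x) (pix y)" "conj_mor x y f = ?FM (pix x) (pix y) p"
      and q: "q \<in> Hom ?K (pix y) (pix z)" "conj_mor y z g = ?FM (pix y) (pix z) q" unfolding T_def by blast
    have eq: "conj_mor x z (Comp Dp x y z g f) = ?FM (pix x) (pix z) (Comp ?K (pix x) (pix y) (pix z) q p)"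
      using o fg p q pixX by (simp add: conj_mor_Comp F.FM_Comp b_def del: free_cat_simps(2,3))
    have "Comp ?K (pix x) (pix y) (pix z) q p \<in> Hom ?K (pix x) (pix z)"
      using p(1) q(1) by (auto intro: awalk_quiver_append)
    then show ?thesis unfolding T_def eq by (rule imageI)
  qed
  have T_path: "T (\<gamma> 0) (\<gamma> 1) (Lmor \<gamma>)" if "\<gamma> \<in> \<Gamma>" for \<gamma>
    using that
  proof (induction \<gamma> rule: path_induct)
    case (equiv \<gamma> \<gamma>')
    then show ?case using R_ends[of \<gamma> \<gamma>'] D.L_R[of \<gamma> \<gamma>'] by simp
  next
    case (pixel A x y \<rho>)
    then have "Lmor \<rho> = D.can x y" "\<rho> 0 = x" "\<rho> 1 = y" "x \<in> A" "y \<in> A"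
      using D.can_arrow[OF pixel] pixel_arrow_in[OF pixel(2)] by (auto simp: pixel_arrow_def)
    then show ?case using T_Nil[of A x y] pixel by simp
  next
    case (crossing A B \<gamma>)
    have g: "\<gamma> 0 \<in> A" "\<gamma> 1 \<in> B" using crossing by (auto simp: crossing_def)
    obtain w v \<tau> \<sigma> \<delta> where *: "pixel_arrow \<Gamma> A w (s A) \<tau>" "pixel_arrow \<Gamma> B (s B) v \<sigma>" "\<delta> \<in> \<Gamma>" "\<delta> 0 = w" "\<delta> 1 = v"
      "two_pixel_path P \<delta>"
      "Comp Dp (s A) (\<gamma> 1) (s B) (D.can (\<gamma> 1) (s B)) (Comp Dp (s A) (\<gamma> 0) (\<gamma> 1) (Lmor \<gamma>) (D.can (s A) (\<gamma> 0)))
       = Comp Dp (s A) w (s B) (Comp Dp w v (s B) (D.can v (s B)) (Lmor \<delta>)) (D.can (s A) w)"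
      by (rule D.crossing_factor[OF crossing bspec[OF s crossing(1)] bspec[OF s crossing(2)]])
    let ?p = "Comp Dp w v (s B) (D.can v (s B)) (Lmor \<delta>)"
    let ?a = "Comp Dp (s A) w (s B) ?p (D.can (s A) w)"
    have conj: "conj_mor (\<gamma> 0) (\<gamma> 1) (Lmor \<gamma>) = ?a"
      using *(7) g crossing by (simp add: conj_mor_def b_def \<theta>_def \<iota>_def pix_eqI)
    \<comment> \<open>\<open>can v (s B)\<close> is the formal inverse of the class of
      \<open>\<sigma>\<close>, so \<open>?p\<close> is a fraction whose numerator crosses two
      pixels. In the same way \<open>can (s A) w\<close> is the inverse of the class of
      \<open>\<tau>\<close>, which makes \<open>?a\<close> an arrow.\<close>
    have "pseudo_arrow X \<Gamma> R P w (s B) ?p"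
      unfolding pseudo_arrow_def
      using *(3-6) loc_inv_eq_can[OF crossing(2) *(2)] pixel_arrow_pixel_mors[OF crossing(2) *(2)]
      by (intro bexI[of _ \<delta>] bexI[of _ "R `` {\<sigma>}"]) simp_all
    then have "?a \<in> ?Arr A B"
      unfolding quiver_arrows_def
      using loc_inv_eq_can[OF crossing(1) *(1)] pixel_arrow_pixel_mors[OF crossing(1) *(1)]
      by (intro CollectI exI[of _ w] exI[of _ "R `` {\<tau>}"] exI[of _ ?p] conjI) simp_all
    then have a: "?a \<in> Hom Dp (s A) (s B)" "[(A, ?a, B)] \<in> Hom ?K A B"
      using Arr crossing(1,2) by (auto simp: awalk_quiver)
    have "conj_mor (\<gamma> 0) (\<gamma> 1) (Lmor \<gamma>) = ?FM A B [(A, ?a, B)]"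
      using conj a(1) sX crossing(1,2) by (simp add: D.D.Comp_Ident_left)
    then show ?case unfolding T_def using a(2) g crossing by (simp only: pix_eqI) (rule imageI)
  next
    case (concat \<gamma> \<gamma>')
    then show ?case
      using T_Comp[of "\<gamma> 0" "\<gamma>' 0" "\<gamma>' 1" "Lmor \<gamma>" "Lmor \<gamma>'"] D.L_concat[OF concat.hyps(1-3)] D.L_in[OF concat.hyps(1)]
        D.L_in[OF concat.hyps(2)] ends_in[OF concat.hyps(1)] ends_in[OF concat.hyps(2)] by simp
  qed
  have full: "T x y f" if "x \<in> X" "y \<in> X" "f \<in> Hom Dp x y" for x y f
  proof (rule loc.localization_induct[where T = T])
    show "f \<in> Hom (localization C \<Sigma>) x y" "x \<in> Obj C" "y \<in> Obj C"
      using that by (simp_all flip: pixelation_def)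
  next
    fix x assume "x \<in> Obj C"
    then show "T x x (Ident (localization C \<Sigma>) x)"
      using T_Nil[of "pix x" x x] pixX D.can_Ident[of "pix x" x] by (simp flip: pixelation_def)
  next
    fix x y f assume "f \<in> Hom C x y"
    then show "T x y (loc_mor C \<Sigma> x y f)" using T_path by (elim Hom_C_cases) auto
  next
    fix x y \<sigma> assume "\<sigma> \<in> \<Sigma> x y"
    then obtain A \<rho> where A: "A \<in> P" "pixel_arrow \<Gamma> A x y \<rho>" "\<sigma> = R `` {\<rho>}" by (rule pixel_mors_cases)
    then show "T y x (loc_inv C \<Sigma> x y \<sigma>)"
      using T_Nil[OF A(1)] pixel_arrow_in[OF A(2)] loc_inv_eq_can[OF A(1,2)] by simp
  next
    fix x y z f g assume "x \<in> Obj C" "y \<in> Obj C" "z \<in> Obj C" "f \<in> Hom (localization C \<Sigma>) x y"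
      "g \<in> Hom (localization C \<Sigma>) y z" "T x y f" "T y z g"
    then show "T x z (Comp (localization C \<Sigma>) x y z g f)" using T_Comp by (simp flip: pixelation_def)
  qed
  have "\<exists>GM. is_functor Dp (quiver_cat X \<Gamma> R P s) pix GM \<and>
      quasi_inverse Dp (quiver_cat X \<Gamma> R P s) pix GM s (\<lambda>u v F. ?FM u v (rep F))"
  \<comment> \<open>Base points lie in their own pixels, so \<open>pix\<close> undoes
    \<open>s\<close> exactly and the canonical map at a base point is an identity.\<close>
  proof (rule quasi_inverse_of_retraction[OF F.functor_quotient_kernel[folded cat_eq], where a = pix])
    show "p = q" if "x \<in> Obj (quiver_cat X \<Gamma> R P s)" "y \<in> Obj (quiver_cat X \<Gamma> R P s)"
      "p \<in> Hom (quiver_cat X \<Gamma> R P s) x y" "q \<in> Hom (quiver_cat X \<Gamma> R P s) x y"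
      "?FM x y (rep p) = ?FM x y (rep q)" for x y p q
      using F.faithful_quotient_kernel[of x y p q] that by (simp add: cat_eq quotient_cat_def)
    show "conj_mor u v f \<in> (\<lambda>F. ?FM (pix u) (pix v) (rep F)) ` Hom (quiver_cat X \<Gamma> R P s) (pix u) (pix v)"
      if "u \<in> Obj Dp" "v \<in> Obj Dp" "f \<in> Hom Dp u v" for u v f
      using F.image_quotient_kernel[of "pix u" "pix v"] that full[of u v f] pixX by (simp add: cat_eq T_def)
  qed (use pixX pix_s s D.can_Ident in \<open>auto simp: cat_eq quotient_cat_def b_def \<theta>_def\<close>)
  then show ?thesis
    unfolding equivalent_cats_def using F.functor_quotient_kernel[folded cat_eq] by blast
qed

end

section \<open>The pixelation of a quotient of the linear path category\<close>

context path_triple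
begin

lemma R_sandwich_assoc:
  assumes "\<alpha> \<in> \<Gamma>" "\<rho> \<in> \<Gamma>" "\<gamma> \<in> \<Gamma>" "\<rho>' \<in> \<Gamma>" "\<beta> \<in> \<Gamma>"
    and "\<alpha> 1 = \<rho> 0" "\<rho> 1 = \<gamma> 0" "\<gamma> 1 = \<rho>' 0" "\<rho>' 1 = \<beta> 0"
  shows "((\<alpha> \<cdot>\<^sub>p \<rho>) \<cdot>\<^sub>p \<gamma> \<cdot>\<^sub>p (\<rho>' \<cdot>\<^sub>p \<beta>), \<alpha> \<cdot>\<^sub>p (\<rho> \<cdot>\<^sub>p \<gamma> \<cdot>\<^sub>p \<rho>') \<cdot>\<^sub>p \<beta>) \<in> R"
proof -
  have "((\<alpha> \<cdot>\<^sub>p \<rho>) \<cdot>\<^sub>p \<gamma> \<cdot>\<^sub>p (\<rho>' \<cdot>\<^sub>p \<beta>), (\<alpha> \<cdot>\<^sub>p \<rho>) \<cdot>\<^sub>p \<gamma> \<cdot>\<^sub>p \<rho>' \<cdot>\<^sub>p \<beta>) \<in> R"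
    using assms by (intro R_assoc) (simp_all add: concat_in)
  moreover have 1: "((\<alpha> \<cdot>\<^sub>p \<rho>) \<cdot>\<^sub>p \<gamma>, \<alpha> \<cdot>\<^sub>p (\<rho> \<cdot>\<^sub>p \<gamma>)) \<in> R"
    using assms by (intro R_sym[OF R_assoc]) simp_all
  have 2: "((\<alpha> \<cdot>\<^sub>p \<rho>) \<cdot>\<^sub>p \<gamma> \<cdot>\<^sub>p \<rho>', \<alpha> \<cdot>\<^sub>p (\<rho> \<cdot>\<^sub>p \<gamma>) \<cdot>\<^sub>p \<rho>') \<in> R"
    using assms by (intro R_concat_left[OF 1]) simp_all
  have 3: "(\<alpha> \<cdot>\<^sub>p (\<rho> \<cdot>\<^sub>p \<gamma>) \<cdot>\<^sub>p \<rho>', \<alpha> \<cdot>\<^sub>p (\<rho> \<cdot>\<^sub>p \<gamma> \<cdot>\<^sub>p \<rho>')) \<in> R"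
    using assms by (intro R_sym[OF R_assoc]) (simp_all add: concat_in)
  have "((\<alpha> \<cdot>\<^sub>p \<rho>) \<cdot>\<^sub>p \<gamma> \<cdot>\<^sub>p \<rho>' \<cdot>\<^sub>p \<beta>, \<alpha> \<cdot>\<^sub>p (\<rho> \<cdot>\<^sub>p \<gamma> \<cdot>\<^sub>p \<rho>') \<cdot>\<^sub>p \<beta>) \<in> R"
    using assms by (intro R_concat_left[OF R_trans[OF 2 3]]) simp_all
  ultimately show ?thesis by (rule R_trans)
qed

end

context path_triple
begin

section \<open>Linear combinations of paths and their prolongation\<close>

abbreviation lin_C :: "('x, 'x pth set \<Rightarrow>\<^sub>0 'k::{comm_ring,comm_monoid_mult}, 'k) lincat" where
  "lin_C \<equiv> linearization C"

abbreviation lin_C0 :: "('x option, 'x pth set \<Rightarrow>\<^sub>0 'k::{comm_ring,comm_monoid_mult}, 'k) lincat" where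
  "lin_C0 \<equiv> lin_path_cat X \<Gamma> R"

lemma lin_category_lin_C: "lin_category lin_C"
  by (rule category.lin_category_linearization[OF category_C])

lemma lin_category_lin_C0: "lin_category lin_C0"
  unfolding lin_path_cat_def by (intro lin_category_adjoin_zero lin_category_lin_C) simp

lemma Obj_lin_C0: "u \<in> Obj lin_C0 \<longleftrightarrow> u = None \<or> (\<exists>x\<in>X. u = Some x)"
  by (auto simp: lin_path_cat_def)

lemma lin_C0_simps [simp]:
  "Hom lin_C0 (Some x) (Some y) = Hom lin_C x y"
  "Hom lin_C0 None v = {0}" "Hom lin_C0 u None = {0}"
  "Comp lin_C0 (Some x) (Some y) (Some z) g f = Comp lin_C x y z g f"
  "Comp lin_C0 None v w g f = 0" "Comp lin_C0 u None w g f = 0" "Comp lin_C0 u v None g f = 0"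
  "HZero lin_C0 u v = 0"
  "HAdd lin_C0 (Some x) (Some y) = (+)"
  "HScale lin_C0 (Some x) (Some y) c = Poly_Mapping.map ((*) c)"
  "Ident lin_C0 None = 0" "Ident lin_C0 (Some x) = Ident lin_C x"
  "HAdd lin_C0 None v f g = 0" "HAdd lin_C0 u None f g = 0"
  "HScale lin_C0 None v c f = 0" "HScale lin_C0 u None c f = 0"
  by (simp_all add: lin_path_cat_def fun_eq_iff) (cases u; cases v; simp)

definition pmor :: "'x pth \<Rightarrow> ('x pth set \<Rightarrow>\<^sub>0 'k::{comm_ring,comm_monoid_mult})" where
  "pmor \<gamma> = Poly_Mapping.single (R `` {\<gamma>}) 1"

lemma pmor_in: "\<gamma> \<in> \<Gamma> \<Longrightarrow> pmor \<gamma> \<in> Hom lin_C (\<gamma> 0) (\<gamma> 1)"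
  by (simp add: pmor_def cls_in_C)

lemma pmor_R: "(\<gamma>, \<gamma>') \<in> R \<Longrightarrow> pmor \<gamma> = pmor \<gamma>'"
  by (simp add: pmor_def cls_eq)

lemma Comp_single_path: "\<lbrakk>\<gamma> \<in> \<Gamma>; \<delta> \<in> \<Gamma>; \<gamma> 1 = \<delta> 0\<rbrakk> \<Longrightarrow>
    Comp lin_C x y z (Poly_Mapping.single (R `` {\<delta>}) d) (Poly_Mapping.single (R `` {\<gamma>}) c)
    = Poly_Mapping.single (R `` {\<gamma> \<cdot>\<^sub>p \<delta>}) (d * c)"
  by (simp add: lin_Comp_single Comp_C)

lemma Comp_pmor: "\<lbrakk>\<gamma> \<in> \<Gamma>; \<delta> \<in> \<Gamma>; \<gamma> 1 = \<delta> 0\<rbrakk> \<Longrightarrow> Comp lin_C x y z (pmor \<delta>) (pmor \<gamma>) = pmor (\<gamma> \<cdot>\<^sub>p \<delta>)"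
  by (simp add: pmor_def Comp_single_path)

text \<open>The linear counterpart of
  \<open>\<rho> \<cdot>\<^sub>p \<gamma> \<cdot>\<^sub>p \<rho>'\<close>, the prolongation by which
  pixel equivalence compares paths with different ends.\<close>

definition sandwich ::
  "'x pth \<Rightarrow> ('x pth set \<Rightarrow>\<^sub>0 'k) \<Rightarrow> 'x pth \<Rightarrow> ('x pth set \<Rightarrow>\<^sub>0 'k::{comm_ring,comm_monoid_mult})" where
  "sandwich \<rho> f \<rho>' = Comp lin_C (\<rho> 0) (\<rho>' 0) (\<rho>' 1) (pmor \<rho>') (Comp lin_C (\<rho> 0) (\<rho> 1) (\<rho>' 0) f (pmor \<rho>))"

lemma sandwich_zero: "sandwich \<rho> 0 \<rho>' = 0"
  by (simp add: sandwich_def lin_Comp_zero)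

lemma sandwich_add: "sandwich \<rho> (f + g) \<rho>' = sandwich \<rho> f \<rho>' + sandwich \<rho> g \<rho>'"
  by (simp add: sandwich_def lin_Comp_add_left lin_Comp_add_right)

lemma sandwich_R: "(\<alpha>, \<alpha>') \<in> R \<Longrightarrow> (\<beta>, \<beta>') \<in> R \<Longrightarrow> sandwich \<alpha> f \<beta> = sandwich \<alpha>' f \<beta>'"
  using R_ends[of \<alpha> \<alpha>'] R_ends[of \<beta> \<beta>'] by (simp add: sandwich_def pmor_R[of \<alpha> \<alpha>'] pmor_R[of \<beta> \<beta>'])

lemma sandwich_single:
  assumes "\<rho> \<in> \<Gamma>" "\<gamma> \<in> \<Gamma>" "\<rho>' \<in> \<Gamma>" "\<rho> 1 = \<gamma> 0" "\<gamma> 1 = \<rho>' 0"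
  shows "sandwich \<rho> (Poly_Mapping.single (R `` {\<gamma>}) c) \<rho>' = Poly_Mapping.single (R `` {\<rho> \<cdot>\<^sub>p \<gamma> \<cdot>\<^sub>p \<rho>'}) c"
  using assms by (simp add: sandwich_def pmor_def Comp_single_path concat_in)

lemma sandwich_scale:
  assumes "\<rho> \<in> \<Gamma>" "\<rho>' \<in> \<Gamma>" "f \<in> Hom lin_C (\<rho> 1) (\<rho>' 0)"
  shows "sandwich \<rho> (Poly_Mapping.map ((*) c) f) \<rho>' = Poly_Mapping.map ((*) c) (sandwich \<rho> f \<rho>')"
proof -
  interpret L: lin_category "lin_C :: ('x, 'x pth set \<Rightarrow>\<^sub>0 'a, 'a) lincat" by (rule lin_category_lin_C)
  show ?thesis
    using assms L.Comp_scale_left[of "\<rho> 0" "\<rho> 1" "\<rho>' 0" "pmor \<rho>" f c]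
      pmor_in[OF assms(1), where 'a = 'a] pmor_in[OF assms(2), where 'a = 'a]
      L.Comp_scale_right[of "\<rho> 0" "\<rho>' 0" "\<rho>' 1" "Comp lin_C (\<rho> 0) (\<rho> 1) (\<rho>' 0) f (pmor \<rho>)" "pmor \<rho>'" c]
      L.Comp_in[of "\<rho> 0" "\<rho> 1" "\<rho>' 0" "pmor \<rho>" f] ends_in[OF assms(1)] ends_in[OF assms(2)]
    unfolding sandwich_def by simp
qed

text \<open>Allows a prolongation that already lies in an ideal to be lengthened further without
  leaving it.\<close>

lemma sandwich_sandwich:
  assumes "\<alpha> \<in> \<Gamma>" "\<rho> \<in> \<Gamma>" "\<rho>' \<in> \<Gamma>" "\<beta> \<in> \<Gamma>" "\<alpha> 1 = \<rho> 0" "\<rho>' 1 = \<beta> 0" "f \<in> Hom lin_C (\<rho> 1) (\<rho>' 0)"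
  shows "sandwich (\<alpha> \<cdot>\<^sub>p \<rho>) f (\<rho>' \<cdot>\<^sub>p \<beta>) = sandwich \<alpha> (sandwich \<rho> f \<rho>') \<beta>"
proof -
  interpret L: lin_category "lin_C :: ('x, 'x pth set \<Rightarrow>\<^sub>0 'a, 'a) lincat" by (rule lin_category_lin_C)
  define w u x y v t where "w = \<alpha> 0" "u = \<rho> 0" "x = \<rho> 1" "y = \<rho>' 0" "v = \<rho>' 1" "t = \<beta> 1"
  note defs = w_u_x_y_v_t_def
  have o: "w \<in> Obj lin_C" "u \<in> Obj lin_C" "x \<in> Obj lin_C" "y \<in> Obj lin_C" "v \<in> Obj lin_C" "t \<in> Obj lin_C"
    using assms by (auto simp: defs ends_in(1) ends_in(2))
  have h: "pmor \<alpha> \<in> Hom lin_C w u" "pmor \<rho> \<in> Hom lin_C u x" "f \<in> Hom lin_C x y" "pmor \<rho>' \<in> Hom lin_C y v"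
    "pmor \<beta> \<in> Hom lin_C v t"
    using pmor_in[OF assms(1)] pmor_in[OF assms(2)] pmor_in[OF assms(3)] pmor_in[OF assms(4)] assms(5-7)
    by (simp_all add: defs)
  note in_simps = o h L.Comp_in
  have "sandwich (\<alpha> \<cdot>\<^sub>p \<rho>) f (\<rho>' \<cdot>\<^sub>p \<beta>) = Comp lin_C w y t (Comp lin_C y v t (pmor \<beta>) (pmor \<rho>'))
      (Comp lin_C w x y f (Comp lin_C w u x (pmor \<rho>) (pmor \<alpha>)))"
    using assms by (simp add: sandwich_def Comp_pmor defs)
  also have "Comp lin_C w x y f (Comp lin_C w u x (pmor \<rho>) (pmor \<alpha>))
      = Comp lin_C w u y (Comp lin_C u x y f (pmor \<rho>)) (pmor \<alpha>)"
    by (intro L.Comp_assoc in_simps)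
  also have "Comp lin_C w y t (Comp lin_C y v t (pmor \<beta>) (pmor \<rho>')) \<dots>
      = Comp lin_C w v t (pmor \<beta>) (Comp lin_C w y v (pmor \<rho>') (Comp lin_C w u y (Comp lin_C u x y f (pmor \<rho>)) (pmor \<alpha>)))"
    by (intro L.Comp_assoc[symmetric] in_simps)
  also have "Comp lin_C w y v (pmor \<rho>') (Comp lin_C w u y (Comp lin_C u x y f (pmor \<rho>)) (pmor \<alpha>))
      = Comp lin_C w u v (Comp lin_C u y v (pmor \<rho>') (Comp lin_C u x y f (pmor \<rho>))) (pmor \<alpha>)"
    by (intro L.Comp_assoc in_simps)
  finally show ?thesis using assms(5,6) by (simp add: sandwich_def defs)
qed

lemma path_sum_Suc: "path_sum R (Suc n) c \<gamma> = path_sum R n c \<gamma> + Poly_Mapping.single (R `` {\<gamma> n}) (c n)"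
  by (simp add: path_sum_def)

lemma sandwich_path_sum:
  assumes "\<And>i. i < n \<Longrightarrow> \<gamma> i \<in> \<Gamma> \<and> \<gamma> i 0 = \<rho> 1 \<and> \<gamma> i 1 = \<rho>' 0" "\<rho> \<in> \<Gamma>" "\<rho>' \<in> \<Gamma>"
  shows "sandwich \<rho> (path_sum R n c \<gamma>) \<rho>' = (\<Sum>i<n. Poly_Mapping.single (R `` {\<rho> \<cdot>\<^sub>p \<gamma> i \<cdot>\<^sub>p \<rho>'}) (c i))"
  using assms(1)
proof (induction n)
  case 0
  then show ?case by (simp add: path_sum_def sandwich_zero)
next
  case (Suc n)
  then have "\<gamma> n \<in> \<Gamma>" "\<gamma> n 0 = \<rho> 1" "\<gamma> n 1 = \<rho>' 0" by simp_all
  with Suc assms(2,3) show ?case by (simp add: path_sum_Suc sandwich_add sandwich_single)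
qed

end

section \<open>An ideal that contains the closure under pixel equivalence\<close>

locale lin_screen = screen X \<Gamma> R P
  for X :: "'x set" and \<Gamma> R P +
  fixes I :: "('x, 'k::{comm_ring,comm_monoid_mult}) path_ideal"
  assumes ideal_I: "lin_ideal (lin_path_cat X \<Gamma> R) I"
begin

sublocale lin_C: lin_category "lin_C :: ('x, 'x pth set \<Rightarrow>\<^sub>0 'k, 'k) lincat"
  by (rule lin_category_lin_C)

sublocale QI: quotient_lin_category "lin_C0 :: ('x option, 'x pth set \<Rightarrow>\<^sub>0 'k, 'k) lincat" I
  by (intro quotient_lin_category.intro quotient_lin_category_axioms.intro lin_category_lin_C0 ideal_I)

lemma Some_in: "x \<in> X \<Longrightarrow> Some x \<in> Obj lin_C0"
  and None_in: "None \<in> Obj lin_C0"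
  by (simp_all add: Obj_lin_C0)

lemma I_sandwich:
  assumes "\<rho> \<in> \<Gamma>" "\<rho>' \<in> \<Gamma>" "f \<in> I (Some (\<rho> 1)) (Some (\<rho>' 0))"
  shows "sandwich \<rho> f \<rho>' \<in> I (Some (\<rho> 0)) (Some (\<rho>' 1))"
proof -
  have o: "Some (\<rho> 0) \<in> Obj lin_C0" "Some (\<rho> 1) \<in> Obj lin_C0" "Some (\<rho>' 0) \<in> Obj lin_C0" "Some (\<rho>' 1) \<in> Obj lin_C0"
    using assms by (simp_all add: Some_in ends_in(1) ends_in(2))
  have "Comp lin_C0 (Some (\<rho> 0)) (Some (\<rho> 1)) (Some (\<rho>' 0)) f (pmor \<rho>) \<in> I (Some (\<rho> 0)) (Some (\<rho>' 0))"
    using o assms pmor_in[OF assms(1), where 'a = 'k] by (intro QI.I_Comp_right) simp_all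
  then have "Comp lin_C0 (Some (\<rho> 0)) (Some (\<rho>' 0)) (Some (\<rho>' 1)) (pmor \<rho>')
      (Comp lin_C0 (Some (\<rho> 0)) (Some (\<rho> 1)) (Some (\<rho>' 0)) f (pmor \<rho>)) \<in> I (Some (\<rho> 0)) (Some (\<rho>' 1))"
    using o assms pmor_in[OF assms(2), where 'a = 'k]
    by - (rule QI.I_Comp_left[where y = "Some (\<rho>' 0)"], simp_all)
  then show ?thesis by (simp add: sandwich_def)
qed

text \<open>
  This is an ideal by (S3), and it contains the generators of the ideal closure. So if the class of a
  path in a pixel lies in the closure of \<open>I\<close>, then some path in the same pixel has its class in \<open>I\<close>,
  and the pixel is pre-dead: outside pre-dead pixels no path becomes zero.
\<close>

definition saturation :: "('x, 'k) path_ideal" where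
  "saturation u v = {f \<in> Hom lin_C0 u v. \<forall>x y. u = Some x \<longrightarrow> v = Some y \<longrightarrow>
     (\<exists>w t p q. pixel_arrow \<Gamma> (pix x) w x p \<and> pixel_arrow \<Gamma> (pix y) y t q \<and>
        sandwich p f q \<in> I (Some w) (Some t))}"

lemma saturation_SomeI:
  assumes "f \<in> Hom lin_C x y" "pixel_arrow \<Gamma> (pix x) w x p" "pixel_arrow \<Gamma> (pix y) y t q"
    and "sandwich p f q \<in> I (Some w) (Some t)"
  shows "f \<in> saturation (Some x) (Some y)"
  unfolding saturation_def using assms by auto

lemma saturation_SomeE:
  assumes "f \<in> saturation (Some x) (Some y)"
  obtains w t p q where "f \<in> Hom lin_C x y" "pixel_arrow \<Gamma> (pix x) w x p" "pixel_arrow \<Gamma> (pix y) y t q"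
    "sandwich p f q \<in> I (Some w) (Some t)"
  using assms unfolding saturation_def by auto

lemma saturation_zero: "x \<in> X \<Longrightarrow> y \<in> X \<Longrightarrow> 0 \<in> saturation (Some x) (Some y)"
  using pixel_arrow_const[of "pix x" x] pixel_arrow_const[of "pix y" y] pix[of x] pix[of y]
    QI.I_zero[of "Some x" "Some y"]
  by (intro saturation_SomeI[of 0 x y x "const_path x" y "const_path y"])
    (auto simp: sandwich_zero Some_in)

text \<open>The two summands come with different prolongations. A completed cospan at the source and
  a completed span at the target lengthen them to common ends, where (S1) makes them
  equivalent.\<close>

lemma saturation_add:
  assumes "x \<in> X" "y \<in> X" "f \<in> saturation (Some x) (Some y)" "g \<in> saturation (Some x) (Some y)"
  shows "f + g \<in> saturation (Some x) (Some y)"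
proof -
  obtain w t p q where 1: "f \<in> Hom lin_C x y" "pixel_arrow \<Gamma> (pix x) w x p" "pixel_arrow \<Gamma> (pix y) y t q"
    "sandwich p f q \<in> I (Some w) (Some t)" using assms(3) by (rule saturation_SomeE)
  obtain w' t' p' q' where 2: "g \<in> Hom lin_C x y" "pixel_arrow \<Gamma> (pix x) w' x p'" "pixel_arrow \<Gamma> (pix y) y t' q'"
    "sandwich p' g q' \<in> I (Some w') (Some t')" using assms(4) by (rule saturation_SomeE)
  have P: "pix x \<in> P" "pix y \<in> P" using pix assms by auto
  obtain u \<alpha> \<alpha>' where u: "pixel_arrow \<Gamma> (pix x) u w \<alpha>" "pixel_arrow \<Gamma> (pix x) u w' \<alpha>'"
    using cospan_completion[OF P(1) 1(2) 2(2)] by blast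
  obtain v \<beta> \<beta>' where v: "pixel_arrow \<Gamma> (pix y) t v \<beta>" "pixel_arrow \<Gamma> (pix y) t' v \<beta>'"
    using span_completion[OF P(2) 1(3) 2(3)] by blast
  note arrows = 1(2,3) 2(2,3) u v
  have "sandwich (\<alpha> \<cdot>\<^sub>p p) f (q \<cdot>\<^sub>p \<beta>) \<in> I (Some u) (Some v)"
    using I_sandwich[of \<alpha> \<beta> "sandwich p f q"] 1 arrows sandwich_sandwich[of \<alpha> p q \<beta> f]
    by (simp add: pixel_arrow_def)
  moreover have "sandwich (\<alpha> \<cdot>\<^sub>p p) g (q \<cdot>\<^sub>p \<beta>) = sandwich (\<alpha>' \<cdot>\<^sub>p p') g (q' \<cdot>\<^sub>p \<beta>')"
    by (rule sandwich_R[OF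
          pixel_arrow_unique[OF P(1) pixel_arrow_concat[OF u(1) 1(2)] pixel_arrow_concat[OF u(2) 2(2)]]
          pixel_arrow_unique[OF P(2) pixel_arrow_concat[OF 1(3) v(1)] pixel_arrow_concat[OF 2(3) v(2)]]])
  moreover have "sandwich (\<alpha>' \<cdot>\<^sub>p p') g (q' \<cdot>\<^sub>p \<beta>') \<in> I (Some u) (Some v)"
    using I_sandwich[of \<alpha>' \<beta>' "sandwich p' g q'"] 2 arrows sandwich_sandwich[of \<alpha>' p' q' \<beta>' g]
    by (simp add: pixel_arrow_def)
  ultimately have "sandwich (\<alpha> \<cdot>\<^sub>p p) (f + g) (q \<cdot>\<^sub>p \<beta>) \<in> I (Some u) (Some v)"
    using QI.I_add[of "Some u" "Some v"] pixel_arrow_in[OF u(1)] pixel_arrow_in[OF v(1)] P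
    by (simp add: sandwich_add Some_in pixel_in_X)
  moreover have "f + g \<in> Hom lin_C x y" using 1(1) 2(1) by (simp add: keys_add_subset)
  ultimately show ?thesis
    using arrows by (intro saturation_SomeI[OF _ pixel_arrow_concat pixel_arrow_concat])
qed

lemma saturation_scale:
  assumes "x \<in> X" "y \<in> X" "f \<in> saturation (Some x) (Some y)"
  shows "Poly_Mapping.map ((*) c) f \<in> saturation (Some x) (Some y)"
  using assms(3)
proof (rule saturation_SomeE)
  fix w t p q assume 1: "f \<in> Hom lin_C x y" "pixel_arrow \<Gamma> (pix x) w x p" "pixel_arrow \<Gamma> (pix y) y t q"
    "sandwich p f q \<in> I (Some w) (Some t)"
  have "w \<in> X" "t \<in> X" using 1 by (auto simp: pixel_arrow_def intro: ends_in)
  then have "sandwich p (Poly_Mapping.map ((*) c) f) q \<in> I (Some w) (Some t)"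
    using sandwich_scale[of p q f c] QI.I_scale[of "Some w" "Some t" _ c] 1
    by (simp add: pixel_arrow_def Some_in)
  with 1 show ?thesis
    by (intro saturation_SomeI[of _ x y w p t q]) (simp_all add: subset_trans[OF keys_map_mult])
qed

text \<open>Additivity reduces \<open>g\<close> to a multiple of one path \<open>\<gamma>\<close>.
  (S3) then moves the prolongation \<open>q\<close> past it: \<open>\<gamma>\<close> followed by
  \<open>q'\<close> is equivalent to \<open>q\<close> followed by \<open>\<gamma>'\<close>. So the
  prolonged composite is a multiple of \<open>\<gamma>'\<close> after the prolonged
  \<open>f\<close>, and the ideal absorbs it.\<close>

lemma saturation_Comp_left:
  assumes o: "x \<in> X" "y \<in> X" "z \<in> X" and f: "f \<in> saturation (Some x) (Some y)" and "g \<in> Hom lin_C y z"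
  shows "Comp lin_C x y z g f \<in> saturation (Some x) (Some z)"
proof -
  have "Poly_Mapping.keys g \<subseteq> Hom C y z" using assms(5) by simp
  then show ?thesis
  proof (induction g rule: keys_subset_induct)
    case zero
    then show ?case using o by (simp add: lin_Comp_zero saturation_zero)
  next
    case (add g g')
    then show ?case using o by (simp add: lin_Comp_add_left saturation_add)
  next
    case (single F c)
    then obtain \<gamma> where \<gamma>: "\<gamma> \<in> \<Gamma>" "\<gamma> 0 = y" "\<gamma> 1 = z" "F = R `` {\<gamma>}" by (rule Hom_C_cases)
    obtain w t p q where 1: "f \<in> Hom lin_C x y" "pixel_arrow \<Gamma> (pix x) w x p" "pixel_arrow \<Gamma> (pix y) y t q"
      "sandwich p f q \<in> I (Some w) (Some t)" using f by (rule saturation_SomeE)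
    have "in_pixel P q" using 1(3) pix[OF o(2)] by (auto simp: in_pixel_def pixel_arrow_def)
    then obtain q' \<gamma>' where *: "q' \<in> \<Gamma>" "\<gamma>' \<in> \<Gamma>" "in_pixel P q'" "z = q' 0" "t = \<gamma>' 0" "(\<gamma> \<cdot>\<^sub>p q', q \<cdot>\<^sub>p \<gamma>') \<in> R"
      using S3[of q \<gamma>] 1(3) \<gamma> by (auto simp: pixel_arrow_def)
    have "im q' \<subseteq> pix z"
      using *(3,4) ends_in_im(1)[of q'] pix_eqI by (auto simp: in_pixel_def)
    then have q': "pixel_arrow \<Gamma> (pix z) z (q' 1) q'" using * by (simp add: pixel_arrow_def)
    let ?g = "Poly_Mapping.single F c :: 'x pth set \<Rightarrow>\<^sub>0 'k"
    have p: "p \<in> \<Gamma>" "p 0 = w" "p 1 = x" and q: "q \<in> \<Gamma>" "q 0 = y" "q 1 = t"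
      using 1 by (auto simp: pixel_arrow_def)
    define f' where "f' = Comp lin_C w x y f (pmor p)"
    have wX: "w \<in> X" "t \<in> X" "q' 1 \<in> X" using p q * ends_in by auto
    have f': "f' \<in> Hom lin_C w y"
      unfolding f'_def using 1(1) pmor_in[OF p(1), where 'a = 'k] p o wX by (intro lin_C.Comp_in) simp_all
    have g: "?g \<in> Hom lin_C y z" using single by simp
    \<comment> \<open>Both composites are multiples by \<open>c\<close> of a single path, which is
      the form in which the equivalent paths can be exchanged.\<close>
    have cr: "Comp lin_C y z (q' 1) (pmor q') ?g = Poly_Mapping.map ((*) c) (pmor (\<gamma> \<cdot>\<^sub>p q'))"
      "Poly_Mapping.map ((*) c) (pmor (q \<cdot>\<^sub>p \<gamma>')) = Comp lin_C y t (q' 1) (Poly_Mapping.single (R `` {\<gamma>'}) c) (pmor q)"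
      using \<gamma> * q by (simp_all add: pmor_def Comp_single_path)
    have g': "Poly_Mapping.single (R `` {\<gamma>'}) c \<in> Hom lin_C t (q' 1)"
      using cls_in_C[OF *(2)] *(5) R_ends[OF *(6)] by simp
    have "sandwich p (Comp lin_C x y z ?g f) q' = Comp lin_C w z (q' 1) (pmor q') (Comp lin_C w x z (Comp lin_C x y z ?g f) (pmor p))"
      using p * by (simp add: sandwich_def)
    also have "Comp lin_C w x z (Comp lin_C x y z ?g f) (pmor p) = Comp lin_C w y z ?g f'"
      unfolding f'_def using 1(1) g pmor_in[OF p(1), where 'a = 'k] p o wX
      by (intro lin_C.Comp_assoc[symmetric]) simp_all
    also have "Comp lin_C w z (q' 1) (pmor q') (Comp lin_C w y z ?g f') = Comp lin_C w y (q' 1) (Comp lin_C y z (q' 1) (pmor q') ?g) f'"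
      using f' g pmor_in[OF *(1), where 'a = 'k] * o wX by (intro lin_C.Comp_assoc) simp_all
    also have "Comp lin_C y z (q' 1) (pmor q') ?g = Comp lin_C y t (q' 1) (Poly_Mapping.single (R `` {\<gamma>'}) c) (pmor q)"
      using cr pmor_R[OF *(6), where 'a = 'k] by simp
    also have "Comp lin_C w y (q' 1) \<dots> f' = Comp lin_C w t (q' 1) (Poly_Mapping.single (R `` {\<gamma>'}) c) (Comp lin_C w y t (pmor q) f')"
      using f' g' pmor_in[OF q(1), where 'a = 'k] q o wX by (intro lin_C.Comp_assoc[symmetric]) simp_all
    also have "Comp lin_C w y t (pmor q) f' = sandwich p f q"
      using p q by (simp add: sandwich_def f'_def)
    finally have "sandwich p (Comp lin_C x y z ?g f) q' \<in> I (Some w) (Some (q' 1))"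
      using QI.I_Comp_left[of "Some w" "Some t" "Some (q' 1)" "sandwich p f q"] 1(4) g' wX by (simp add: Some_in)
    moreover have "Comp lin_C x y z ?g f \<in> Hom lin_C x z"
      using 1(1) g o by (intro lin_C.Comp_in) simp_all
    ultimately show ?case using 1(2) q' by (intro saturation_SomeI)
  qed
qed

text \<open>The mirror argument: the dual half of (S3) moves the prolongation at the source of
  \<open>g\<close> backwards past the path in front of it.\<close>

lemma saturation_Comp_right:
  assumes o: "x \<in> X" "y \<in> X" "z \<in> X" and "f \<in> Hom lin_C x y" and g: "g \<in> saturation (Some y) (Some z)"
  shows "Comp lin_C x y z g f \<in> saturation (Some x) (Some z)"
proof -
  have "Poly_Mapping.keys f \<subseteq> Hom C x y" using assms(4) by simp
  then show ?thesis
  proof (induction f rule: keys_subset_induct)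
    case zero
    then show ?case using o by (simp add: lin_Comp_zero saturation_zero)
  next
    case (add f f')
    then show ?case using o by (simp add: lin_Comp_add_right saturation_add)
  next
    case (single F c)
    then obtain \<gamma> where \<gamma>: "\<gamma> \<in> \<Gamma>" "\<gamma> 0 = x" "\<gamma> 1 = y" "F = R `` {\<gamma>}" by (rule Hom_C_cases)
    obtain w t p q where 1: "g \<in> Hom lin_C y z" "pixel_arrow \<Gamma> (pix y) w y p" "pixel_arrow \<Gamma> (pix z) z t q"
      "sandwich p g q \<in> I (Some w) (Some t)" using g by (rule saturation_SomeE)
    have "in_pixel P p" using 1(2) pix[OF o(2)] by (auto simp: in_pixel_def pixel_arrow_def)
    then obtain p' \<gamma>' where *: "p' \<in> \<Gamma>" "\<gamma>' \<in> \<Gamma>" "in_pixel P p'" "\<gamma>' 1 = w" "p' 1 = x" "(\<gamma>' \<cdot>\<^sub>p p, p' \<cdot>\<^sub>p \<gamma>) \<in> R"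
      using S3_dual[of p \<gamma>] 1(2) \<gamma> by (auto simp: pixel_arrow_def)
    have "im p' \<subseteq> pix x"
      using *(3,5) ends_in_im(2)[of p'] pix_eqI by (auto simp: in_pixel_def)
    then have p': "pixel_arrow \<Gamma> (pix x) (p' 0) x p'" using * by (simp add: pixel_arrow_def)
    let ?f = "Poly_Mapping.single F c :: 'x pth set \<Rightarrow>\<^sub>0 'k" and ?u = "p' 0"
    let ?f' = "Poly_Mapping.single (R `` {\<gamma>'}) c :: 'x pth set \<Rightarrow>\<^sub>0 'k"
    have p: "p \<in> \<Gamma>" "p 0 = w" "p 1 = y" and q: "q \<in> \<Gamma>" "q 0 = z" "q 1 = t"
      using 1 by (auto simp: pixel_arrow_def)
    have wX: "w \<in> X" "t \<in> X" "?u \<in> X" using p q * ends_in by auto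
    have f: "?f \<in> Hom lin_C x y" using single by simp
    have f': "?f' \<in> Hom lin_C ?u w"
      using cls_in_C[OF *(2)] *(4) R_ends[OF *(6)] by simp
    note pm = pmor_in[OF p(1), where 'a = 'k] pmor_in[OF q(1), where 'a = 'k] pmor_in[OF *(1), where 'a = 'k]
    have "Comp lin_C ?u x y ?f (pmor p') = Poly_Mapping.map ((*) c) (pmor (p' \<cdot>\<^sub>p \<gamma>))"
      "Poly_Mapping.map ((*) c) (pmor (\<gamma>' \<cdot>\<^sub>p p)) = Comp lin_C ?u w y (pmor p) ?f'"
      using \<gamma> * p by (simp_all add: pmor_def Comp_single_path)
    then have cr: "Comp lin_C ?u x y ?f (pmor p') = Comp lin_C ?u w y (pmor p) ?f'"
      using pmor_R[OF *(6), where 'a = 'k] by simp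
    have "sandwich p' (Comp lin_C x y z g ?f) q = Comp lin_C ?u z t (pmor q) (Comp lin_C ?u x z (Comp lin_C x y z g ?f) (pmor p'))"
      using q * by (simp add: sandwich_def)
    also have "Comp lin_C ?u x z (Comp lin_C x y z g ?f) (pmor p') = Comp lin_C ?u y z g (Comp lin_C ?u x y ?f (pmor p'))"
      using 1(1) f pm * o wX by (intro lin_C.Comp_assoc[symmetric]) simp_all
    also have "\<dots> = Comp lin_C ?u w z (Comp lin_C w y z g (pmor p)) ?f'"
      unfolding cr using 1(1) f' pm p o wX by (intro lin_C.Comp_assoc) simp_all
    also have "Comp lin_C ?u z t (pmor q) \<dots> = Comp lin_C ?u w t (Comp lin_C w z t (pmor q) (Comp lin_C w y z g (pmor p))) ?f'"
      using 1(1) f' pm p q o wX lin_C.Comp_in[of w y z "pmor p" g] by (intro lin_C.Comp_assoc) simp_all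
    also have "Comp lin_C w z t (pmor q) (Comp lin_C w y z g (pmor p)) = sandwich p g q"
      using p q by (simp add: sandwich_def)
    finally have "sandwich p' (Comp lin_C x y z g ?f) q \<in> I (Some ?u) (Some t)"
      using QI.I_Comp_right[of "Some ?u" "Some w" "Some t" ?f' "sandwich p g q"] 1(4) f' wX by (simp add: Some_in)
    moreover have "Comp lin_C x y z g ?f \<in> Hom lin_C x z"
      using 1(1) f o by (intro lin_C.Comp_in) simp_all
    ultimately show ?case using 1(3) p' by (intro saturation_SomeI)
  qed
qed

text \<open>At \<open>None\<close> the condition on prolongations is vacuous, but the hom-set has
  only one element.\<close>

lemma saturation_None: "saturation None v = {0}" "saturation u None = {0}"
  by (auto simp: saturation_def)

lemma lin_ideal_saturation: "lin_ideal lin_C0 saturation"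
  unfolding lin_ideal_def
proof (intro conjI ballI allI)
  fix u v :: "'x option" assume o: "u \<in> Obj lin_C0" "v \<in> Obj lin_C0"
  show "saturation u v \<subseteq> Hom lin_C0 u v" by (auto simp: saturation_def)
  show "HZero lin_C0 u v \<in> saturation u v"
    using o by (auto simp: Obj_lin_C0 saturation_None saturation_zero)
  fix f assume f: "f \<in> saturation u v"
  show "HScale lin_C0 u v c f \<in> saturation u v" for c
    using o f by (auto simp: Obj_lin_C0 saturation_None saturation_scale)
  fix g assume "g \<in> saturation u v"
  with f o show "HAdd lin_C0 u v f g \<in> saturation u v"
    by (auto simp: Obj_lin_C0 saturation_None saturation_add)
next
  fix u v w :: "'x option" and f g :: "'x pth set \<Rightarrow>\<^sub>0 'k"
  assume o: "u \<in> Obj lin_C0" "v \<in> Obj lin_C0" "w \<in> Obj lin_C0"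
  show "Comp lin_C0 u v w g f \<in> saturation u w" if "f \<in> saturation u v" "g \<in> Hom lin_C0 v w"
    using o that by (cases u; cases v; cases w)
      (auto simp: Obj_lin_C0 saturation_None saturation_zero saturation_Comp_left)
  show "Comp lin_C0 u v w g f \<in> saturation u w" if "f \<in> Hom lin_C0 u v" "g \<in> saturation v w"
    using o that by (cases u; cases v; cases w)
      (auto simp: Obj_lin_C0 saturation_None saturation_zero saturation_Comp_right)
qed

text \<open>The equivalence of the prolonged paths forces their outer ends to coincide, and the two
  anonymous pixels are those of the ends of \<open>\<gamma>\<close>.\<close>

lemma pixel_equiv_D:
  assumes "pixel_equiv \<Gamma> R P \<gamma> \<gamma>'" "\<gamma> \<in> \<Gamma>" "\<gamma>' \<in> \<Gamma>"
  obtains u t \<rho>1 \<rho>2 \<rho>3 \<rho>4 where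
    "pixel_arrow \<Gamma> (pix (\<gamma> 0)) u (\<gamma> 0) \<rho>1" "pixel_arrow \<Gamma> (pix (\<gamma> 0)) u (\<gamma>' 0) \<rho>2"
    "pixel_arrow \<Gamma> (pix (\<gamma> 1)) (\<gamma> 1) t \<rho>3" "pixel_arrow \<Gamma> (pix (\<gamma> 1)) (\<gamma>' 1) t \<rho>4"
    "(\<rho>1 \<cdot>\<^sub>p \<gamma> \<cdot>\<^sub>p \<rho>3, \<rho>2 \<cdot>\<^sub>p \<gamma>' \<cdot>\<^sub>p \<rho>4) \<in> R"
proof -
  from assms(1) obtain \<rho>1 \<rho>2 \<rho>3 \<rho>4 A B where *: "\<rho>1 \<in> \<Gamma>" "\<rho>2 \<in> \<Gamma>" "\<rho>3 \<in> \<Gamma>" "\<rho>4 \<in> \<Gamma>"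
    "A \<in> P" "im \<rho>1 \<union> im \<rho>2 \<subseteq> A" "B \<in> P" "im \<rho>3 \<union> im \<rho>4 \<subseteq> B"
    "\<rho>1 1 = \<gamma> 0" "\<gamma> 1 = \<rho>3 0" "\<rho>2 1 = \<gamma>' 0" "\<gamma>' 1 = \<rho>4 0" "(\<rho>1 \<cdot>\<^sub>p \<gamma> \<cdot>\<^sub>p \<rho>3, \<rho>2 \<cdot>\<^sub>p \<gamma>' \<cdot>\<^sub>p \<rho>4) \<in> R"
    unfolding pixel_equiv_def by blast
  have "pix (\<gamma> 0) = A" using * ends_in_im(2)[of \<rho>1] by (intro pix_eqI) auto
  moreover have "pix (\<gamma> 1) = B" using * ends_in_im(1)[of \<rho>3] by (intro pix_eqI) auto
  moreover have "\<rho>2 0 = \<rho>1 0" "\<rho>4 1 = \<rho>3 1" using R_ends[OF *(13)] by simp_all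
  ultimately show thesis
    using * by (intro that[of "\<rho>1 0" \<rho>1 \<rho>2 "\<rho>3 1" \<rho>3 \<rho>4]) (auto simp: pixel_arrow_def)
qed

text \<open>Each pair of summands has its own prolongations, while the saturation requires one for
  the whole sum. A roof over all their starting points and a dual one under all their end points
  give common ends, and by (S1) the lengthened prolongations no longer depend on the
  summand.\<close>

lemma saturation_pixel_equiv:
  assumes o: "x \<in> X" "y \<in> X" "x' \<in> X" "y' \<in> X" and g: "g \<in> I (Some x') (Some y')"
    and equiv: "mor_pixel_equiv \<Gamma> R P x y f x' y' g"
  shows "f \<in> saturation (Some x) (Some y)"
proof -
  obtain n c \<gamma> \<gamma>' where f: "f = path_sum R n c \<gamma>" and g_eq: "g = path_sum R n c \<gamma>'"
    and paths: "\<forall>i<n. \<gamma> i \<in> \<Gamma> \<and> \<gamma> i 0 = x \<and> \<gamma> i 1 = y \<and> \<gamma>' i \<in> \<Gamma> \<and> \<gamma>' i 0 = x' \<and> \<gamma>' i 1 = y' \<and>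
      pixel_equiv \<Gamma> R P (\<gamma> i) (\<gamma>' i)"
    using equiv unfolding mor_pixel_equiv_def by blast
  show ?thesis
  \<comment> \<open>An empty sum offers no points over which to form a roof, but it is zero.\<close>
  proof (cases "n = 0")
    case True
    then show ?thesis using o by (simp add: f path_sum_def saturation_zero)
  next
    case False
    let ?A = "pix x" and ?B = "pix y"
    have P: "?A \<in> P" "?B \<in> P" using pix o by auto
    have "\<forall>i. \<exists>u t \<rho>1 \<rho>2 \<rho>3 \<rho>4. i < n \<longrightarrow>
        pixel_arrow \<Gamma> ?A u x \<rho>1 \<and> pixel_arrow \<Gamma> ?A u x' \<rho>2 \<and>
        pixel_arrow \<Gamma> ?B y t \<rho>3 \<and> pixel_arrow \<Gamma> ?B y' t \<rho>4 \<and> (\<rho>1 \<cdot>\<^sub>p \<gamma> i \<cdot>\<^sub>p \<rho>3, \<rho>2 \<cdot>\<^sub>p \<gamma>' i \<cdot>\<^sub>p \<rho>4) \<in> R"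
    proof
      fix i
      show "\<exists>u t \<rho>1 \<rho>2 \<rho>3 \<rho>4. i < n \<longrightarrow>
        pixel_arrow \<Gamma> ?A u x \<rho>1 \<and> pixel_arrow \<Gamma> ?A u x' \<rho>2 \<and>
        pixel_arrow \<Gamma> ?B y t \<rho>3 \<and> pixel_arrow \<Gamma> ?B y' t \<rho>4 \<and> (\<rho>1 \<cdot>\<^sub>p \<gamma> i \<cdot>\<^sub>p \<rho>3, \<rho>2 \<cdot>\<^sub>p \<gamma>' i \<cdot>\<^sub>p \<rho>4) \<in> R"
      proof (cases "i < n")
        case True
        with paths have i: "pixel_equiv \<Gamma> R P (\<gamma> i) (\<gamma>' i)" "\<gamma> i \<in> \<Gamma>" "\<gamma>' i \<in> \<Gamma>"
          and ends: "\<gamma> i 0 = x" "\<gamma> i 1 = y" "\<gamma>' i 0 = x'" "\<gamma>' i 1 = y'" by auto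
        obtain u t \<rho>1 \<rho>2 \<rho>3 \<rho>4 where
          "pixel_arrow \<Gamma> (pix (\<gamma> i 0)) u (\<gamma> i 0) \<rho>1" "pixel_arrow \<Gamma> (pix (\<gamma> i 0)) u (\<gamma>' i 0) \<rho>2"
          "pixel_arrow \<Gamma> (pix (\<gamma> i 1)) (\<gamma> i 1) t \<rho>3" "pixel_arrow \<Gamma> (pix (\<gamma> i 1)) (\<gamma>' i 1) t \<rho>4"
          "(\<rho>1 \<cdot>\<^sub>p \<gamma> i \<cdot>\<^sub>p \<rho>3, \<rho>2 \<cdot>\<^sub>p \<gamma>' i \<cdot>\<^sub>p \<rho>4) \<in> R"
          using i by (rule pixel_equiv_D)
        then show ?thesis unfolding ends by (intro exI impI conjI)
      qed simp
    qed
    then obtain u t \<rho>1 \<rho>2 \<rho>3 \<rho>4 where \<rho>: "\<And>i. i < n \<Longrightarrow>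
        pixel_arrow \<Gamma> ?A (u i) x (\<rho>1 i) \<and> pixel_arrow \<Gamma> ?A (u i) x' (\<rho>2 i) \<and>
        pixel_arrow \<Gamma> ?B y (t i) (\<rho>3 i) \<and> pixel_arrow \<Gamma> ?B y' (t i) (\<rho>4 i) \<and>
        (\<rho>1 i \<cdot>\<^sub>p \<gamma> i \<cdot>\<^sub>p \<rho>3 i, \<rho>2 i \<cdot>\<^sub>p \<gamma>' i \<cdot>\<^sub>p \<rho>4 i) \<in> R"
      by metis
    have "u ` {..<n} \<subseteq> ?A" "t ` {..<n} \<subseteq> ?B" using \<rho> pixel_arrow_in by fast+
    then obtain w v where w: "\<forall>a\<in>u ` {..<n}. \<exists>\<alpha>. pixel_arrow \<Gamma> ?A w a \<alpha>"
      and v: "\<forall>a\<in>t ` {..<n}. \<exists>\<beta>. pixel_arrow \<Gamma> ?B a v \<beta>"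
      using common_roof[OF P(1), of "u ` {..<n}"] common_coroof[OF P(2), of "t ` {..<n}"] False by auto
    have "\<forall>i<n. \<exists>\<alpha>. pixel_arrow \<Gamma> ?A w (u i) \<alpha>" "\<forall>i<n. \<exists>\<beta>. pixel_arrow \<Gamma> ?B (t i) v \<beta>"
      using w v by auto
    then obtain \<alpha> \<beta> where \<alpha>: "\<And>i. i < n \<Longrightarrow> pixel_arrow \<Gamma> ?A w (u i) (\<alpha> i)"
      and \<beta>: "\<And>i. i < n \<Longrightarrow> pixel_arrow \<Gamma> ?B (t i) v (\<beta> i)" by metis
    \<comment> \<open>The summand 0 exists because \<open>n\<close> is positive; its prolongations
      are taken for all summands.\<close>
    define p q p' q' where "p = \<alpha> 0 \<cdot>\<^sub>p \<rho>1 0" and "q = \<alpha> 0 \<cdot>\<^sub>p \<rho>2 0" and "p' = \<rho>3 0 \<cdot>\<^sub>p \<beta> 0" and "q' = \<rho>4 0 \<cdot>\<^sub>p \<beta> 0"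
    have pq: "pixel_arrow \<Gamma> ?A w x p" "pixel_arrow \<Gamma> ?A w x' q" "pixel_arrow \<Gamma> ?B y v p'" "pixel_arrow \<Gamma> ?B y' v q'"
      unfolding p_def q_def p'_def q'_def using False \<alpha>[of 0] \<beta>[of 0] \<rho>[of 0]
      by (blast intro: pixel_arrow_concat)+
    \<comment> \<open>(S1) exchanges the prolongations of summand 0 for those of summand
      \<open>i\<close>; after reassociation the given equivalence appears in the middle.\<close>
    have key: "R `` {p \<cdot>\<^sub>p \<gamma> i \<cdot>\<^sub>p p'} = R `` {q \<cdot>\<^sub>p \<gamma>' i \<cdot>\<^sub>p q'}" if i: "i < n" for i
    proof -
      have ar: "pixel_arrow \<Gamma> ?A (u i) x (\<rho>1 i)" "pixel_arrow \<Gamma> ?A (u i) x' (\<rho>2 i)"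
        "pixel_arrow \<Gamma> ?B y (t i) (\<rho>3 i)" "pixel_arrow \<Gamma> ?B y' (t i) (\<rho>4 i)"
        "pixel_arrow \<Gamma> ?A w (u i) (\<alpha> i)" "pixel_arrow \<Gamma> ?B (t i) v (\<beta> i)"
        and r: "(\<rho>1 i \<cdot>\<^sub>p \<gamma> i \<cdot>\<^sub>p \<rho>3 i, \<rho>2 i \<cdot>\<^sub>p \<gamma>' i \<cdot>\<^sub>p \<rho>4 i) \<in> R"
        using \<rho>[OF i] \<alpha>[OF i] \<beta>[OF i] by auto
      note ar_simps = ar[unfolded pixel_arrow_def]
      have g: "\<gamma> i \<in> \<Gamma>" "\<gamma> i 0 = x" "\<gamma> i 1 = y" "\<gamma>' i \<in> \<Gamma>" "\<gamma>' i 0 = x'" "\<gamma>' i 1 = y'"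
        using paths i by auto
      have "(p, \<alpha> i \<cdot>\<^sub>p \<rho>1 i) \<in> R" "(q, \<alpha> i \<cdot>\<^sub>p \<rho>2 i) \<in> R"
        using pixel_arrow_unique[OF P(1) pq(1) pixel_arrow_concat[OF ar(5,1)]]
          pixel_arrow_unique[OF P(1) pq(2) pixel_arrow_concat[OF ar(5,2)]] by auto
      moreover have "(p', \<rho>3 i \<cdot>\<^sub>p \<beta> i) \<in> R" "(q', \<rho>4 i \<cdot>\<^sub>p \<beta> i) \<in> R"
        using pixel_arrow_unique[OF P(2) pq(3) pixel_arrow_concat[OF ar(3,6)]]
          pixel_arrow_unique[OF P(2) pq(4) pixel_arrow_concat[OF ar(4,6)]] by auto
      ultimately have 1: "(p \<cdot>\<^sub>p \<gamma> i \<cdot>\<^sub>p p', (\<alpha> i \<cdot>\<^sub>p \<rho>1 i) \<cdot>\<^sub>p \<gamma> i \<cdot>\<^sub>p (\<rho>3 i \<cdot>\<^sub>p \<beta> i)) \<in> R"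
        and 4: "(q \<cdot>\<^sub>p \<gamma>' i \<cdot>\<^sub>p q', (\<alpha> i \<cdot>\<^sub>p \<rho>2 i) \<cdot>\<^sub>p \<gamma>' i \<cdot>\<^sub>p (\<rho>4 i \<cdot>\<^sub>p \<beta> i)) \<in> R"
        using g pq[unfolded pixel_arrow_def] R_refl[OF g(1)] R_refl[OF g(4)] by (auto intro!: R_concat)
      have 2: "((\<alpha> i \<cdot>\<^sub>p \<rho>1 i) \<cdot>\<^sub>p \<gamma> i \<cdot>\<^sub>p (\<rho>3 i \<cdot>\<^sub>p \<beta> i), \<alpha> i \<cdot>\<^sub>p (\<rho>1 i \<cdot>\<^sub>p \<gamma> i \<cdot>\<^sub>p \<rho>3 i) \<cdot>\<^sub>p \<beta> i) \<in> R"
        using ar_simps g by (intro R_sandwich_assoc) auto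
      have 3: "((\<alpha> i \<cdot>\<^sub>p \<rho>2 i) \<cdot>\<^sub>p \<gamma>' i \<cdot>\<^sub>p (\<rho>4 i \<cdot>\<^sub>p \<beta> i), \<alpha> i \<cdot>\<^sub>p (\<rho>2 i \<cdot>\<^sub>p \<gamma>' i \<cdot>\<^sub>p \<rho>4 i) \<cdot>\<^sub>p \<beta> i) \<in> R"
        using ar_simps g by (intro R_sandwich_assoc) auto
      have 5: "(\<alpha> i \<cdot>\<^sub>p (\<rho>1 i \<cdot>\<^sub>p \<gamma> i \<cdot>\<^sub>p \<rho>3 i) \<cdot>\<^sub>p \<beta> i, \<alpha> i \<cdot>\<^sub>p (\<rho>2 i \<cdot>\<^sub>p \<gamma>' i \<cdot>\<^sub>p \<rho>4 i) \<cdot>\<^sub>p \<beta> i) \<in> R"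
        using ar_simps by (intro R_concat_left R_concat_right r) auto
      show ?thesis
        by (rule cls_eq[OF R_trans[OF 1 R_trans[OF 2 R_trans[OF 5 R_sym[OF R_trans[OF 4 3]]]]]])
    qed
    have "sandwich p f p' = sandwich q g q'"
      using paths pq key by (simp add: f g_eq sandwich_path_sum pixel_arrow_def)
    moreover have "sandwich q g q' \<in> I (Some w) (Some v)"
      using I_sandwich[of q q' g] g pq by (simp add: pixel_arrow_def)
    moreover have "f \<in> Hom lin_C x y"
    proof -
      have "path_sum R m c \<gamma> \<in> Hom lin_C x y" if "m \<le> n" for m
        using that
      proof (induction m)
        case (Suc m)
        then have "R `` {\<gamma> m} \<in> Hom C x y" using paths cls_in_C[of "\<gamma> m"] by auto
        with Suc show ?case by (simp add: path_sum_Suc keys_add_subset)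
      qed (simp add: path_sum_def)
      then show ?thesis by (simp add: f)
    qed
    ultimately show ?thesis using pq by (intro saturation_SomeI[of f x y w p v p']) auto
  qed
qed

section \<open>The quotient by the ideal closure and its localization\<close>

abbreviation J :: "('x, 'k) path_ideal" where
  "J \<equiv> ideal_closure X \<Gamma> R P I"

lemma J_subset_saturation: "f \<in> J u v \<Longrightarrow> f \<in> saturation u v"
  unfolding ideal_closure_def
  by (erule generated_ideal_minimal[OF _ lin_ideal_saturation]) (auto intro: saturation_pixel_equiv)

sublocale QJ: quotient_lin_category "lin_C0 :: ('x option, 'x pth set \<Rightarrow>\<^sub>0 'k, 'k) lincat" J
  unfolding ideal_closure_def
  by (intro quotient_lin_category.intro quotient_lin_category_axioms.intro lin_category_lin_C0
      lin_ideal_generated_ideal)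

abbreviation B :: "('x option, ('x pth set \<Rightarrow>\<^sub>0 'k) set, 'k) lincat" where
  "B \<equiv> closure_quotient X \<Gamma> R P I"

lemma B_eq: "B = QJ.L"
  by (simp add: closure_quotient_def)

abbreviation qp :: "'x pth \<Rightarrow> ('x pth set \<Rightarrow>\<^sub>0 'k) set" where
  "qp \<equiv> quotient_path X \<Gamma> R J"

lemma qp_eq: "qp \<gamma> = QJ.cls (Some (\<gamma> 0)) (Some (\<gamma> 1)) (pmor \<gamma>)"
  by (simp add: quotient_path_def pmor_def)

lemma pre_dead_of_zero_path:
  assumes A: "A \<in> P" "pixel_arrow \<Gamma> A x y \<rho>" and zero: "qp \<rho> = HZero B (Some x) (Some y)"
  shows "pre_dead X \<Gamma> R P I A"
proof -
  have \<rho>: "\<rho> \<in> \<Gamma>" "\<rho> 0 = x" "\<rho> 1 = y" "x \<in> A" "y \<in> A"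
    using A(2) pixel_arrow_in[OF A(2)] by (auto simp: pixel_arrow_def)
  then have "pmor \<rho> \<in> J (Some x) (Some y)"
    using QJ.cls_eq_HZero_iff[of "Some x" "Some y" "pmor \<rho>"] zero pmor_in[OF \<rho>(1), where 'a = 'k] pixel_in_X[OF A(1)]
    by (simp add: qp_eq B_eq Some_in)
  then have "pmor \<rho> \<in> saturation (Some x) (Some y)" by (rule J_subset_saturation)
  then obtain w t p q where pq: "pixel_arrow \<Gamma> (pix x) w x p" "pixel_arrow \<Gamma> (pix y) y t q"
    and s: "sandwich p (pmor \<rho>) q \<in> I (Some w) (Some t)" by (rule saturation_SomeE)
  have "pix x = A" "pix y = A" using A(1) \<rho> pix_eqI by auto
  \<comment> \<open>The prolonged path is the witness for pre-deadness: it stays inside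
    \<open>A\<close>, and its class lies in \<open>I\<close> itself and not just in the
    closure.\<close>
  with pq A(2) have \<delta>: "pixel_arrow \<Gamma> A w t (p \<cdot>\<^sub>p \<rho> \<cdot>\<^sub>p q)" by (auto intro: pixel_arrow_concat)
  have "pmor (p \<cdot>\<^sub>p \<rho> \<cdot>\<^sub>p q) \<in> I (Some w) (Some t)"
    using s pq \<rho> sandwich_single[of p \<rho> q "1 :: 'k"] by (simp add: pmor_def pixel_arrow_def)
  then have "QI.cls (Some w) (Some t) (pmor (p \<cdot>\<^sub>p \<rho> \<cdot>\<^sub>p q)) = HZero QI.L (Some w) (Some t)"
    using \<delta> pixel_arrow_in[OF \<delta>] pixel_in_X[OF A(1)] pmor_in[of "p \<cdot>\<^sub>p \<rho> \<cdot>\<^sub>p q", where 'a = 'k]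
    by (subst QI.cls_eq_HZero_iff) (auto simp: Some_in pixel_arrow_def)
  then show ?thesis
    unfolding pre_dead_def quotient_path_def using A(1) \<delta>
    by (intro conjI bexI[of _ "p \<cdot>\<^sub>p \<rho> \<cdot>\<^sub>p q"]) (auto simp: pixel_arrow_def pmor_def)
qed

abbreviation \<Sigma>B :: "'x option \<Rightarrow> 'x option \<Rightarrow> ('x pth set \<Rightarrow>\<^sub>0 'k) set set" where
  "\<Sigma>B \<equiv> lin_pixel_mors X \<Gamma> R P I"

lemma qp_in: "\<gamma> \<in> \<Gamma> \<Longrightarrow> qp \<gamma> \<in> Hom B (Some (\<gamma> 0)) (Some (\<gamma> 1))"
  using pmor_in[of \<gamma>, where 'a = 'k] unfolding qp_eq B_eq QJ.L_simps
  by (intro QJ.cls_in) (simp_all add: Some_in ends_in(1) ends_in(2))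

lemma Obj_B [simp]: "Obj B = Obj (lin_C0 :: ('x option, 'x pth set \<Rightarrow>\<^sub>0 'k, 'k) lincat)"
  by (simp add: B_eq)

sublocale B: lin_category B
  unfolding B_eq by (rule QJ.lin_category_L)

lemma \<Sigma>B_cases:
  assumes "\<sigma> \<in> \<Sigma>B u v"
  obtains A x y \<rho> where "A \<in> P" "pixel_arrow \<Gamma> A x y \<rho>" "u = Some x" "v = Some y" "\<sigma> = qp \<rho>"
    | A x y where "pre_dead X \<Gamma> R P I A" "x \<in> A" "y \<in> A" "u = Some x" "v = Some y"
      "\<sigma> = HZero B (Some x) (Some y)"
  using assms unfolding lin_pixel_mors_def in_pixel_def pixel_arrow_def by blast

lemma pre_dead_in_P: "pre_dead X \<Gamma> R P I A \<Longrightarrow> A \<in> P"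
  by (simp add: pre_dead_def)

lemma \<Sigma>B_in:
  assumes "\<sigma> \<in> \<Sigma>B u v"
  shows "\<sigma> \<in> Hom B u v \<and> (\<exists>x\<in>X. u = Some x) \<and> (\<exists>y\<in>X. v = Some y)"
  using assms
proof (cases rule: \<Sigma>B_cases)
  case (1 A x y \<rho>)
  then show ?thesis
    using qp_in[of \<rho>] pixel_arrow_in[OF 1(2)] pixel_in_X[OF 1(1)] by (auto simp: pixel_arrow_def)
next
  case (2 A x y)
  then show ?thesis
    using pixel_in_X[OF pre_dead_in_P[OF 2(1)]] B.HZero_in[of "Some x" "Some y"] by (auto simp: Some_in)
qed

sublocale loc: lin_localizing B \<Sigma>B
  by unfold_locales (simp add: \<Sigma>B_in)

abbreviation D :: "('x option, ('x, 'k) lin_pixelation_mor, 'k) lincat" where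
  "D \<equiv> lin_pixelation X \<Gamma> R P I"

lemma D_eq: "D = loc.D"
  by (simp add: lin_pixelation_def)

sublocale D: lin_category D
  unfolding D_eq by (rule loc.D.lin_category_axioms)

lemma Obj_D [simp]: "Obj D = Obj (lin_C0 :: ('x option, 'x pth set \<Rightarrow>\<^sub>0 'k, 'k) lincat)"
  by (simp add: D_eq)

text \<open>Only nonzero path classes are inverted by definition; in a pixel that is not pre-dead,
  \<open>pre_dead_of_zero_path\<close> guarantees this for every path.\<close>

lemma qp_in_\<Sigma>B:
  assumes "A \<in> P" "\<not> pre_dead X \<Gamma> R P I A" "pixel_arrow \<Gamma> A x y \<rho>"
  shows "qp \<rho> \<in> \<Sigma>B (Some x) (Some y)"
proof -
  have \<rho>: "\<rho> \<in> \<Gamma>" "x = \<rho> 0" "y = \<rho> 1" "in_pixel P \<rho>"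
    using assms(1,3) by (auto simp: pixel_arrow_def in_pixel_def)
  have "qp \<rho> \<noteq> HZero B (Some x) (Some y)"
    using pre_dead_of_zero_path[OF assms(1,3)] assms(2) by blast
  then show ?thesis
    unfolding lin_pixel_mors_def using \<rho> by (intro UnI1 CollectI exI[of _ \<rho>] conjI) simp_all
qed

lemma zero_object_None: "D.zero_object None"
proof -
  have "Ident B None = HZero B None None"
    by (simp add: B_eq QJ.Ident_Q)
  then have "Ident D None = HZero D None None"
    using loc.lin_loc_mor_Ident[of None] loc.lin_loc_mor_zero[of None None] by (simp add: D_eq None_in)
  then show ?thesis by (simp add: D.zero_object_def None_in)
qed

text \<open>The zero endomorphism of \<open>x\<close> belongs to the inverted class, so the identity
  of \<open>x\<close> is a composite with zero.\<close>

lemma zero_object_pre_dead: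
  assumes A: "pre_dead X \<Gamma> R P I A" and x: "x \<in> A"
  shows "D.zero_object (Some x)"
proof -
  have o: "Some x \<in> Obj D" using pixel_in_X[OF pre_dead_in_P[OF A] x] by (simp add: Some_in)
  have "HZero B (Some x) (Some x) \<in> \<Sigma>B (Some x) (Some x)"
    using A x unfolding lin_pixel_mors_def by blast
  then have "inverse_mors D (Some x) (Some x) (HZero D (Some x) (Some x))
      (lin_loc_inv B \<Sigma>B (Some x) (Some x) (HZero B (Some x) (Some x)))"
    using loc.lin_loc_inverse[of "Some x" "Some x" "HZero B (Some x) (Some x)"]
      loc.lin_loc_mor_zero[of "Some x" "Some x"] o by (simp add: D_eq)
  then show ?thesis
    using o D.Comp_HZero_right[OF o o o] by (auto simp: inverse_mors_def D.zero_object_def)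
qed

abbreviation Lq :: "'x pth \<Rightarrow> ('x, 'k) lin_pixelation_mor" where
  "Lq \<gamma> \<equiv> lin_loc_mor B \<Sigma>B (Some (\<gamma> 0)) (Some (\<gamma> 1)) (qp \<gamma>)"

abbreviation good :: "'x set set" where
  "good \<equiv> {A \<in> P. \<not> pre_dead X \<Gamma> R P I A}"

sublocale can: pixel_functor X \<Gamma> R P D Some Lq good
proof (intro pixel_functor.intro pixel_functor_axioms.intro screen_axioms D.category_axioms)
  fix \<gamma> \<gamma>'
  show "Lq \<gamma> \<in> Hom D (Some (\<gamma> 0)) (Some (\<gamma> 1))" if "\<gamma> \<in> \<Gamma>"
    unfolding D_eq using that by (intro loc.lin_loc_mor_in qp_in) (simp_all add: Some_in ends_in(1) ends_in(2))
  show "Lq (\<gamma> \<cdot>\<^sub>p \<gamma>') = Comp D (Some (\<gamma> 0)) (Some (\<gamma>' 0)) (Some (\<gamma>' 1)) (Lq \<gamma>') (Lq \<gamma>)"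
    if g: "\<gamma> \<in> \<Gamma>" "\<gamma>' \<in> \<Gamma>" "\<gamma> 1 = \<gamma>' 0"
  proof -
    have o: "Some (\<gamma> 0) \<in> Obj lin_C0" "Some (\<gamma>' 0) \<in> Obj lin_C0" "Some (\<gamma>' 1) \<in> Obj lin_C0"
      using g by (simp_all add: Some_in ends_in(1) ends_in(2))
    have "qp (\<gamma> \<cdot>\<^sub>p \<gamma>') = Comp B (Some (\<gamma> 0)) (Some (\<gamma>' 0)) (Some (\<gamma>' 1)) (qp \<gamma>') (qp \<gamma>)"
      using QJ.Comp_Q[OF o, of "pmor \<gamma>" "pmor \<gamma>'"] g pmor_in[OF g(1), where 'a = 'k]
        pmor_in[OF g(2), where 'a = 'k]
      by (simp add: qp_eq B_eq Comp_pmor)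
    then show ?thesis
      unfolding D_eq using loc.lin_loc_mor_Comp[of "Some (\<gamma> 0)" "Some (\<gamma>' 0)" "Some (\<gamma>' 1)" "qp \<gamma>" "qp \<gamma>'"]
        qp_in[OF g(1)] qp_in[OF g(2)] o g by simp
  qed
next
  fix \<gamma> \<gamma>' assume "(\<gamma>, \<gamma>') \<in> R"
  then show "Lq \<gamma> = Lq \<gamma>'"
    using R_ends[of \<gamma> \<gamma>'] pmor_R[of \<gamma> \<gamma>', where 'a = 'k] by (simp add: qp_eq)
next
  fix x assume x: "x \<in> X"
  then show "Some x \<in> Obj D" by (simp add: Some_in)
  have "qp (const_path x) = Ident B (Some x)"
    by (simp add: qp_eq B_eq QJ.Ident_Q pmor_def Ident_C)
  then show "Lq (const_path x) = Ident D (Some x)"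
    using loc.lin_loc_mor_Ident[of "Some x"] x by (simp add: D_eq Some_in)
next
  fix A x y \<rho> assume A: "A \<in> good" and \<rho>: "pixel_arrow \<Gamma> A x y \<rho>"
  then have "inverse_mors D (Some x) (Some y) (lin_loc_mor B \<Sigma>B (Some x) (Some y) (qp \<rho>))
      (lin_loc_inv B \<Sigma>B (Some x) (Some y) (qp \<rho>))"
    unfolding D_eq using pixel_arrow_in[OF \<rho>] pixel_in_X[of A]
    by (intro loc.lin_loc_inverse qp_in_\<Sigma>B[of A]) (auto simp: Some_in)
  with \<rho> show "iso_mor D (Some x) (Some y) (Lq \<rho>)"
    by (auto simp: iso_mor_iff pixel_arrow_def)
qed simp

lemma lin_loc_inv_eq_can:
  assumes A: "A \<in> good" and \<rho>: "pixel_arrow \<Gamma> A x y \<rho>"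
  shows "lin_loc_inv B \<Sigma>B (Some x) (Some y) (qp \<rho>) = can.can y x"
proof -
  have xy: "x \<in> A" "y \<in> A" and o: "Some x \<in> Obj D" "Some y \<in> Obj D"
    using pixel_arrow_in[OF \<rho>] pixel_in_X[of A] A by (auto simp: Some_in)
  have "inverse_mors D (Some x) (Some y) (lin_loc_mor B \<Sigma>B (Some x) (Some y) (qp \<rho>))
      (lin_loc_inv B \<Sigma>B (Some x) (Some y) (qp \<rho>))"
    unfolding D_eq using A o \<rho> by (intro loc.lin_loc_inverse qp_in_\<Sigma>B[of A]) auto
  moreover have "lin_loc_mor B \<Sigma>B (Some x) (Some y) (qp \<rho>) = can.can x y"
    using can.can_arrow[OF A \<rho>] \<rho> by (simp add: pixel_arrow_def)
  ultimately show ?thesis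
    using can.can_inverse[OF A xy] o D.inverse_mors_unique[of "Some x" "Some y" "can.can x y"] by simp
qed

text \<open>Deadness is asked of one point only. In a pre-dead pixel every point is killed directly;
  in any other pixel the canonical isomorphisms spread the property.\<close>

lemma zero_object_dead:
  assumes "A \<in> P" "dead X \<Gamma> R P I A" "x \<in> A"
  shows "D.zero_object (Some x)"
proof (cases "pre_dead X \<Gamma> R P I A")
  case True
  then show ?thesis using assms(3) by (rule zero_object_pre_dead)
next
  case False
  then have A: "A \<in> good" using assms(1) by simp
  obtain y where y: "y \<in> A" "isomorphic_objs D (Some y) None"
    using assms(2) unfolding dead_def by blast
  have o: "Some x \<in> Obj D" "Some y \<in> Obj D" using assms y by (auto simp: Some_in pixel_in_X)
  have "D.zero_object (Some y)" by (rule D.zero_object_isomorphic[OF o(2) zero_object_None y(2)])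
  moreover have "isomorphic_objs D (Some x) (Some y)"
    using can.can_inverse[OF A assms(3) y(1)] unfolding isomorphic_objs_def iso_mor_iff by blast
  ultimately show ?thesis by (rule D.zero_object_isomorphic[OF o(1)])
qed

text \<open>Consequently every vertex of the linear quiver is a \<open>good\<close> pixel, in which
  canonical isomorphisms exist.\<close>

lemma dead_of_pre_dead:
  assumes "pre_dead X \<Gamma> R P I A"
  shows "dead X \<Gamma> R P I A"
proof -
  obtain \<rho> where "\<rho> \<in> \<Gamma>" "im \<rho> \<subseteq> A" using assms by (auto simp: pre_dead_def)
  then have x: "\<rho> 0 \<in> A" using ends_in_im(1)[of \<rho>] by blast
  have "isomorphic_objs D (Some (\<rho> 0)) None"
    using D.zero_objects_inverse_mors[OF zero_object_pre_dead[OF assms x] zero_object_None]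
    unfolding isomorphic_objs_def iso_mor_iff by blast
  with x show ?thesis unfolding dead_def by blast
qed

lemma lin_pseudo_arrow_in:
  assumes "lin_pseudo_arrow X \<Gamma> R P I c x y p" "y \<in> X"
  shows "p \<in> Hom D (Some x) (Some y)"
proof -
  from assms(1) obtain \<gamma> \<sigma> where \<gamma>: "\<gamma> \<in> \<Gamma>" "\<gamma> 0 = x" and \<sigma>: "\<sigma> \<in> \<Sigma>B (Some y) (Some (\<gamma> 1))"
    and p: "p = Comp D (Some x) (Some (\<gamma> 1)) (Some y) (lin_loc_inv B \<Sigma>B (Some y) (Some (\<gamma> 1)) \<sigma>)
      (HScale D (Some x) (Some (\<gamma> 1)) c (lin_loc_mor B \<Sigma>B (Some x) (Some (\<gamma> 1)) (qp \<gamma>)))"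
    unfolding lin_pseudo_arrow_def Let_def by blast
  have o: "Some x \<in> Obj D" "Some (\<gamma> 1) \<in> Obj D" "Some y \<in> Obj D"
    using ends_in[OF \<gamma>(1)] \<gamma>(2) assms(2) by (auto simp: Some_in)
  have "lin_loc_inv B \<Sigma>B (Some y) (Some (\<gamma> 1)) \<sigma> \<in> Hom D (Some (\<gamma> 1)) (Some y)"
    using loc.lin_loc_inverse[of "Some y" "Some (\<gamma> 1)" \<sigma>] o \<sigma> by (simp add: D_eq inverse_mors_def)
  then show ?thesis
    unfolding p using can.L_in[OF \<gamma>(1)] \<gamma>(2) o by (intro D.Comp_in D.HScale_in) simp_all
qed

text \<open>The pattern of the nonlinear case, with the adjoined zero object standing for all dead
  pixels. The property \<open>T\<close> must in addition pass to sums, scalar multiples and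
  vanishing morphisms.\<close>

theorem equivalent_lin_pixelation_lin_quiver_cat:
  assumes s: "\<forall>A\<in>P. s A \<in> A"
  shows "equivalent_lincats D (lin_quiver_cat X \<Gamma> R P I s)"
proof -
  define V where "V = {A \<in> P. \<not> dead X \<Gamma> R P I A}"
  have V_good: "A \<in> good" if "A \<in> V" for A using that dead_of_pre_dead by (auto simp: V_def)
  let ?Arr = "lin_quiver_arrows X \<Gamma> R P I s"
  let ?K = "free_cat (quiver V ?Arr)" and ?FM = "\<lambda>u v. free_functor D (Some \<circ> s) v"
  let ?Z = "free_lin_quiver_cat X \<Gamma> R P I s" and ?\<Phi> = "Phi X \<Gamma> R P I s"
  have Z_eq: "?Z = adjoin_zero (linearization ?K)"
    unfolding free_lin_quiver_cat_def lin_pixel_quiver_def V_def ..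
  have sX: "s A \<in> X" "Some (s A) \<in> Obj D" if "A \<in> P" for A using s that pixel_in_X[OF that] by (auto simp: Some_in)
  have Arr: "a \<in> Hom D (Some (s A)) (Some (s A'))" if "A \<in> V" "A' \<in> V" "a \<in> ?Arr A A'" for A A' a
  proof -
    from that(3) obtain w \<tau> p where a: "a = Comp D (Some (s A)) (Some w) (Some (s A')) p
        (lin_loc_inv B \<Sigma>B (Some w) (Some (s A)) \<tau>)"
      and \<tau>: "\<tau> \<in> \<Sigma>B (Some w) (Some (s A))" and p: "lin_pseudo_arrow X \<Gamma> R P I 1 w (s A') p"
      unfolding lin_quiver_arrows_def by blast
    have o: "Some w \<in> Obj D" "Some (s A) \<in> Obj D" "Some (s A') \<in> Obj D" "s A' \<in> X"
      using \<Sigma>B_in[OF \<tau>] sX that(1,2) by (auto simp: Some_in V_def)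
    have "lin_loc_inv B \<Sigma>B (Some w) (Some (s A)) \<tau> \<in> Hom D (Some (s A)) (Some w)"
      using loc.lin_loc_inverse[of "Some w" "Some (s A)" \<tau>] o \<tau> by (simp add: D_eq inverse_mors_def)
    then show ?thesis unfolding a using lin_pseudo_arrow_in[OF p o(4)] o by (intro D.Comp_in)
  qed
  have F0: "is_functor ?K D (Some \<circ> s) ?FM"
    by (rule D.is_functor_free_functor) (use sX Arr in \<open>auto simp: V_def\<close>)
  interpret F0: functor_to_lin ?K D "Some \<circ> s" ?FM
    by (intro functor_to_lin.intro F0 D.lin_category_axioms)
  \<comment> \<open>\<open>Phi\<close> is the linear extension of the evaluation of walks, continued
    by zero to the adjoined object; its linearity and functoriality come from the general
    constructions.\<close>
  have \<Phi>_eq: "?\<Phi> u v h = (case (u, v) of (Some x, Some y) \<Rightarrow> F0.ext x y h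
      | _ \<Rightarrow> HZero D (map_option s u) (map_option s v))" for u v h
    by (simp add: Phi_def lin_extension_def split: option.splits)
  have FO_eq: "case_option None (Some \<circ> s) = map_option s"
    by (rule HOL.ext) (simp split: option.split)
  have F: "is_lin_functor ?Z D (map_option s) ?\<Phi>"
    using is_lin_functor_adjoin_zero[OF F0.is_lin_functor_ext linearization_simps(4) zero_object_None]
    unfolding Z_eq \<Phi>_eq[abs_def] FO_eq .
  interpret F: is_lin_functor ?Z D "map_option s" ?\<Phi> by (rule F)
  have Q_eq: "lin_quiver_cat X \<Gamma> R P I s = quotient_lincat ?Z F.kernel_ideal"
    unfolding lin_quiver_cat_def F.kernel_ideal_def by simp
  have Obj_Z: "u \<in> Obj ?Z \<longleftrightarrow> u = None \<or> (\<exists>A\<in>V. u = Some A)" for u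
    by (auto simp: Z_eq)
  \<comment> \<open>All points of dead pixels retract to \<open>None\<close> together with the
    adjoined object. There \<open>\<theta>\<close> and \<open>\<iota>\<close> are zero morphisms,
    mutually inverse because both ends are zero objects.\<close>
  define a where "a u = (case u of None \<Rightarrow> None | Some x \<Rightarrow> if dead X \<Gamma> R P I (pix x) then None else Some (pix x))"
    for u
  define b where "b u = map_option s (a u)" for u
  define \<theta> where "\<theta> u = (case (u, a u) of (Some x, Some A) \<Rightarrow> can.can x (s A) | _ \<Rightarrow> HZero D u None)" for u
  define \<iota> where "\<iota> u = (case (u, a u) of (Some x, Some A) \<Rightarrow> can.can (s A) x | _ \<Rightarrow> HZero D None u)" for u
  have a_cases: "(u = None \<or> (\<exists>x. u = Some x \<and> dead X \<Gamma> R P I (pix x))) \<and> a u = None \<and> D.zero_object u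
      \<or> (\<exists>x\<in>X. u = Some x \<and> a u = Some (pix x) \<and> pix x \<in> V)" if "u \<in> Obj D" for u
  proof (cases u)
    case None
    then show ?thesis by (simp add: a_def zero_object_None)
  next
    case (Some x)
    then have "x \<in> X" using that by (simp add: Obj_lin_C0)
    then show ?thesis
      using Some pix[of x] zero_object_dead[of "pix x" x] by (cases "dead X \<Gamma> R P I (pix x)") (auto simp: a_def V_def)
  qed
  have a_in: "a u \<in> Obj ?Z" if "u \<in> Obj D" for u
    using a_cases[OF that] by (auto simp: Obj_Z)
  have b_in: "b u \<in> Obj D" if "u \<in> Obj D" for u
    unfolding b_def by (rule F.FO_in[OF a_in[OF that]])
  have b_zero: "D.zero_object (b u)" if "a u = None" for u
    using that zero_object_None by (simp add: b_def)
  interpret fam: iso_family D b \<theta> \<iota>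
  proof (intro iso_family.intro iso_family_axioms.intro D.category_axioms b_in)
    fix u assume u: "u \<in> Obj D"
    from a_cases[OF u] show "inverse_mors D u (b u) (\<theta> u) (\<iota> u)"
    proof (elim disjE bexE conjE)
      fix x assume x: "x \<in> X" "u = Some x" "a u = Some (pix x)" "pix x \<in> V"
      then show ?thesis
        using can.can_inverse[OF V_good[OF x(4)], of x "s (pix x)"] pix[OF x(1)] s
        by (simp add: b_def \<theta>_def \<iota>_def)
    next
      fix x assume "a u = None" "D.zero_object u"
      then show ?thesis using D.zero_objects_inverse_mors[OF _ zero_object_None, of u]
        by (cases u) (simp_all add: b_def \<theta>_def \<iota>_def)
    next
      assume "a u = None" "D.zero_object u"
      then show ?thesis using D.zero_objects_inverse_mors[OF _ zero_object_None, of u]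
        by (cases u) (simp_all add: b_def \<theta>_def \<iota>_def)
    qed
  qed
  define T where "T u v f \<longleftrightarrow> fam.conj_mor u v f \<in> ?\<Phi> (a u) (a v) ` Hom ?Z (a u) (a v)" for u v f
  have T_I: "T u v f" if "fam.conj_mor u v f = ?\<Phi> (a u) (a v) h" "h \<in> Hom ?Z (a u) (a v)" for u v f h
    unfolding T_def that(1) using that(2) by (rule imageI)
  have T_HZero: "T u v f" if "u \<in> Obj D" "v \<in> Obj D" "fam.conj_mor u v f = HZero D (b u) (b v)" for u v f
    using that F.FM_zero[OF a_in a_in, of u v] F.C.HZero_in[OF a_in a_in, of u v]
    by (intro T_I[of u v f "HZero ?Z (a u) (a v)"]) (simp_all add: b_def)
  \<comment> \<open>After transport one end is a zero object, so the morphism is zero and hence the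
    image of 0. This settles every case that touches a dead pixel.\<close>
  have T_zero_object: "T u v f" if o: "u \<in> Obj D" "v \<in> Obj D" and "f \<in> Hom D u v" "a u = None \<or> a v = None" for u v f
    using that(4) b_zero
    by (intro T_HZero[OF o] D.zero_object_Hom b_in o fam.conj_mor_in that(3)) auto
  have T_Comp: "T u w (Comp D u v w g f)"
    if o: "u \<in> Obj D" "v \<in> Obj D" "w \<in> Obj D" and fg: "f \<in> Hom D u v" "g \<in> Hom D v w" "T u v f" "T v w g" for u v w f g
  proof -
    from fg(3,4) obtain p q where p: "p \<in> Hom ?Z (a u) (a v)" "fam.conj_mor u v f = ?\<Phi> (a u) (a v) p"
      and q: "q \<in> Hom ?Z (a v) (a w)" "fam.conj_mor v w g = ?\<Phi> (a v) (a w) q" unfolding T_def by blast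
    show ?thesis
    proof (rule T_I)
      show "Comp ?Z (a u) (a v) (a w) q p \<in> Hom ?Z (a u) (a w)"
        by (intro F.C.Comp_in a_in o p(1) q(1))
      show "fam.conj_mor u w (Comp D u v w g f) = ?\<Phi> (a u) (a w) (Comp ?Z (a u) (a v) (a w) q p)"
        using fam.conj_mor_Comp[OF o fg(1,2)] F.FM_Comp[OF a_in[OF o(1)] a_in[OF o(2)] a_in[OF o(3)] p(1) q(1)]
        by (simp add: p(2) q(2) b_def)
    qed
  qed
  have T_add: "T u v (HAdd D u v f g)"
    if o: "u \<in> Obj D" "v \<in> Obj D" and fg: "f \<in> Hom D u v" "g \<in> Hom D u v" "T u v f" "T u v g" for u v f g
  proof -
    from fg(3,4) obtain p q where p: "p \<in> Hom ?Z (a u) (a v)" "fam.conj_mor u v f = ?\<Phi> (a u) (a v) p"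
      and q: "q \<in> Hom ?Z (a u) (a v)" "fam.conj_mor u v g = ?\<Phi> (a u) (a v) q" unfolding T_def by blast
    have "fam.conj_mor u v (HAdd D u v f g) = HAdd D (b u) (b v) (fam.conj_mor u v f) (fam.conj_mor u v g)"
      using o fg b_in fam.theta_in fam.iota_in
      by (simp add: fam.conj_mor_def D.Comp_add_right D.Comp_add_left D.Comp_in)
    then show ?thesis
      using F.FM_add[OF a_in[OF o(1)] a_in[OF o(2)] p(1) q(1)] F.C.HAdd_in[OF a_in[OF o(1)] a_in[OF o(2)] p(1) q(1)]
      by (intro T_I[of u v _ "HAdd ?Z (a u) (a v) p q"]) (simp_all add: p(2) q(2) b_def)
  qed
  have T_scale: "T u v (HScale D u v c f)"
    if o: "u \<in> Obj D" "v \<in> Obj D" and f: "f \<in> Hom D u v" "T u v f" for u v f c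
  proof -
    from f(2) obtain p where p: "p \<in> Hom ?Z (a u) (a v)" "fam.conj_mor u v f = ?\<Phi> (a u) (a v) p"
      unfolding T_def by blast
    have "fam.conj_mor u v (HScale D u v c f) = HScale D (b u) (b v) c (fam.conj_mor u v f)"
      using o f b_in fam.theta_in fam.iota_in
      by (simp add: fam.conj_mor_def D.Comp_scale_right D.Comp_scale_left D.Comp_in)
    then show ?thesis
      using F.FM_scale[OF a_in[OF o(1)] a_in[OF o(2)] p(1)] F.C.HScale_in[OF a_in[OF o(1)] a_in[OF o(2)] p(1)]
      by (intro T_I[of u v _ "HScale ?Z (a u) (a v) c p"]) (simp_all add: p(2) b_def)
  qed
  have a_pixel: "a (Some x) = (if A \<in> V then Some A else None)" if "A \<in> P" "x \<in> A" for A x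
    using that pix_eqI[of A x] by (simp add: a_def V_def)
  have T_can: "T (Some x) (Some y) (can.can x y)" if A: "A \<in> V" "x \<in> A" "y \<in> A" for A x y
  proof -
    have P: "A \<in> P" using A by (simp add: V_def)
    have eq: "a (Some x) = Some A" "a (Some y) = Some A" using a_pixel[OF P] A by auto
    have "fam.conj_mor (Some x) (Some y) (can.can x y) = Ident D (Some (s A))"
      using A P s can.can_Comp[OF V_good[OF A(1)]] can.can_Ident[OF V_good[OF A(1)]]
      by (simp add: fam.conj_mor_def b_def \<theta>_def \<iota>_def eq)
    also have "\<dots> = ?\<Phi> (Some A) (Some A) (Ident ?Z (Some A))"
      using F.FM_Ident[of "Some A"] A by (simp add: Obj_Z)
    finally show ?thesis
      using F.C.Ident_in[of "Some A"] A by (intro T_I) (simp_all add: eq Obj_Z)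
  qed
  have T_path: "T (Some (\<gamma> 0)) (Some (\<gamma> 1)) (Lq \<gamma>)" if "\<gamma> \<in> \<Gamma>" for \<gamma>
    using that
  proof (induction \<gamma> rule: path_induct)
    case (equiv \<gamma> \<gamma>')
    then show ?case using R_ends[of \<gamma> \<gamma>'] can.L_R[of \<gamma> \<gamma>'] by simp
  next
    case (pixel A x y \<rho>)
    then have \<rho>: "\<rho> \<in> \<Gamma>" "\<rho> 0 = x" "\<rho> 1 = y" "x \<in> A" "y \<in> A"
      using pixel_arrow_in[OF pixel(2)] by (auto simp: pixel_arrow_def)
    show ?case
    proof (cases "A \<in> V")
      case True
      then show ?thesis using T_can[OF True \<rho>(4,5)] can.can_arrow[OF V_good[OF True] pixel(2)] \<rho> by simp
    next
      case False
      then show ?thesis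
        using a_pixel[OF pixel(1) \<rho>(4)] \<rho> can.L_in[OF \<rho>(1)] ends_in[OF \<rho>(1)]
        by (intro T_zero_object) (auto simp: Some_in)
    qed
  next
    case (crossing A A' \<gamma>)
    have g: "\<gamma> 0 \<in> A" "\<gamma> 1 \<in> A'" using crossing by (auto simp: crossing_def)
    have go: "Some (\<gamma> 0) \<in> Obj D" "Some (\<gamma> 1) \<in> Obj D" using ends_in[OF crossing(4)] by (auto simp: Some_in)
    show ?case
    proof (cases "A \<in> V \<and> A' \<in> V")
      case False
      then show ?thesis
        using a_pixel[OF crossing(1) g(1)] a_pixel[OF crossing(2) g(2)] can.L_in[OF crossing(4)] go
        by (intro T_zero_object) auto
    next
      case True
      then have A: "A \<in> good" "A' \<in> good" using V_good by auto
      have eq: "a (Some (\<gamma> 0)) = Some A" "a (Some (\<gamma> 1)) = Some A'"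
        using a_pixel[OF crossing(1) g(1)] a_pixel[OF crossing(2) g(2)] True by auto
      obtain w v \<tau> \<sigma> \<delta> where *: "pixel_arrow \<Gamma> A w (s A) \<tau>" "pixel_arrow \<Gamma> A' (s A') v \<sigma>" "\<delta> \<in> \<Gamma>" "\<delta> 0 = w" "\<delta> 1 = v"
        "two_pixel_path P \<delta>"
        "Comp D (Some (s A)) (Some (\<gamma> 1)) (Some (s A')) (can.can (\<gamma> 1) (s A'))
           (Comp D (Some (s A)) (Some (\<gamma> 0)) (Some (\<gamma> 1)) (Lq \<gamma>) (can.can (s A) (\<gamma> 0)))
         = Comp D (Some (s A)) (Some w) (Some (s A'))
           (Comp D (Some w) (Some v) (Some (s A')) (can.can v (s A')) (Lq \<delta>)) (can.can (s A) w)"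
        by (rule can.crossing_factor[OF A crossing(3-5) bspec[OF s crossing(1)] bspec[OF s crossing(2)]])
      let ?p = "Comp D (Some w) (Some v) (Some (s A')) (can.can v (s A')) (Lq \<delta>)"
      let ?a = "Comp D (Some (s A)) (Some w) (Some (s A')) ?p (can.can (s A) w)"
      have conj: "fam.conj_mor (Some (\<gamma> 0)) (Some (\<gamma> 1)) (Lq \<gamma>) = ?a"
        using *(7) by (simp add: fam.conj_mor_def b_def \<theta>_def \<iota>_def eq)
      have w: "w \<in> A" "v \<in> A'" using pixel_arrow_in[OF *(1)] pixel_arrow_in[OF *(2)] by auto
      have o: "Some w \<in> Obj D" "Some v \<in> Obj D" "Some (s A) \<in> Obj D" "Some (s A') \<in> Obj D"
        using w sX crossing(1,2) by (auto simp: Some_in pixel_in_X)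
      have L\<delta>: "Lq \<delta> \<in> Hom D (Some w) (Some v)" using can.L_in[OF *(3)] *(4,5) by simp
      show ?thesis
      \<comment> \<open>A vanishing fraction is not a pseudo arrow, so the quiver may have no arrow
        for this crossing; its transport is zero and comes from 0.\<close>
      proof (cases "?p = HZero D (Some w) (Some (s A'))")
        case True
        then have "?a = HZero D (Some (s A)) (Some (s A'))"
          using D.Comp_HZero_left[OF o(3,1,4) can.can_in[OF A(1) bspec[OF s crossing(1)] w(1)]] by simp
        then show ?thesis using conj by (intro T_HZero go) (simp add: b_def eq)
      next
        case False
        \<comment> \<open>The coefficient is 1, the one with which the arrows of the quiver are
          recorded.\<close>
        have "lin_pseudo_arrow X \<Gamma> R P I 1 w (s A') ?p"
          unfolding lin_pseudo_arrow_def Let_def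
          using *(3-6) False lin_loc_inv_eq_can[OF A(2) *(2)] qp_in_\<Sigma>B[OF _ _ *(2)] A(2) D.HScale_one[OF o(1,2) L\<delta>]
          by (intro conjI bexI[of _ \<delta>] bexI[of _ "qp \<sigma>"]) simp_all
        then have "?a \<in> ?Arr A A'"
          unfolding lin_quiver_arrows_def
          using lin_loc_inv_eq_can[OF A(1) *(1)] qp_in_\<Sigma>B[OF _ _ *(1)] A(1)
          by (intro CollectI exI[of _ w] exI[of _ "qp \<tau>"] exI[of _ ?p] conjI) simp_all
        then have a: "?a \<in> Hom D (Some (s A)) (Some (s A'))" and walk: "[(A, ?a, A')] \<in> Hom ?K A A'"
          using Arr \<open>A \<in> V \<and> A' \<in> V\<close> by (auto simp: awalk_quiver)
        have "F0.ext A A' (Poly_Mapping.single [(A, ?a, A')] 1) = ?a"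
          using F0.ext_single[of A A' "[(A, ?a, A')]" 1] walk \<open>A \<in> V \<and> A' \<in> V\<close> a o
          by (simp add: D.HScale_one D.Comp_Ident_left)
        then have "fam.conj_mor (Some (\<gamma> 0)) (Some (\<gamma> 1)) (Lq \<gamma>)
            = ?\<Phi> (Some A) (Some A') (Poly_Mapping.single [(A, ?a, A')] 1)"
          unfolding conj by (simp add: \<Phi>_eq)
        then show ?thesis
          using walk by (intro T_I[of _ _ _ "Poly_Mapping.single [(A, ?a, A')] 1"]) (simp_all add: eq Z_eq)
      qed
    qed
  next
    case (concat \<gamma> \<gamma>')
    then show ?case
      using T_Comp[of "Some (\<gamma> 0)" "Some (\<gamma>' 0)" "Some (\<gamma>' 1)" "Lq \<gamma>" "Lq \<gamma>'"] can.L_concat[OF concat.hyps(1-3)]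
        can.L_in[OF concat.hyps(1)] can.L_in[OF concat.hyps(2)] ends_in[OF concat.hyps(1)] ends_in[OF concat.hyps(2)]
      by (simp add: Some_in)
  qed
  \<comment> \<open>Between points, a morphism of the quotient is the class of a linear combination
    of paths, so the case of one path spreads by \<open>T_scale\<close> and
    \<open>T_add\<close>.\<close>
  have T_mor: "T u v (lin_loc_mor B \<Sigma>B u v f)" if o: "u \<in> Obj D" "v \<in> Obj D" and f: "f \<in> Hom B u v" for u v f
  proof (cases "u = None \<or> v = None")
    case True
    then show ?thesis
      using o f loc.lin_loc_mor_in[of u v f] by (intro T_zero_object) (auto simp: D_eq a_def)
  next
    case False
    then obtain x y where uv: "u = Some x" "v = Some y" by auto
    obtain h where h: "h \<in> Hom lin_C0 u v" "f = QJ.cls u v h"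
      using f unfolding B_eq QJ.L_simps by (rule QJ.Hom_Q_cases)
    have o': "u \<in> Obj (lin_C0 :: ('x option, 'x pth set \<Rightarrow>\<^sub>0 'k, 'k) lincat)"
      "v \<in> Obj (lin_C0 :: ('x option, 'x pth set \<Rightarrow>\<^sub>0 'k, 'k) lincat)" using o by simp_all
    have cls_in: "QJ.cls u v g \<in> Hom B u v" if "g \<in> Hom lin_C0 u v" for g
      unfolding B_eq QJ.L_simps by (rule QJ.cls_in[OF o' that])
    have "Poly_Mapping.keys h \<subseteq> Hom C x y" using h(1) by (simp add: uv)
    then have "T u v (lin_loc_mor B \<Sigma>B u v (QJ.cls u v h))"
    proof (induction h rule: keys_subset_induct)
      case zero
      have "QJ.cls u v 0 = HZero B u v" by (simp add: B_eq)
      then have "lin_loc_mor B \<Sigma>B u v (QJ.cls u v 0) = HZero D u v"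
        using loc.lin_loc_mor_zero[of u v] o by (simp add: D_eq)
      moreover have "fam.conj_mor u v (HZero D u v) = HZero D (b u) (b v)"
        using o b_in fam.theta_in fam.iota_in
        by (simp add: fam.conj_mor_def D.Comp_HZero_left D.Comp_HZero_right)
      ultimately show ?case using o by (intro T_HZero) simp_all
    next
      case (single F c)
      then obtain \<gamma> where \<gamma>: "\<gamma> \<in> \<Gamma>" "\<gamma> 0 = x" "\<gamma> 1 = y" "F = R `` {\<gamma>}" by (rule Hom_C_cases)
      have "QJ.cls u v (Poly_Mapping.single F c) = HScale B u v c (qp \<gamma>)"
        using QJ.HScale_L[OF o', of "pmor \<gamma>" c] pmor_in[OF \<gamma>(1), where 'a = 'k] \<gamma>
        by (simp add: qp_eq B_eq uv pmor_def)
      then have "lin_loc_mor B \<Sigma>B u v (QJ.cls u v (Poly_Mapping.single F c)) = HScale D u v c (Lq \<gamma>)"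
        using loc.lin_loc_mor_scale[of u v "qp \<gamma>" c] qp_in[OF \<gamma>(1)] \<gamma> o by (simp add: D_eq uv)
      then show ?case
        using T_scale[OF o, of "Lq \<gamma>" c] T_path[OF \<gamma>(1)] can.L_in[OF \<gamma>(1)] \<gamma> by (simp add: uv)
    next
      case (add g g')
      then have gg': "g \<in> Hom lin_C0 u v" "g' \<in> Hom lin_C0 u v" by (simp_all add: uv)
      have "QJ.cls u v (g + g') = HAdd B u v (QJ.cls u v g) (QJ.cls u v g')"
        using QJ.HAdd_L[OF o' gg'] by (simp add: B_eq uv)
      then show ?case
        using T_add[OF o _ _ add(3,4)] cls_in[OF gg'(1)] cls_in[OF gg'(2)] o
          loc.lin_loc_mor_add[of u v "QJ.cls u v g" "QJ.cls u v g'"] loc.lin_loc_mor_in[of u v]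
        by (simp add: D_eq)
    qed
    then show ?thesis by (simp add: h(2))
  qed
  \<comment> \<open>The inverse of a path in a pixel of \<open>V\<close> is canonical. All other
    members of the inverted class, among them the adjoined zero morphisms, have both ends in a dead
    pixel.\<close>
  have T_inv: "T v u (lin_loc_inv B \<Sigma>B u v \<sigma>)" if o: "u \<in> Obj D" "v \<in> Obj D" and \<sigma>: "\<sigma> \<in> \<Sigma>B u v" for u v \<sigma>
  proof -
    have inv: "lin_loc_inv B \<Sigma>B u v \<sigma> \<in> Hom D v u"
      using loc.lin_loc_inverse[of u v \<sigma>] o \<sigma> by (simp add: D_eq inverse_mors_def)
    show ?thesis
      using \<sigma>
    proof (cases rule: \<Sigma>B_cases)
      case (1 A x y \<rho>)
      have xy: "x \<in> A" "y \<in> A" using pixel_arrow_in[OF 1(2)] by auto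
      show ?thesis
      proof (cases "A \<in> V")
        case True
        then show ?thesis
          using T_can[OF True xy(2,1)] lin_loc_inv_eq_can[OF V_good[OF True] 1(2)] 1 by simp
      next
        case False
        then show ?thesis using a_pixel[OF 1(1) xy(1)] 1 inv o by (intro T_zero_object) auto
      qed
    next
      case (2 A x y)
      then have "A \<notin> V" using dead_of_pre_dead by (simp add: V_def)
      then show ?thesis
        using a_pixel[OF pre_dead_in_P[OF 2(1)] 2(2)] 2 inv o by (intro T_zero_object) auto
    qed
  qed
  have full: "T u v f" if "u \<in> Obj D" "v \<in> Obj D" "f \<in> Hom D u v" for u v f
  proof (rule loc.lin_localization_induct[where T = T])
    show "f \<in> Hom loc.D u v" "u \<in> Obj B" "v \<in> Obj B" using that by (simp_all add: D_eq)
  qed (use T_mor T_inv T_Comp T_add T_scale in \<open>simp_all flip: D_eq\<close>)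
  show ?thesis
  proof (rule equivalent_lincats_of_retraction[OF fam.iso_family_axioms
        F.lin_functor_quotient_kernel[folded Q_eq], where a = a])
    fix u v f assume "u \<in> Obj D" "v \<in> Obj D" "f \<in> Hom D u v"
    then show "fam.conj_mor u v f \<in> (\<lambda>F. ?\<Phi> (a u) (a v) (rep F)) ` Hom (lin_quiver_cat X \<Gamma> R P I s) (a u) (a v)"
      using F.image_quotient_kernel_ideal[of "a u" "a v"] full[of u v f] a_in unfolding T_def Q_eq by blast
  next
    interpret K: quotient_lin_category ?Z F.kernel_ideal by (rule F.quotient_kernel_ideal)
    have Obj_Q: "Obj (lin_quiver_cat X \<Gamma> R P I s) = Obj ?Z" unfolding Q_eq by (rule K.L_simps)
    show "a u \<in> Obj (lin_quiver_cat X \<Gamma> R P I s)" "b u = map_option s (a u)" if "u \<in> Obj D" for u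
      using a_in[OF that] by (simp_all add: Obj_Q b_def)
    show "p = q" if "x \<in> Obj (lin_quiver_cat X \<Gamma> R P I s)" "y \<in> Obj (lin_quiver_cat X \<Gamma> R P I s)"
      "p \<in> Hom (lin_quiver_cat X \<Gamma> R P I s) x y" "q \<in> Hom (lin_quiver_cat X \<Gamma> R P I s) x y"
      "?\<Phi> x y (rep p) = ?\<Phi> x y (rep q)" for x y p q
      using that F.faithful_quotient_kernel_ideal[of x y p q] unfolding Q_eq K.L_simps(1) by blast
    \<comment> \<open>The retraction is strict on the image of the quiver: at \<open>None\<close>
      the zero morphism is the identity, and \<open>s A\<close> lies in the pixel
      \<open>A\<close>.\<close>
    fix c assume "c \<in> Obj (lin_quiver_cat X \<Gamma> R P I s)"
    then consider "c = None" | A where "c = Some A" "A \<in> V" unfolding Obj_Q Obj_Z by blast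
    then show "a (map_option s c) = c" "\<theta> (map_option s c) = Ident D (map_option s c)"
    proof (atomize (full), cases)
      case 1
      then show "a (map_option s c) = c \<and> \<theta> (map_option s c) = Ident D (map_option s c)"
        using zero_object_None by (simp add: a_def \<theta>_def D.zero_object_def)
    next
      case (2 A)
      then have "A \<in> P" "s A \<in> A" using s by (auto simp: V_def)
      then show "a (map_option s c) = c \<and> \<theta> (map_option s c) = Ident D (map_option s c)"
        using 2 a_pixel[of A "s A"] can.can_Ident[OF V_good[OF 2(2)]] by (simp add: \<theta>_def)
    qed
  qed
qed

end

text \<open>\<open>path_based_ideal\<close> determines \<open>I\<close> only at objects, so
  \<open>I\<close> agrees with a generated ideal there and not as a function.\<close>

lemma lin_ideal_cong:
  assumes "\<And>u v. u \<in> Obj A \<Longrightarrow> v \<in> Obj A \<Longrightarrow> I u v = I' u v" "lin_ideal A I'"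
  shows "lin_ideal A I"
  using assms unfolding lin_ideal_def by simp

lemma (in path_triple) lin_ideal_path_based:
  fixes I :: "('x, 'k::{comm_ring,comm_monoid_mult}) path_ideal"
  assumes "path_based_ideal X \<Gamma> R I"
  shows "lin_ideal (lin_path_cat X \<Gamma> R) I"
proof -
  let ?A = "lin_C0 :: ('x option, 'x pth set \<Rightarrow>\<^sub>0 'k, 'k) lincat"
  obtain S where S: "\<forall>u\<in>Obj ?A. \<forall>v\<in>Obj ?A. I u v = generated_ideal ?A S u v"
    using assms unfolding path_based_ideal_def by (elim exE conjE) (rule that)
  show ?thesis
  proof (rule lin_ideal_cong)
    show "lin_ideal ?A (generated_ideal ?A S)"
      by (intro lin_ideal_generated_ideal lin_category_lin_C0)
    show "I u v = generated_ideal ?A S u v" if "u \<in> Obj ?A" "v \<in> Obj ?A" for u v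
      using S that by simp
  qed
qed

theorem theorem2p37:
  fixes X :: "'x set" and \<Gamma> :: "(real \<Rightarrow> 'x) set" and R :: "(real \<Rightarrow> 'x) rel" and P :: "'x set set"
    and I :: "('x, 'k::{comm_ring,comm_monoid_mult}) path_ideal"
    and s :: "'x set \<Rightarrow> 'x"
  assumes "screen X \<Gamma> R P"
    and "path_based_ideal X \<Gamma> R I"
    and "\<forall>A\<in>P. s A \<in> A"
  shows "equivalent_cats (pixelation X \<Gamma> R P) (quiver_cat X \<Gamma> R P s) \<and>
    equivalent_lincats (lin_pixelation X \<Gamma> R P I) (lin_quiver_cat X \<Gamma> R P I s)"
proof
  interpret screen X \<Gamma> R P by (rule assms(1))
  interpret lin_screen X \<Gamma> R P I
    by (intro lin_screen.intro lin_screen_axioms.intro assms(1) lin_ideal_path_based assms(2))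
  show "equivalent_cats (pixelation X \<Gamma> R P) (quiver_cat X \<Gamma> R P s)"
    by (rule equivalent_pixelation_quiver_cat[OF assms(3)])
  show "equivalent_lincats (lin_pixelation X \<Gamma> R P I) (lin_quiver_cat X \<Gamma> R P I s)"
    by (rule equivalent_lin_pixelation_lin_quiver_cat[OF assms(3)])
qed

end
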